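(* Fix $\alpha,\beta>0$ and consider the random walk in the i.i.d. Beta$(\alpha,\beta)$ environment described in the context. For each fixed $\xi\in\mathrm{ri}\,\mathcal U$ there is an event $\Omega^{(\xi)}$ such that $\mathbb P(\Omega^{(\xi)})=1$ and the following holds for every $\omega\in\Omega^{(\xi)}$: if $z_N\in\mathbb Z^2$ is any sequence such that $|z_N|_1=N$ and $z_N/N\to\xi$, then the conditioned quenched path distribution $P^\omega_0(\,\cdot\mid X_N=z_N)$ converges weakly, on the path space $(\mathbb Z^2)^{\mathbb Z_+}$, as $N\to\infty$, to the Doob-transformed path measure $P^{\kappa^\xi(\omega)}_0$.
   Context: Let $e_1=(1,0)$, $e_2=(0,1)$, $|x|_1=|x_1|+|x_2|$. Fix $\alpha,\beta>0$. The environment space is $\Omega=[0,1]^{\mathbb Z^2}$; under $\mathbb P$ the coordinates $\omega_{x,x+e_1}$, $x\in\mathbb Z^2$, are i.i.d. Beta$(\alpha,\beta)$, and $\omega_{x,x+e_2}=1-\omega_{x,x+e_1}$. For nearest-neighbor transition probabilities $p=(p_{y,y+e_i})$ on $\mathbb Z^2$ with $p_{y,y+e_1}+p_{y,y+e_2}=1$, $P^p_x$ denotes the law on $(\mathbb Z^2)^{\mathbb Z_+}$ of the Markov chain $(X_n)_{n\ge0}$ with $X_0=x$ and $P^p_x(X_{n+1}=y+e_i\mid X_n=y)=p_{y,y+e_i}$. Let $\mathrm{ri}\,\mathcal U=\{te_1+(1-t)e_2:0<t<1\}$. For each $\xi\in\mathrm{ri}\,\mathcal U$, the process $B^\xi=\{B^\xi_{x,y}(\omega):x,y\in\mathbb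 Z^2\}$ is defined $\mathbb P$-a.s. by $$B^\xi_{x,y}(\omega)=\lim_{N\to\infty}\big(\log P^\omega_x\{X_{|z_N-x|_1}=z_N\}-\log P^\omega_y\{X_{|z_N-y|_1}=z_N\}\big),$$ where $z_N\in\mathbb Z^2$ is any sequence with $|z_N|_1\to\infty$, $z_N/|z_N|_1\to\xi$ (the paper proves that, $\mathbb P$-a.s., the limit exists for all $x,y$ and all such sequences and does not depend on the sequence). It satisfies $\omega_{x,x+e_1}e^{-B^\xi_{x,x+e_1}}+\omega_{x,x+e_2}e^{-B^\xi_{x,x+e_2}}=1$, so $\kappa^\xi_{x,x+e_i}(\omega)=\omega_{x,x+e_i}e^{-B^\xi_{x,x+e_i}(\omega)}$, $i\in\{1,2\}$, defines a transition probability on $\mathbb Z^2$. *)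

theory Defs
  imports "HOL-Probability.Probability" "HOL-Real_Asymp.Real_Asymp"
begin

type_synonym site = "int \<times> int"

definition e1 :: site where "e1 = (1, 0)"

definition e2 :: site where "e2 = (0, 1)"

definition l1 :: "site \<Rightarrow> nat" where
  "l1 x = nat (\<bar>fst x\<bar> + \<bar>snd x\<bar>)"

definition rvec :: "site \<Rightarrow> real \<times> real" where
  "rvec x = (real_of_int (fst x), real_of_int (snd x))"

definition riU :: "(real \<times> real) set" where
  "riU = {t *\<^sub>R rvec e1 + (1 - t) *\<^sub>R rvec e2 | t. 0 < t \<and> t < 1}"

section \<open>The Beta environment\<close>

definition beta_measure :: "real \<Rightarrow> real \<Rightarrow> real measure" where
  "beta_measure \<alpha> \<beta> = density (restrict_space lborel {0..1})
     (\<lambda>t. ennreal (t powr (\<alpha> - 1) * (1 - t) powr (\<beta> - 1) / Beta \<alpha> \<beta>))"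

text \<open>An environment is stored as the function that sends \<open>x\<close> to the probability of the step
  from \<open>x\<close> to \<open>x + e1\<close>; the underlying space of \<open>env_measure\<close> is \<open>[0,1]\<close> to the power \<open>site\<close>.\<close>

definition env_measure :: "real \<Rightarrow> real \<Rightarrow> (site \<Rightarrow> real) measure" where
  "env_measure \<alpha> \<beta> = PiM UNIV (\<lambda>_. beta_measure \<alpha> \<beta>)"

definition env_trans :: "(site \<Rightarrow> real) \<Rightarrow> site \<Rightarrow> site \<Rightarrow> real" where
  "env_trans \<omega> x y = (if y = x + e1 then \<omega> x else if y = x + e2 then 1 - \<omega> x else 0)"

section \<open>Path measures\<close>

definition nn_trans :: "(site \<Rightarrow> site \<Rightarrow> real) \<Rightarrow> bool" where
  "nn_trans p \<longleftrightarrow> (\<forall>y. 0 \<le> p y (y + e1) \<and> 0 \<le> p y (y + e2) \<and>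
     p y (y + e1) + p y (y + e2) = 1 \<and> (\<forall>z. z \<noteq> y + e1 \<longrightarrow> z \<noteq> y + e2 \<longrightarrow> p y z = 0))"

text \<open>\<open>step_kernel p x n X\<close> is the conditional law of the \<open>n\<close>-th position given the earlier
  positions \<open>X 0, \<dots>, X (n - 1)\<close>.\<close>

fun step_kernel :: "(site \<Rightarrow> site \<Rightarrow> real) \<Rightarrow> site \<Rightarrow> nat \<Rightarrow> (nat \<Rightarrow> site) \<Rightarrow> site measure" where
  "step_kernel p x 0 X = return (count_space UNIV) x"
| "step_kernel p x (Suc n) X = density (count_space UNIV) (\<lambda>z. ennreal (p (X n) z))"

text \<open>The law of the Markov chain with transition probabilities \<open>p\<close> started at \<open>x\<close>, from the
  Ionescu-Tulcea theorem. It is meaningful for \<open>nn_trans p\<close>; see \<open>emeasure_path_law_cylinder\<close>.\<close>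

definition path_law :: "(site \<Rightarrow> site \<Rightarrow> real) \<Rightarrow> site \<Rightarrow> (nat \<Rightarrow> site) measure" where
  "path_law p x = projective_family.lim UNIV
     (Ionescu_Tulcea.CI (step_kernel p x) (\<lambda>_. count_space UNIV)) (\<lambda>_. count_space UNIV)"

definition hit_prob :: "(site \<Rightarrow> real) \<Rightarrow> site \<Rightarrow> site \<Rightarrow> real" where
  "hit_prob \<omega> x z = measure (path_law (env_trans \<omega>) x) {X. X (l1 (z - x)) = z}"

text \<open>If \<open>X N = z\<close> has probability \<open>0\<close> under \<open>path_law p x\<close>, the following is the null measure.\<close>

definition cond_path_law ::
    "(site \<Rightarrow> site \<Rightarrow> real) \<Rightarrow> site \<Rightarrow> nat \<Rightarrow> site \<Rightarrow> (nat \<Rightarrow> site) measure" where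
  "cond_path_law p x N z = uniform_measure (path_law p x) {X. X N = z}"

text \<open>Weak convergence, for the topology of the type \<open>'a\<close>. On \<open>nat \<Rightarrow> site\<close> this is the product
  topology of the discrete topology on \<open>site\<close>.\<close>

definition weakly_converges :: "(nat \<Rightarrow> 'a::topological_space measure) \<Rightarrow> 'a measure \<Rightarrow> bool" where
  "weakly_converges M \<mu> \<longleftrightarrow> (\<forall>f :: 'a \<Rightarrow> real. continuous_on UNIV f \<longrightarrow> bounded (range f) \<longrightarrow>
     (\<lambda>N. integral\<^sup>L (M N) f) \<longlonglongrightarrow> integral\<^sup>L \<mu> f)"

section \<open>The Busemann process and the Doob transform\<close>

definition to_infinity_in_direction :: "(nat \<Rightarrow> site) \<Rightarrow> real \<times> real \<Rightarrow> bool" where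
  "to_infinity_in_direction z \<xi> \<longleftrightarrow> filterlim (\<lambda>N. l1 (z N)) at_top sequentially \<and>
     (\<lambda>N. rvec (z N) /\<^sub>R real (l1 (z N))) \<longlonglongrightarrow> \<xi>"

definition is_busemann_limit :: "real \<times> real \<Rightarrow> (site \<Rightarrow> real) \<Rightarrow> site \<Rightarrow> site \<Rightarrow> real \<Rightarrow> bool" where
  "is_busemann_limit \<xi> \<omega> x y b \<longleftrightarrow> (\<forall>z. to_infinity_in_direction z \<xi> \<longrightarrow>
     (\<lambda>N. ln (hit_prob \<omega> x (z N)) - ln (hit_prob \<omega> y (z N))) \<longlonglongrightarrow> b)"

text \<open>The common limit along all sequences in direction \<open>\<xi>\<close>; unspecified for those \<open>\<omega>\<close> for which
  there is none.\<close>

definition busemann :: "real \<times> real \<Rightarrow> (site \<Rightarrow> real) \<Rightarrow> site \<Rightarrow> site \<Rightarrow> real" where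
  "busemann \<xi> \<omega> x y = (THE b. is_busemann_limit \<xi> \<omega> x y b)"

definition kappa :: "real \<times> real \<Rightarrow> (site \<Rightarrow> real) \<Rightarrow> site \<Rightarrow> site \<Rightarrow> real" where
  "kappa \<xi> \<omega> x y = env_trans \<omega> x y * exp (- busemann \<xi> \<omega> x y)"

section \<open>Well-definedness\<close>

lemma prob_space_beta_measure:
  assumes "\<alpha> > 0" "\<beta> > 0"
  shows "prob_space (beta_measure \<alpha> \<beta>)"
proof
  let ?f = "\<lambda>t::real. t powr (\<alpha> - 1) * (1 - t) powr (\<beta> - 1)"
  have B: "Beta \<alpha> \<beta> > 0"
    using assms by (simp add: Beta_def Gamma_real_pos)
  have "((\<lambda>t. ?f t / Beta \<alpha> \<beta>) has_integral Beta \<alpha> \<beta> / Beta \<alpha> \<beta>) {0..1}"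
    using has_integral_Beta_real[OF assms] by (rule has_integral_divide)
  then have "((\<lambda>t. ?f t / Beta \<alpha> \<beta>) has_integral 1) {0..1}"
    using B by simp
  then have "((\<lambda>t. if t \<in> {0..1} then ?f t / Beta \<alpha> \<beta> else 0) has_integral 1) UNIV"
    by (simp only: has_integral_restrict_UNIV)
  then have "(\<integral>\<^sup>+ t. ennreal (if t \<in> {0..1} then ?f t / Beta \<alpha> \<beta> else 0) \<partial>lborel) = ennreal 1"
    using B by (intro nn_integral_has_integral_lborel) auto
  moreover have "emeasure (beta_measure \<alpha> \<beta>) (space (beta_measure \<alpha> \<beta>)) =
      (\<integral>\<^sup>+ t. ennreal (?f t / Beta \<alpha> \<beta>) \<partial>restrict_space lborel {0..1})"
    unfolding beta_measure_def
    by (subst emeasure_density)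
       (auto intro!: nn_integral_cong measurable_restrict_space1
          simp: indicator_def space_restrict_space sets_restrict_space_iff)
  moreover have "\<dots> = (\<integral>\<^sup>+ t. ennreal (if t \<in> {0..1} then ?f t / Beta \<alpha> \<beta> else 0) \<partial>lborel)"
    by (subst nn_integral_restrict_space) (auto intro!: nn_integral_cong split: split_indicator)
  ultimately show "emeasure (beta_measure \<alpha> \<beta>) (space (beta_measure \<alpha> \<beta>)) = 1"
    by simp
qed

lemma prob_space_env_measure:
  assumes "\<alpha> > 0" "\<beta> > 0"
  shows "prob_space (env_measure \<alpha> \<beta>)"
  unfolding env_measure_def by (rule prob_space_PiM) (rule prob_space_beta_measure[OF assms])

lemma space_env_measure: "space (env_measure \<alpha> \<beta>) = {\<omega>. \<forall>x. \<omega> x \<in> {0..1}}"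
  by (auto simp: env_measure_def beta_measure_def space_PiM space_restrict_space PiE_iff)

lemma nn_trans_env_trans: "\<omega> \<in> space (env_measure \<alpha> \<beta>) \<Longrightarrow> nn_trans (env_trans \<omega>)"
  unfolding space_env_measure nn_trans_def env_trans_def e1_def e2_def by auto

lemma nn_trans_nonneg: "nn_trans p \<Longrightarrow> 0 \<le> p y z"
  unfolding nn_trans_def by (metis order_refl)

lemma prob_space_step:
  assumes "nn_trans p"
  shows "prob_space (density (count_space UNIV) (\<lambda>z. ennreal (p y z)))"
proof
  have ne: "y + e1 \<noteq> y + e2"
    by (simp add: e1_def e2_def)
  have "(\<integral>\<^sup>+ z. ennreal (p y z) \<partial>count_space UNIV) =
      (\<Sum>z\<in>{y + e1, y + e2}. ennreal (p y z))"
    using assms by (intro nn_integral_count_space') (auto simp: nn_trans_def simp del: split_paired_All)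
  also have "\<dots> = 1"
    using assms ne by (simp add: nn_trans_def del: split_paired_All flip: ennreal_plus)
  finally show "emeasure (density (count_space UNIV) (\<lambda>z. ennreal (p y z)))
      (space (density (count_space UNIV) (\<lambda>z. ennreal (p y z)))) = 1"
    by (simp add: emeasure_density)
qed

lemma Ionescu_Tulcea_step_kernel:
  assumes "nn_trans p"
  shows "Ionescu_Tulcea (step_kernel p x) (\<lambda>_. count_space UNIV)"
proof (rule Ionescu_Tulcea.intro)
  show "prob_space (step_kernel p x i X)" for i X
    using prob_space_step[OF assms] by (cases i) (auto intro: prob_space_return)
  fix i
  show "step_kernel p x i \<in> measurable (PiM {0..<i} (\<lambda>_. count_space UNIV))
      (subprob_algebra (count_space UNIV))"
  proof (cases i)
    case 0
    have eq: "step_kernel p x i = (\<lambda>_. return (count_space UNIV) x)"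
      using 0 by (simp add: fun_eq_iff)
    have "return (count_space UNIV) x \<in> space (subprob_algebra (count_space UNIV))"
      using prob_space_return[of x "count_space UNIV"]
      by (simp add: space_subprob_algebra prob_space_imp_subprob_space)
    then show ?thesis unfolding eq by (rule measurable_const)
  next
    case (Suc n)
    have "(\<lambda>X. density (count_space UNIV) (\<lambda>z. ennreal (p (X n) z)))
        \<in> measurable (PiM {0..<Suc n} (\<lambda>_. count_space UNIV)) (subprob_algebra (count_space UNIV))"
    proof (rule measurable_compose[where f = "\<lambda>X. X n" and N = "count_space UNIV"])
      show "(\<lambda>X. X n) \<in> measurable (PiM {0..<Suc n} (\<lambda>_. count_space UNIV)) (count_space UNIV)"
        by (rule measurable_component_singleton) simp
      show "(\<lambda>y. density (count_space UNIV) (\<lambda>z. ennreal (p y z)))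
          \<in> measurable (count_space UNIV) (subprob_algebra (count_space UNIV))"
        using prob_space_step[OF assms]
        by (auto simp: space_subprob_algebra intro: prob_space_imp_subprob_space)
    qed
    moreover have "step_kernel p x i = (\<lambda>X. density (count_space UNIV) (\<lambda>z. ennreal (p (X n) z)))"
      using Suc by (simp add: fun_eq_iff)
    ultimately show ?thesis using Suc by simp
  qed
qed

instance int :: second_countable_topology
proof
  show "\<exists>B::int set set. countable B \<and> open = generate_topology B"
    by (intro exI[of _ "range lessThan \<union> range greaterThan"]) (auto simp: open_int_def)
qed

lemma sets_path_law:
  assumes "nn_trans p"
  shows "sets (path_law p x) = sets (borel :: (nat \<Rightarrow> site) measure)"
proof -
  interpret Ionescu_Tulcea "step_kernel p x" "\<lambda>_. count_space UNIV"
    by (rule Ionescu_Tulcea_step_kernel[OF assms])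
  have "sets (PiM UNIV (\<lambda>_::nat. count_space UNIV :: site measure)) = sets borel"
    using sets_PiM_equal_borel[where 'a = nat and 'b = site]
      sets_PiM_cong[OF refl, of UNIV "\<lambda>_::nat. borel :: site measure" "\<lambda>_. count_space UNIV"]
    by (simp add: sets_borel_eq_count_space)
  then show ?thesis unfolding path_law_def by simp
qed

lemma prob_space_path_law:
  assumes "nn_trans p"
  shows "prob_space (path_law p x)"
proof -
  interpret Ionescu_Tulcea "step_kernel p x" "\<lambda>_. count_space UNIV"
    by (rule Ionescu_Tulcea_step_kernel[OF assms])
  have "prob_space (distr PF.lim (PiM {} (\<lambda>_. count_space UNIV)) (\<lambda>x. restrict x {}))"
    by (subst distr_lim) (auto intro: PF.prob_space_P)
  then show ?thesis
    unfolding path_law_def by (rule prob_space_distrD[rotated]) (simp add: measurable_cong_sets[OF PF.sets_lim])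
qed

text \<open>These cylinder probabilities characterise \<open>path_law p x\<close> as the law of the Markov chain with
  initial state \<open>x\<close> and transition probabilities \<open>p\<close>.\<close>

lemma emeasure_path_law_cylinder:
  assumes "nn_trans p"
  shows "emeasure (path_law p x) {X. \<forall>i\<le>n. X i = a i} =
    ennreal (of_bool (a 0 = x) * (\<Prod>i<n. p (a i) (a (Suc i))))"
proof -
  interpret Ionescu_Tulcea "step_kernel p x" "\<lambda>_. count_space UNIV"
    by (rule Ionescu_Tulcea_step_kernel[OF assms])
  define A where "A n = PiE {0..<Suc n} (\<lambda>i. {a i})" for n
  have A[measurable]: "A n \<in> sets (PiM {0..<Suc n} (\<lambda>_. count_space UNIV))" for n
    unfolding A_def by (intro sets_PiM_I_finite) auto
  have upd: "(\<lambda>y. fun_upd X n y) -` A n =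
      (if \<forall>i<n. X i = a i then {a n} else {})"
    if "X \<in> space (PiM {0..<n} (\<lambda>_. count_space UNIV))" for X n
    using that by (auto simp: A_def PiE_iff space_PiM extensional_def Ball_def less_Suc_eq
      split: if_splits simp del: split_paired_All)
  have eP_A: "emeasure (eP n X) (A n) =
      (if \<forall>i<n. X i = a i then emeasure (step_kernel p x n X) {a n} else 0)"
    if "X \<in> space (PiM {0..<n} (\<lambda>_. count_space UNIV))" for X n
    using emeasure_eP[OF that A] unfolding upd[OF that] by auto
  have C_A: "emeasure (C 0 (Suc n) (\<lambda>_. undefined)) (A n) =
      ennreal (of_bool (a 0 = x) * (\<Prod>i<n. p (a i) (a (Suc i))))" for n
  proof (induction n)
    case 0
    have u: "(\<lambda>_. undefined) \<in> space (PiM {0..<0::nat} (\<lambda>_. count_space (UNIV :: site set)))"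
      by (simp add: space_PiM)
    have "C 0 (Suc 0) (\<lambda>_. undefined) = eP 0 (\<lambda>_. undefined)"
      using bind_return[OF measurable_eP u] by simp
    then show ?case
      using eP_A[OF u] by (simp add: indicator_def)
  next
    case (Suc n)
    let ?C = "C 0 (Suc n) (\<lambda>_. undefined)"
    have u: "(\<lambda>_. undefined) \<in> space (PiM {0..<0::nat} (\<lambda>_. count_space (UNIV :: site set)))"
      by (simp add: space_PiM)
    have sp: "space ?C = space (PiM {0..<Suc n} (\<lambda>_. count_space UNIV))"
      using space_C[OF u, of "Suc n"] by simp
    have st: "sets ?C = sets (PiM {0..<Suc n} (\<lambda>_. count_space UNIV))"
      using sets_C[OF u, of "Suc n"] by simp
    have eP: "eP (Suc n) \<in> measurable ?C
        (subprob_algebra (PiM {0..<Suc (Suc n)} (\<lambda>_. count_space UNIV)))"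
      unfolding measurable_cong_sets[OF st refl] by (rule measurable_eP)
    have ne: "space ?C \<noteq> {}"
      unfolding sp by (simp add: space_PiM PiE_eq_empty_iff)
    have "C 0 (Suc (Suc n)) (\<lambda>_. undefined) = ?C \<bind> eP (Suc n)"
      by simp
    then have "emeasure (C 0 (Suc (Suc n)) (\<lambda>_. undefined)) (A (Suc n)) =
        (\<integral>\<^sup>+ X. emeasure (eP (Suc n) X) (A (Suc n)) \<partial>?C)"
      by (simp only: emeasure_bind[OF ne eP A])
    also have "\<dots> = (\<integral>\<^sup>+ X. ennreal (p (a n) (a (Suc n))) * indicator (A n) X \<partial>?C)"
    proof (rule nn_integral_cong)
      fix X assume "X \<in> space ?C"
      then have X: "X \<in> space (PiM {0..<Suc n} (\<lambda>_. count_space UNIV))"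
        using sp by simp
      have "X \<in> A n \<longleftrightarrow> (\<forall>i<Suc n. X i = a i)"
        using X by (auto simp: A_def space_PiM PiE_iff)
      then show "emeasure (eP (Suc n) X) (A (Suc n)) =
          ennreal (p (a n) (a (Suc n))) * indicator (A n) X"
        by (auto simp: eP_A[OF X] emeasure_density)
    qed
    also have "\<dots> = ennreal (p (a n) (a (Suc n))) * emeasure ?C (A n)"
      using A[of n] st by (subst nn_integral_cmult_indicator) simp_all
    finally show ?case
      unfolding Suc.IH
      by (simp add: ennreal_mult[symmetric] prod_nonneg nn_trans_nonneg[OF assms] mult_ac)
  qed
  have "{X. \<forall>i\<le>n. X i = a i} = PF.emb UNIV {0..<Suc n} (A n)"
    by (auto simp: A_def prod_emb_def space_PiM PiE_iff)
  then have "emeasure (path_law p x) {X. \<forall>i\<le>n. X i = a i} = emeasure (CI {0..<Suc n}) (A n)"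
    unfolding path_law_def by (simp only: lim[OF finite_atLeastLessThan A])
  also have "\<dots> = emeasure (C 0 (Suc n) (\<lambda>_. undefined)) (PF.emb {0..<Suc n} {0..<Suc n} (A n))"
    by (rule emeasure_CI[OF order_refl A])
  also have "PF.emb {0..<Suc n} {0..<Suc n} (A n) = A n"
    by (rule prod_emb_id) (auto simp: A_def PiE_iff)
  finally show ?thesis
    unfolding C_A .
qed

lemma exists_to_infinity_in_direction:
  assumes "\<xi> \<in> riU"
  shows "\<exists>z. to_infinity_in_direction z \<xi>"
proof -
  obtain t where t: "0 < t" "t < 1" and \<xi>: "\<xi> = (t, 1 - t)"
    using assms by (auto simp: riU_def rvec_def e1_def e2_def)
  define z where "z N = (\<lfloor>t * real N\<rfloor>, int N - \<lfloor>t * real N\<rfloor>)" for N :: nat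
  have fl: "0 \<le> \<lfloor>t * real N\<rfloor>" "\<lfloor>t * real N\<rfloor> \<le> int N" for N
  proof -
    show "0 \<le> \<lfloor>t * real N\<rfloor>" using t by simp
    have "t * real N \<le> real N" using t by (simp add: mult_left_le_one_le)
    then show "\<lfloor>t * real N\<rfloor> \<le> int N" by linarith
  qed
  have l1: "l1 (z N) = N" for N
    using fl[of N] by (simp add: l1_def z_def)
  have lim: "(\<lambda>N. real_of_int \<lfloor>t * real N\<rfloor> / real N) \<longlonglongrightarrow> t"
    by real_asymp
  have "(\<lambda>N. (real_of_int \<lfloor>t * real N\<rfloor> / real N, 1 - real_of_int \<lfloor>t * real N\<rfloor> / real N))
      \<longlonglongrightarrow> (t, 1 - t)"
    by (intro tendsto_Pair tendsto_diff tendsto_const lim)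
  moreover have "eventually (\<lambda>N. (real_of_int \<lfloor>t * real N\<rfloor> / real N,
      1 - real_of_int \<lfloor>t * real N\<rfloor> / real N) = rvec (z N) /\<^sub>R real N) sequentially"
    using eventually_gt_at_top[of 0]
    by eventually_elim (simp add: rvec_def z_def field_simps)
  ultimately have "(\<lambda>N. rvec (z N) /\<^sub>R real N) \<longlonglongrightarrow> \<xi>"
    unfolding \<xi> by (rule Lim_transform_eventually)
  then have "to_infinity_in_direction z \<xi>"
    unfolding to_infinity_in_direction_def l1 by (simp add: filterlim_ident)
  then show ?thesis by blast
qed

lemma busemann_eqI:
  assumes "\<xi> \<in> riU" and "is_busemann_limit \<xi> \<omega> x y b"
  shows "busemann \<xi> \<omega> x y = b"
  unfolding busemann_def
proof (rule the_equality)
  show "is_busemann_limit \<xi> \<omega> x y b" by (rule assms(2))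
  fix b' assume b': "is_busemann_limit \<xi> \<omega> x y b'"
  obtain z where "to_infinity_in_direction z \<xi>"
    using exists_to_infinity_in_direction[OF assms(1)] ..
  then show "b' = b"
    using assms(2) b' unfolding is_busemann_limit_def by (blast intro: LIMSEQ_unique)
qed

lemma nn_trans_kappa:
  assumes "\<omega> \<in> space (env_measure \<alpha> \<beta>)"
    and "\<And>x. kappa \<xi> \<omega> x (x + e1) + kappa \<xi> \<omega> x (x + e2) = 1"
  shows "nn_trans (kappa \<xi> \<omega>)"
  unfolding nn_trans_def
proof (intro allI conjI impI)
  fix y z
  show "kappa \<xi> \<omega> y (y + e1) + kappa \<xi> \<omega> y (y + e2) = 1" by (rule assms(2))
  have "0 \<le> kappa \<xi> \<omega> y z" for z
    using nn_trans_nonneg[OF nn_trans_env_trans[OF assms(1)]] by (simp add: kappa_def)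
  then show "0 \<le> kappa \<xi> \<omega> y (y + e1)" "0 \<le> kappa \<xi> \<omega> y (y + e2)" by auto
  assume "z \<noteq> y + e1" "z \<noteq> y + e2"
  then show "kappa \<xi> \<omega> y z = 0" by (simp add: kappa_def env_trans_def)
qed

end

theory Submission
  imports Defs
begin

text \<open>
  Total positivity of the quenched transition probabilities makes the ratio of the hitting
  probabilities of \<open>z\<close> from \<open>e1\<close> and from \<open>e2\<close> increasing as \<open>z\<close> moves to the right along an
  antidiagonal. For every \<open>l > 0\<close> the environment of a quadrant carries, on an extension of its
  probability space, a positive harmonic function with independent Beta increments along the two
  axes; the construction preserves all product laws because each local step is an exchange of two
  independent Beta variables. An annealed estimate (Cauchy--Schwarz, with the harmonic function of
  a second parameter bounding the transition probabilities) shows that the Doob transform by this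
  function has a velocity, which strictly increases with \<open>l\<close> and exhausts the directions to the left
  of the mean drift; the other directions follow by reflection. Parameters whose velocities lie
  on either side of \<open>\<xi>\<close> therefore bound the upper and lower limits of the hitting ratio by
  variables with means close to each other, so that the two limits agree almost surely. The limits
  of the ratios give the Busemann increments, hence convergence of all cylinder probabilities.
\<close>

section \<open>Beta laws\<close>

text \<open>The arrays for two values of \<open>l\<close> are never put on one probability space:
  all they share is the law of their environment. Harmonic functions for different \<open>l\<close>
  are therefore compared through expectations only. This is why the velocity is obtained from
  moments, and why upper and lower limits of the ratio are identified through their integrals: the
  bounding variable has mean l / (l + \<alpha> + \<beta>), which is continuous in \<open>l\<close>.
  The velocity is a critical point. In direction (t, 1 - t) minus the logarithm of the harmonic
  function grows at mean rate t * \<open>mean1 l\<close> + (1 - t) * \<open>mean2 l\<close>, whose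
  derivative in \<open>l\<close> vanishes exactly when \<open>velocity l\<close> = t. Otherwise some
  nearby \<open>m\<close> has a smaller rate, and the harmonic function for \<open>m\<close> bounds
  the transition probabilities well enough to make the mass of the transform for \<open>l\<close>
  exponentially small near that direction. The direction of the mean drift itself is the velocity of
  no \<open>l\<close>, neither directly nor after reflection. There \<open>l\<close> tending to
  infinity bounds both the ratio and its inverse from below by 1.\<close>

definition beta_law :: "real \<Rightarrow> real \<Rightarrow> real measure" where
  "beta_law p q = density lborel
     (\<lambda>t. ennreal (indicator {0<..<1} t * (t powr (p - 1) * (1 - t) powr (q - 1) / Beta p q)))"

lemma sets_beta_law [measurable_cong, simp]: "sets (beta_law p q) = sets borel"
  and space_beta_law [simp]: "space (beta_law p q) = UNIV"
  by (simp_all add: beta_law_def)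

lemma Beta_real_pos: "p > 0 \<Longrightarrow> q > 0 \<Longrightarrow> Beta p q > (0::real)"
  by (simp add: Beta_def Gamma_real_pos)

lemma nn_integral_beta_law:
  assumes [measurable]: "f \<in> borel_measurable borel"
  shows "(\<integral>\<^sup>+t. f t \<partial>beta_law p q) = (\<integral>\<^sup>+t. ennreal (indicator {0<..<1} t *
    (t powr (p - 1) * (1 - t) powr (q - 1) / Beta p q)) * f t \<partial>lborel)"
  unfolding beta_law_def by (subst nn_integral_density) simp_all

text \<open>\<open>beta_measure\<close> lives on the unit interval; on the whole line with its Borel
  sets, affine substitutions and maps such as 1 - t are available directly. The endpoints make no
  difference, because \<open>powr\<close> sends 0 to 0 and the density vanishes there.\<close>

lemma beta_law_eq_distr:
  assumes "p > 0" "q > 0"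
  shows "beta_law p q = distr (beta_measure p q) borel (\<lambda>x. x)"
proof (rule measure_eqI)
  show "sets (beta_law p q) = sets (distr (beta_measure p q) borel (\<lambda>x. x))" by simp
  fix A assume "A \<in> sets (beta_law p q)"
  then have A[measurable]: "A \<in> sets borel" by simp
  have m: "(\<lambda>x. x) \<in> measurable (beta_measure p q) borel"
    unfolding beta_measure_def by (simp add: measurable_restrict_space1)
  have sp: "space (beta_measure p q) = {0..1}"
    by (simp add: beta_measure_def space_restrict_space)
  have A': "A \<inter> {0..1} \<in> sets (restrict_space lborel {0..1})"
    using A by (auto simp: sets_restrict_space Int_commute)
  have "emeasure (distr (beta_measure p q) borel (\<lambda>x. x)) A = emeasure (beta_measure p q) (A \<inter> {0..1})"
    using m by (subst emeasure_distr) (simp_all add: sp)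
  also have "\<dots> = (\<integral>\<^sup>+t. ennreal (t powr (p - 1) * (1 - t) powr (q - 1) / Beta p q) *
      indicator (A \<inter> {0..1}) t \<partial>restrict_space lborel {0..1})"
    using A' unfolding beta_measure_def
    by (subst emeasure_density) (auto intro!: measurable_restrict_space1)
  also have "\<dots> = (\<integral>\<^sup>+t. ennreal (t powr (p - 1) * (1 - t) powr (q - 1) / Beta p q) *
      indicator (A \<inter> {0..1}) t * indicator {0..1} t \<partial>lborel)"
    by (subst nn_integral_restrict_space) (auto intro!: nn_integral_cong split: split_indicator)
  also have "\<dots> = (\<integral>\<^sup>+t. ennreal (indicator {0<..<1} t *
    (t powr (p - 1) * (1 - t) powr (q - 1) / Beta p q)) * indicator A t \<partial>lborel)"
  proof (rule nn_integral_cong)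
    fix t :: real
    show "ennreal (t powr (p - 1) * (1 - t) powr (q - 1) / Beta p q) * indicator (A \<inter> {0..1}) t * indicator {0..1} t =
      ennreal (indicator {0<..<1} t * (t powr (p - 1) * (1 - t) powr (q - 1) / Beta p q)) * indicator A t"
      by (cases "t = 0 \<or> t = 1") (auto split: split_indicator)
  qed
  also have "\<dots> = emeasure (beta_law p q) A"
    unfolding beta_law_def by (subst emeasure_density) simp_all
  finally show "emeasure (beta_law p q) A = emeasure (distr (beta_measure p q) borel (\<lambda>x. x)) A" ..
qed

lemma prob_space_beta_law:
  assumes "p > 0" "q > 0"
  shows "prob_space (beta_law p q)"
  unfolding beta_law_eq_distr[OF assms]
  by (rule prob_space.prob_space_distr[OF prob_space_beta_measure[OF assms]])
     (simp add: beta_measure_def measurable_restrict_space1)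

lemma AE_beta_law: "AE t in beta_law p q. 0 < t \<and> t < 1"
  unfolding beta_law_def by (subst AE_density) (auto intro!: AE_I2 split: split_indicator)

text \<open>Multiplying the density by t powr s gives the Beta density with first parameter p + s,
  up to the quotient of the normalising constants.\<close>

lemma nn_integral_beta_law_powr:
  assumes "p > 0" "q > 0" "p + s > 0"
  shows "(\<integral>\<^sup>+t. ennreal (t powr s) \<partial>beta_law p q) = ennreal (Beta (p + s) q / Beta p q)"
proof -
  note B = Beta_real_pos[OF assms(1,2)] Beta_real_pos[OF assms(3,2)]
  have "(\<integral>\<^sup>+t. ennreal (t powr s) \<partial>beta_law p q) =
     (\<integral>\<^sup>+t. ennreal (Beta (p + s) q / Beta p q) * ennreal (indicator {0<..<1} t *
    (t powr (p + s - 1) * (1 - t) powr (q - 1) / Beta (p + s) q)) \<partial>lborel)"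
    using B
    by (subst nn_integral_beta_law, simp, intro nn_integral_cong)
       (auto simp: ennreal_mult[symmetric] powr_add[symmetric] algebra_simps split: split_indicator)
  also have "\<dots> = ennreal (Beta (p + s) q / Beta p q) * emeasure (beta_law (p + s) q) (space (beta_law (p + s) q))"
    unfolding beta_law_def by (subst nn_integral_cmult) (auto simp: emeasure_density)
  finally show ?thesis
    using prob_space.emeasure_space_1[OF prob_space_beta_law[OF assms(3,2)]] by simp
qed

lemma nn_integral_beta_law_id:
  assumes "p > 0" "q > 0"
  shows "(\<integral>\<^sup>+t. ennreal t \<partial>beta_law p q) = ennreal (p / (p + q))"
proof -
  have "(\<integral>\<^sup>+t. ennreal t \<partial>beta_law p q) = (\<integral>\<^sup>+t. ennreal (t powr 1) \<partial>beta_law p q)"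
  proof (rule nn_integral_cong_AE)
    show "AE t in beta_law p q. ennreal t = ennreal (t powr 1)"
      using AE_beta_law[of p q] by eventually_elim simp
  qed
  also have "\<dots> = ennreal (Beta (p + 1) q / Beta p q)"
    using assms by (intro nn_integral_beta_law_powr) auto
  also have "Beta (p + 1) q / Beta p q = p / (p + q)"
  proof -
    have "p \<notin> \<int>\<^sub>\<le>\<^sub>0" "p + q \<notin> \<int>\<^sub>\<le>\<^sub>0" using assms by (auto elim!: nonpos_Ints_cases)
    then have "Gamma (p + 1) = p * Gamma p" "Gamma (p + 1 + q) = (p + q) * Gamma (p + q)"
      using Gamma_plus1[of p] Gamma_plus1[of "p + q"] by (auto simp: add_ac)
    moreover have "Gamma p \<noteq> 0" "Gamma q \<noteq> 0" "Gamma (p + q) \<noteq> 0"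
      using Gamma_real_pos[of p] Gamma_real_pos[of q] Gamma_real_pos[of "p + q"] assms
      by (simp_all only: less_imp_neq[symmetric] add_pos_pos simp_thms)
    ultimately show ?thesis using assms by (simp add: Beta_def)
  qed
  finally show ?thesis .
qed

text \<open>In terms of Dirichlet variables: if \<open>(c, b - c, 1 - b)\<close> is Dirichlet, then \<open>c / b\<close> and \<open>b\<close>
  are independent, and so are \<open>c\<close> and \<open>(1 - b) / (1 - c)\<close>.\<close>

lemma beta_law_exchange:
  fixes g :: "real \<Rightarrow> real \<Rightarrow> ennreal"
  assumes "l > 0" "\<beta> > 0" "\<alpha> > 0"
    and [measurable]: "(\<lambda>(x, y). g x y) \<in> borel_measurable (borel \<Otimes>\<^sub>M borel)"
  shows "(\<integral>\<^sup>+b. \<integral>\<^sup>+a. g (a * b) ((1 - b) / (1 - a * b)) \<partial>beta_law l \<beta> \<partial>beta_law (l + \<beta>) \<alpha>) =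
    (\<integral>\<^sup>+c. \<integral>\<^sup>+w. g c w \<partial>beta_law \<alpha> \<beta> \<partial>beta_law l (\<alpha> + \<beta>))" (is "?L = ?R")
proof -
  define K where "K = 1 / (Beta l \<beta> * Beta (l + \<beta>) \<alpha>)"
  \<comment> \<open>Both products of Beta values equal Gamma l * Gamma \<beta> * Gamma \<alpha> /
    Gamma (l + \<alpha> + \<beta>), so \<open>K\<close> normalises the Dirichlet density.\<close>
  have K: "K = 1 / (Beta l (\<alpha> + \<beta>) * Beta \<alpha> \<beta>)" "K > 0"
    using assms(1-3) Gamma_real_pos[of "\<beta> + l"] Gamma_real_pos[of "\<alpha> + \<beta>"]
    by (auto simp: K_def Beta_def add_ac field_simps Gamma_real_pos less_imp_neq[symmetric] zero_less_mult_iff)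
  let ?f = "\<lambda>p q t. indicator {0<..<1} t * (t powr (p - 1) * (1 - t) powr (q - 1) / Beta p q) :: real"
  \<comment> \<open>The joint density of b and c = a * b. Substituting c for a at fixed b gives it
    from the left side; substituting w = (1 - b) / (1 - c) for b at fixed c then factorises it into
    the densities on the right.\<close>
  define F where "F b c = (if 0 < c \<and> c < b \<and> b < 1 then
    K * (c powr (l - 1) * (b - c) powr (\<beta> - 1) * (1 - b) powr (\<alpha> - 1)) else 0)" for b c
  have [measurable]: "(\<lambda>(b, c). F b c) \<in> borel_measurable (borel \<Otimes>\<^sub>M borel)"
    unfolding F_def by measurable
  have gm [measurable]: "(\<lambda>x. g (u x) (v x)) \<in> borel_measurable M"
    if [measurable]: "u \<in> borel_measurable M" "v \<in> borel_measurable M" for u v and M :: "'x measure"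
    using measurable_compose[of "\<lambda>x. (u x, v x)" M "borel \<Otimes>\<^sub>M borel" "\<lambda>(x, y). g x y" borel] by simp
  have "?L = (\<integral>\<^sup>+b. ennreal (?f (l + \<beta>) \<alpha> b) * (\<integral>\<^sup>+a. ennreal (?f l \<beta> a) *
      g (a * b) ((1 - b) / (1 - a * b)) \<partial>lborel) \<partial>lborel)"
    by (simp add: nn_integral_beta_law beta_law_def nn_integral_density cong: nn_integral_cong)
  also have "\<dots> = (\<integral>\<^sup>+b. (\<integral>\<^sup>+c. ennreal (F b c) * g c ((1 - b) / (1 - c)) \<partial>lborel) \<partial>lborel)"
  proof (rule nn_integral_cong)
    fix b :: real
    show "ennreal (?f (l + \<beta>) \<alpha> b) * (\<integral>\<^sup>+a. ennreal (?f l \<beta> a) *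
      g (a * b) ((1 - b) / (1 - a * b)) \<partial>lborel) =
      (\<integral>\<^sup>+c. ennreal (F b c) * g c ((1 - b) / (1 - c)) \<partial>lborel)"
    proof (cases "0 < b \<and> b < 1")
      case False
      then have "F b c = 0" for c by (auto simp: F_def)
      then show ?thesis using False by auto
    next
      case True
      have "ennreal (?f (l + \<beta>) \<alpha> b) * (\<integral>\<^sup>+a. ennreal (?f l \<beta> a) *
          g (a * b) ((1 - b) / (1 - a * b)) \<partial>lborel) =
        (\<integral>\<^sup>+a. ennreal (?f (l + \<beta>) \<alpha> b) * (ennreal (?f l \<beta> a) *
          g (a * b) ((1 - b) / (1 - a * b))) \<partial>lborel)"
        by (subst nn_integral_cmult) auto
      also have "\<dots> = (\<integral>\<^sup>+a. ennreal b * (ennreal (F b (b * a)) *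
          g (b * a) ((1 - b) / (1 - b * a))) \<partial>lborel)"
      proof (rule nn_integral_cong)
        fix a :: real
        have "?f (l + \<beta>) \<alpha> b * ?f l \<beta> a = b * F b (b * a)"
        proof (cases "0 < a \<and> a < 1")
          case False
          then show ?thesis using True by (auto simp: F_def zero_less_mult_iff)
        next
          case a: True
          have "b * a < b" "b * a > 0" using True a by auto
          moreover have "(b - b * a) powr (\<beta> - 1) = b powr (\<beta> - 1) * (1 - a) powr (\<beta> - 1)"
            using True a by (subst powr_mult[symmetric]) (auto simp: algebra_simps)
          moreover have "(b * a) powr (l - 1) = b powr (l - 1) * a powr (l - 1)"
            using True a by (subst powr_mult[symmetric]) auto
          moreover have "b powr (l + \<beta> - 1) = b * (b powr (\<beta> - 1) * b powr (l - 1))"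
            using True by (simp add: powr_add[symmetric] powr_mult_base algebra_simps)
          ultimately show ?thesis using True a
            by (simp add: F_def K_def mult_ac)
        qed
        then have "ennreal (?f (l + \<beta>) \<alpha> b) * ennreal (?f l \<beta> a) = ennreal b * ennreal (F b (b * a))"
          using True K(2) Beta_real_pos[of l \<beta>] Beta_real_pos[of "l + \<beta>" \<alpha>] assms(1-3)
          by (subst (1 2) ennreal_mult[symmetric]) (auto simp: F_def)
        then show "ennreal (?f (l + \<beta>) \<alpha> b) * (ennreal (?f l \<beta> a) *
            g (a * b) ((1 - b) / (1 - a * b))) = ennreal b * (ennreal (F b (b * a)) *
            g (b * a) ((1 - b) / (1 - b * a)))"
          by (simp add: mult.assoc[symmetric] mult.commute[of a b])
      qed
      also have "\<dots> = (\<integral>\<^sup>+c. ennreal (F b c) * g c ((1 - b) / (1 - c)) \<partial>lborel)"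
        using True by (subst nn_integral_real_affine[of "\<lambda>c. ennreal (F b c) * g c ((1 - b) / (1 - c))" b 0])
          (auto simp: nn_integral_cmult)
      finally show ?thesis .
    qed
  qed
  also have "\<dots> = (\<integral>\<^sup>+c. (\<integral>\<^sup>+b. ennreal (F b c) * g c ((1 - b) / (1 - c)) \<partial>lborel) \<partial>lborel)"
    by (rule lborel_pair.Fubini') measurable
  also have "\<dots> = (\<integral>\<^sup>+c. ennreal (?f l (\<alpha> + \<beta>) c) * (\<integral>\<^sup>+w. ennreal (?f \<alpha> \<beta> w) * g c w \<partial>lborel) \<partial>lborel)"
  proof (rule nn_integral_cong)
    fix c :: real
    show "(\<integral>\<^sup>+b. ennreal (F b c) * g c ((1 - b) / (1 - c)) \<partial>lborel) =
      ennreal (?f l (\<alpha> + \<beta>) c) * (\<integral>\<^sup>+w. ennreal (?f \<alpha> \<beta> w) * g c w \<partial>lborel)"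
    proof (cases "0 < c \<and> c < 1")
      case False
      then have "F b c = 0" for b by (auto simp: F_def)
      then show ?thesis using False by auto
    next
      case True
      have "(\<integral>\<^sup>+b. ennreal (F b c) * g c ((1 - b) / (1 - c)) \<partial>lborel) =
        ennreal \<bar>- (1 - c)\<bar> * (\<integral>\<^sup>+w. ennreal (F (1 + (- (1 - c)) * w) c) *
          g c ((1 - (1 + (- (1 - c)) * w)) / (1 - c)) \<partial>lborel)"
        using True by (intro nn_integral_real_affine) auto
      also have "\<dots> = (\<integral>\<^sup>+w. ennreal (1 - c) * (ennreal (F (1 - (1 - c) * w) c) * g c w) \<partial>lborel)"
      proof -
        have "1 + (- (1 - c)) * w = 1 - (1 - c) * w" "(1 - (1 - (1 - c) * w)) / (1 - c) = w" for w
          using True by (simp_all only: mult_minus_left diff_conv_add_uminus[symmetric]) auto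
        then show ?thesis
          using True by (subst nn_integral_cmult) auto
      qed
      also have "\<dots> = (\<integral>\<^sup>+w. ennreal (?f l (\<alpha> + \<beta>) c) * (ennreal (?f \<alpha> \<beta> w) * g c w) \<partial>lborel)"
      proof (rule nn_integral_cong)
        fix w :: real
        have "(1 - c) * F (1 - (1 - c) * w) c = ?f l (\<alpha> + \<beta>) c * ?f \<alpha> \<beta> w"
        proof (cases "0 < w \<and> w < 1")
          case False
          then consider "w \<le> 0" | "1 \<le> w" by linarith
          then have "\<not> (c < 1 - (1 - c) * w \<and> 1 - (1 - c) * w < 1)"
          proof cases
            case 1
            then have "(1 - c) * w \<le> 0" using True by (simp add: mult_nonneg_nonpos)
            then have "1 \<le> 1 - (1 - c) * w" by linarith
            then show ?thesis by (meson not_less)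
          next
            case 2
            then have "(1 - c) * 1 \<le> (1 - c) * w" using True by (intro mult_left_mono) auto
            then have "1 - c \<le> (1 - c) * w" by (simp only: mult_1_right)
            then have "1 - (1 - c) * w \<le> c" by linarith
            then show ?thesis by (meson not_less)
          qed
          then show ?thesis using True False by (auto simp: F_def)
        next
          case w: True
          have p: "(1 - c) * w > 0" "(1 - c) * w < 1 - c" using True w by auto
          have e: "1 - (1 - c) * w - c = (1 - c) * (1 - w)" by (simp add: algebra_simps)
          have "F (1 - (1 - c) * w) c = K * (c powr (l - 1) * ((1 - c) * (1 - w)) powr (\<beta> - 1) *
              ((1 - c) * w) powr (\<alpha> - 1))"
          proof -
            have "c < 1 - (1 - c) * w" "1 - (1 - c) * w < 1" using p by linarith+
            then show ?thesis using True by (simp add: F_def e)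
          qed
          also have "\<dots> = K * (c powr (l - 1) * ((1 - c) powr (\<beta> - 1) * (1 - w) powr (\<beta> - 1)) *
              ((1 - c) powr (\<alpha> - 1) * w powr (\<alpha> - 1)))"
            using True w by (simp add: powr_mult)
          finally have "F (1 - (1 - c) * w) c = \<dots>" .
          moreover have "(1 - c) powr (\<alpha> + \<beta> - 1) = (1 - c) * ((1 - c) powr (\<beta> - 1) * (1 - c) powr (\<alpha> - 1))"
          proof -
            have "\<alpha> + \<beta> - 1 = 1 + ((\<beta> - 1) + (\<alpha> - 1))" by simp
            then have "(1 - c) powr (\<alpha> + \<beta> - 1) = (1 - c) powr (1 + ((\<beta> - 1) + (\<alpha> - 1)))" by (simp only:)
            then show ?thesis using True by (simp only: powr_add) simp
          qed
          ultimately show ?thesis using True w by (simp add: K(1))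
        qed
        then have "ennreal (1 - c) * ennreal (F (1 - (1 - c) * w) c) = ennreal (?f l (\<alpha> + \<beta>) c) * ennreal (?f \<alpha> \<beta> w)"
          using True K(2) Beta_real_pos[of l "\<alpha> + \<beta>"] Beta_real_pos[of \<alpha> \<beta>] assms(1-3)
          by (subst (1 2) ennreal_mult[symmetric]) (auto simp: F_def)
        then show "ennreal (1 - c) * (ennreal (F (1 - (1 - c) * w) c) * g c w) =
            ennreal (?f l (\<alpha> + \<beta>) c) * (ennreal (?f \<alpha> \<beta> w) * g c w)"
          by (simp add: mult.assoc[symmetric])
      qed
      also have "\<dots> = ennreal (?f l (\<alpha> + \<beta>) c) * (\<integral>\<^sup>+w. ennreal (?f \<alpha> \<beta> w) * g c w \<partial>lborel)"
        by (subst nn_integral_cmult) auto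
      finally show ?thesis .
    qed
  qed
  also have "\<dots> = ?R"
    by (simp add: beta_law_def nn_integral_density)
  finally show ?thesis .
qed

section \<open>Polygamma functions and the velocity\<close>

lemma Polygamma_real_sums:
  assumes "(x::real) > 0" "n > 0"
  shows "(\<lambda>k. 1 / (x + real k) ^ Suc n) sums ((-1) ^ Suc n * Polygamma n x / fact n)"
  using Polygamma_LIMSEQ[of x n] assms by (simp add: divide_inverse)

text \<open>Cauchy--Schwarz for the series of the powers -3, -4 and -5 of x + k gives S4^2 \<le> S3
  * S5. The factorials make the inequality strict: the two sides are 36 * S4^2 and 48 * S3 *
  S5.\<close>

lemma Polygamma_3_squared_less:
  assumes "(x::real) > 0"
  shows "(Polygamma 3 x)\<^sup>2 < Polygamma 2 x * Polygamma 4 x"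
proof -
  define S3 where "S3 = - Polygamma 2 x / 2"
  define S4 where "S4 = Polygamma 3 x / 6"
  define S5 where "S5 = - Polygamma 4 x / 24"
  have S3: "(\<lambda>k. 1 / (x + real k) ^ 3) sums S3"
    using Polygamma_real_sums[OF assms, of 2] by (simp add: S3_def eval_nat_numeral)
  have S4: "(\<lambda>k. 1 / (x + real k) ^ 4) sums S4"
    using Polygamma_real_sums[OF assms, of 3] by (simp add: S4_def fact_numeral)
  have S5: "(\<lambda>k. 1 / (x + real k) ^ 5) sums S5"
    using Polygamma_real_sums[OF assms, of 4] by (simp add: S5_def fact_numeral)
  have pos: "S3 > 0" "S4 > 0" "S5 > 0"
    using sums_unique[OF S3] suminf_pos[OF sums_summable[OF S3]]
      sums_unique[OF S4] suminf_pos[OF sums_summable[OF S4]]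
      sums_unique[OF S5] suminf_pos[OF sums_summable[OF S5]] assms
    by (auto simp: add_pos_nonneg)
  \<comment> \<open>The series of y^3 * (S - y)^2 with y = 1 / (x + k), taken at its minimiser S =
    S4 / S3; the value there is S5 - S4^2 / S3.\<close>
  have "(\<lambda>k. (S4 / S3)\<^sup>2 * (1 / (x + real k) ^ 3) - 2 * (S4 / S3) * (1 / (x + real k) ^ 4) +
      1 / (x + real k) ^ 5) sums ((S4 / S3)\<^sup>2 * S3 - 2 * (S4 / S3) * S4 + S5)"
    by (intro sums_add sums_diff sums_mult S3 S4 S5)
  moreover have "(S4 / S3)\<^sup>2 * (1 / (x + real k) ^ 3) - 2 * (S4 / S3) * (1 / (x + real k) ^ 4) +
      1 / (x + real k) ^ 5 = 1 / (x + real k) ^ 3 * (S4 / S3 - 1 / (x + real k))\<^sup>2" for k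
  proof -
    define y where "y = 1 / (x + real k)"
    have y: "1 / (x + real k) ^ m = y ^ m" for m by (simp add: y_def power_one_over)
    have "S ^ 2 * y ^ 3 - 2 * S * y ^ 4 + y ^ 5 = y ^ 3 * (S - y) ^ 2" for S
      by (simp add: power2_eq_square algebra_simps eval_nat_numeral)
    then show ?thesis unfolding y y_def[symmetric] .
  qed
  ultimately have "(\<lambda>k. 1 / (x + real k) ^ 3 * (S4 / S3 - 1 / (x + real k))\<^sup>2) sums
      ((S4 / S3)\<^sup>2 * S3 - 2 * (S4 / S3) * S4 + S5)"
    by simp
  then have "0 \<le> (S4 / S3)\<^sup>2 * S3 - 2 * (S4 / S3) * S4 + S5"
    using assms by (rule_tac sums_le[OF _ sums_zero]) auto
  also have "\<dots> = S5 - S4\<^sup>2 / S3" using pos by (simp add: field_simps power2_eq_square)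
  finally have "S4\<^sup>2 \<le> S3 * S5" using pos by (simp add: field_simps)
  then have "36 * S4\<^sup>2 < 48 * (S3 * S5)" using pos
    by (smt (verit) mult_pos_pos)
  then show ?thesis
    by (simp add: S3_def S4_def S5_def power2_eq_square)
qed

text \<open>The ratio is minus the logarithmic derivative of \<open>- Polygamma 2\<close>, so its
  decrease expresses strict log-convexity of that function.\<close>

lemma Polygamma_ratio_strict_antimono:
  assumes "0 < x" "x < (y::real)"
  shows "Polygamma 3 y / - Polygamma 2 y < Polygamma 3 x / - Polygamma 2 x"
proof (rule DERIV_neg_imp_decreasing[OF assms(2)])
  fix z assume z: "x \<le> z" "z \<le> y"
  then have z0: "z > 0" using assms by linarith
  then have nz: "z \<notin> \<int>\<^sub>\<le>\<^sub>0" by (auto elim!: nonpos_Ints_cases)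
  have neg: "Polygamma 2 z < 0" using z0 nz by (intro Polygamma_real_even_neg) auto
  have "((\<lambda>z. Polygamma 3 z / - Polygamma 2 z) has_real_derivative
     (Polygamma (Suc 3) z * - Polygamma 2 z - Polygamma 3 z * - Polygamma (Suc 2) z) / (- Polygamma 2 z * - Polygamma 2 z)) (at z)"
    using neg nz by (intro DERIV_divide DERIV_minus has_field_derivative_Polygamma) auto
  moreover have "(Polygamma (Suc 3) z * - Polygamma 2 z - Polygamma 3 z * - Polygamma (Suc 2) z) / (- Polygamma 2 z * - Polygamma 2 z) < 0"
    using Polygamma_3_squared_less[OF z0] neg
    by (intro divide_neg_pos) (auto simp: power2_eq_square mult_neg_neg mult.commute numeral_eq_Suc)
  ultimately show "\<exists>l. ((\<lambda>z. Polygamma 3 z / - Polygamma 2 z) has_real_derivative l) (at z) \<and> l < 0"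
    by blast
qed

lemma not_nonpos_Int: "(x::real) > 0 \<Longrightarrow> x \<notin> \<int>\<^sub>\<le>\<^sub>0"
  by (auto elim!: nonpos_Ints_cases)

lemma Polygamma_1_diff:
  assumes "0 < x" "x < (y::real)"
  shows "\<exists>c. x < c \<and> c < y \<and> Polygamma 1 x - Polygamma 1 y = (y - x) * - Polygamma 2 c"
proof -
  have "\<exists>c. x < c \<and> c < y \<and> Polygamma 1 y - Polygamma 1 x = (y - x) * Polygamma (Suc 1) c"
    using assms by (intro MVT2 has_field_derivative_Polygamma not_nonpos_Int) auto
  then show ?thesis by (auto simp: numeral_2_eq_2 algebra_simps)
qed

text \<open>Cauchy's mean value theorem for \<open>Polygamma 1\<close> and
  \<open>Polygamma 2\<close>. It writes the derivative of a drift as minus the drift times a value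
  of the monotone ratio.\<close>

lemma Polygamma_2_diff:
  assumes "0 < x" "x < (y::real)"
  shows "\<exists>c. x < c \<and> c < y \<and> Polygamma 2 x - Polygamma 2 y =
    - (Polygamma 1 x - Polygamma 1 y) * (Polygamma 3 c / - Polygamma 2 c)"
proof -
  have "\<exists>g'c f'c c. DERIV (Polygamma 1) c :> g'c \<and> DERIV (Polygamma 2) c :> f'c \<and> x < c \<and> c < y \<and>
      ((Polygamma 2 y - Polygamma 2 x) * g'c) = ((Polygamma 1 y - Polygamma 1 x) * f'c)"
    using assms
    by (intro GMVT) (auto intro!: isCont_Polygamma not_nonpos_Int simp: real_differentiable_def
      intro!: exI has_field_derivative_Polygamma)
  then obtain g f c where c: "DERIV (Polygamma 1) c :> g" "DERIV (Polygamma 2) c :> f" "x < c" "c < y"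
    and e: "((Polygamma 2 y - Polygamma 2 x) * g) = ((Polygamma 1 y - Polygamma 1 x) * f)" by blast
  have "c > 0" using assms c by linarith
  then have "g = Polygamma (Suc 1) c" "f = Polygamma (Suc 2) c"
    by (intro DERIV_unique[OF c(1)] DERIV_unique[OF c(2)] has_field_derivative_Polygamma not_nonpos_Int; simp)+
  moreover have "Polygamma 2 c < 0" using \<open>c > 0\<close> by (intro Polygamma_real_even_neg) auto
  ultimately have "Polygamma 2 x - Polygamma 2 y =
    - (Polygamma 1 x - Polygamma 1 y) * (Polygamma 3 c / - Polygamma 2 c)"
    using e by (simp add: field_simps numeral_2_eq_2 numeral_3_eq_3)
  with c show ?thesis by blast
qed

text \<open>Termwise comparison of the two series, from x / (x + d) \<le> (x + k) / (x + d + k). The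
  factor tends to 1 as x grows, so a fixed shift becomes negligible.\<close>

lemma Polygamma_2_shift:
  assumes "(x::real) > 0" "d > 0"
  shows "(x / (x + d)) ^ 3 * - Polygamma 2 x \<le> - Polygamma 2 (x + d)"
proof -
  have a: "(\<lambda>k. (x / (x + d)) ^ 3 * (1 / (x + real k) ^ 3)) sums ((x / (x + d)) ^ 3 * (- Polygamma 2 x / 2))"
    using Polygamma_real_sums[OF assms(1), of 2] by (intro sums_mult) (simp add: eval_nat_numeral)
  have b: "(\<lambda>k. 1 / (x + d + real k) ^ 3) sums (- Polygamma 2 (x + d) / 2)"
    using Polygamma_real_sums[of "x + d" 2] assms by (simp add: eval_nat_numeral)
  have c: "(x / (x + d)) ^ 3 * (1 / (x + real k) ^ 3) \<le> 1 / (x + d + real k) ^ 3" for k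
  proof -
    have "x / (x + d) * (1 / (x + real k)) \<le> 1 / (x + d + real k)"
    proof -
      have "x * (x + d + real k) \<le> (x + d) * (x + real k)"
        using assms by (simp add: algebra_simps)
      then show ?thesis using assms by (simp add: divide_le_eq le_divide_eq add_pos_nonneg mult.commute)
    qed
    then have "(x / (x + d) * (1 / (x + real k))) ^ 3 \<le> (1 / (x + d + real k)) ^ 3"
      using assms by (intro power_mono) auto
    then show ?thesis by (simp add: power_mult_distrib power_divide)
  qed
  have "(x / (x + d)) ^ 3 * (- Polygamma 2 x / 2) \<le> - Polygamma 2 (x + d) / 2"
    by (rule sums_le[OF c a b])
  then show ?thesis by simp
qed

lemma eventually_at_right_DERIV_neg:
  fixes f :: "real \<Rightarrow> real"
  assumes "(f has_real_derivative d) (at x)" "d < 0"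
  shows "eventually (\<lambda>y. f y < f x) (at_right x)"
proof -
  obtain e where e: "e > 0" "\<And>h. h > 0 \<Longrightarrow> h < e \<Longrightarrow> f (x + h) < f x"
    using DERIV_neg_dec_right[OF assms] by blast
  show ?thesis
    unfolding eventually_at_right_field
    using e(2)[of "y - x" for y] e(1) by (intro exI[of _ "x + e"]) auto
qed

lemma eventually_at_left_DERIV_pos:
  fixes f :: "real \<Rightarrow> real"
  assumes "(f has_real_derivative d) (at x)" "d > 0"
  shows "eventually (\<lambda>y. f y < f x) (at_left x)"
proof -
  obtain e where e: "e > 0" "\<And>h. h > 0 \<Longrightarrow> h < e \<Longrightarrow> f (x - h) < f x"
    using DERIV_pos_inc_left[OF assms] by blast
  show ?thesis
    unfolding eventually_at_left_field
    using e(2)[of "x - y" for y] e(1) by (intro exI[of _ "x - e"]) auto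
qed

section \<open>Drift and velocity as functions of the parameter\<close>

locale beta_parameters =
  fixes \<alpha> \<beta> :: real
  assumes ab: "\<alpha> > 0" "\<beta> > 0"
begin

text \<open>For a distributed as Beta(l, \<beta>) and b as Beta(l + \<beta>, \<alpha>), the
  variances of ln b and ln a are \<open>drift1 l\<close> and \<open>drift2 l\<close>.\<close>

definition drift1 :: "real \<Rightarrow> real" where
  "drift1 l = Polygamma 1 (l + \<beta>) - Polygamma 1 (l + \<beta> + \<alpha>)"

definition drift2 :: "real \<Rightarrow> real" where
  "drift2 l = Polygamma 1 l - Polygamma 1 (l + \<beta>)"

definition velocity :: "real \<Rightarrow> real" where
  "velocity l = drift1 l / (drift1 l + drift2 l)"

lemma drift_pos: "l > 0 \<Longrightarrow> drift1 l > 0" "l > 0 \<Longrightarrow> drift2 l > 0"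
  using ab by (auto simp: drift1_def drift2_def intro!: Polygamma_real_strict_antimono)

lemma has_derivative_drift:
  assumes "l > 0"
  shows "(drift1 has_real_derivative Polygamma 2 (l + \<beta>) - Polygamma 2 (l + \<beta> + \<alpha>)) (at l)"
    and "(drift2 has_real_derivative Polygamma 2 l - Polygamma 2 (l + \<beta>)) (at l)"
proof -
  have "(drift1 has_real_derivative Polygamma (Suc 1) (l + \<beta>) - Polygamma (Suc 1) (l + \<beta> + \<alpha>)) (at l)"
    unfolding drift1_def using assms ab
    by (auto intro!: derivative_eq_intros not_nonpos_Int)
  then show "(drift1 has_real_derivative Polygamma 2 (l + \<beta>) - Polygamma 2 (l + \<beta> + \<alpha>)) (at l)"
    by (simp add: numeral_2_eq_2)
  have "(drift2 has_real_derivative Polygamma (Suc 1) l - Polygamma (Suc 1) (l + \<beta>)) (at l)"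
    unfolding drift2_def using assms ab
    by (auto intro!: derivative_eq_intros not_nonpos_Int)
  then show "(drift2 has_real_derivative Polygamma 2 l - Polygamma 2 (l + \<beta>)) (at l)"
    by (simp add: numeral_2_eq_2)
qed

text \<open>The logarithmic derivatives of \<open>drift1\<close> and \<open>drift2\<close> are -q c
  and -q d, where q is the decreasing ratio of polygamma values. The point z + \<beta> separates d
  from c, which decides the sign of q d - q c.\<close>

lemma drift_ratio_strict_mono:
  assumes "0 < l" "l < m"
  shows "drift1 l / drift2 l < drift1 m / drift2 m"
proof (rule DERIV_pos_imp_increasing[OF assms(2)])
  fix z assume z: "l \<le> z" "z \<le> m"
  then have z0: "z > 0" using assms by linarith
  note pos = drift_pos[OF z0]
  obtain c where c: "z + \<beta> < c" and c2: "Polygamma 2 (z + \<beta>) - Polygamma 2 (z + \<beta> + \<alpha>) =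
      - drift1 z * (Polygamma 3 c / - Polygamma 2 c)"
    using Polygamma_2_diff[of "z + \<beta>" "z + \<beta> + \<alpha>"] ab z0 by (auto simp: drift1_def)
  obtain d where d: "0 < d" "d < z + \<beta>" and d2: "Polygamma 2 z - Polygamma 2 (z + \<beta>) =
      - drift2 z * (Polygamma 3 d / - Polygamma 2 d)"
    using Polygamma_2_diff[of z "z + \<beta>"] ab z0 unfolding drift2_def
    by (metis less_add_same_cancel1 less_trans)
  define q where "q w = Polygamma 3 w / - Polygamma 2 w" for w :: real
  have "((\<lambda>z. drift1 z / drift2 z) has_real_derivative
      ((- drift1 z * q c) * drift2 z - drift1 z * (- drift2 z * q d)) / (drift2 z * drift2 z)) (at z)"
    using has_derivative_drift[OF z0] pos unfolding c2 d2 q_def by (intro DERIV_divide) auto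
  moreover have "((- drift1 z * q c) * drift2 z - drift1 z * (- drift2 z * q d)) / (drift2 z * drift2 z) =
      drift1 z * drift2 z * (q d - q c) / (drift2 z * drift2 z)"
    by (simp add: algebra_simps)
  moreover have "q d - q c > 0"
    using Polygamma_ratio_strict_antimono[of d c] c d unfolding q_def by linarith
  then have "drift1 z * drift2 z * (q d - q c) / (drift2 z * drift2 z) > 0"
    using pos by (intro divide_pos_pos mult_pos_pos)
  ultimately show "\<exists>y. ((\<lambda>z. drift1 z / drift2 z) has_real_derivative y) (at z) \<and> 0 < y"
    by auto
qed

lemma velocity_less_iff:
  assumes "l > 0" "0 < t" "t < 1"
  shows "velocity l < t \<longleftrightarrow> (1 - t) * drift1 l < t * drift2 l"
    and "t < velocity l \<longleftrightarrow> t * drift2 l < (1 - t) * drift1 l"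
  using drift_pos[OF assms(1)] by (auto simp: velocity_def field_simps)

lemma velocity_strict_mono:
  assumes "0 < l" "l < m"
  shows "velocity l < velocity m"
  using drift_ratio_strict_mono[OF assms] drift_pos[of l] drift_pos[of m] assms
  by (simp add: velocity_def field_simps add_pos_pos)

text \<open>By the mean value theorem the drifts are \<alpha> and \<beta> times values of
  \<open>- Polygamma 2\<close>, which decreases, at points on either side of l + \<beta>. The upper
  bound is the mean of a single weight, that is, the speed of the averaged walk.\<close>

lemma velocity_bounds:
  assumes "l > 0"
  shows "0 < velocity l" "velocity l < \<alpha> / (\<alpha> + \<beta>)"
proof -
  note pos = drift_pos[OF assms]
  show "0 < velocity l" using pos by (simp add: velocity_def)
  obtain c where c: "l + \<beta> < c" "drift1 l = \<alpha> * - Polygamma 2 c"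
    using Polygamma_1_diff[of "l + \<beta>" "l + \<beta> + \<alpha>"] ab assms by (auto simp: drift1_def)
  obtain d where d: "0 < d" "d < l + \<beta>" "drift2 l = \<beta> * - Polygamma 2 d"
    using Polygamma_1_diff[of l "l + \<beta>"] ab assms unfolding drift2_def
    by (metis add_diff_cancel_left' less_add_same_cancel1 less_trans)
  have "Polygamma 2 d < Polygamma 2 c"
    using c d by (intro Polygamma_real_strict_mono) auto
  then have "\<beta> * drift1 l < \<alpha> * drift2 l"
    unfolding c(2) d(3) using ab by (simp add: algebra_simps)
  then show "velocity l < \<alpha> / (\<alpha> + \<beta>)"
    using pos ab by (simp add: velocity_def field_simps)
qed

text \<open>As l tends to 0, \<open>drift2 l\<close> blows up at least like 1 / l^2 while
  \<open>drift1 l\<close> stays below \<open>Polygamma 1 \<beta>\<close>. The constant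
  \<open>C\<close> is the size of \<open>drift2\<close> that outweighs this bound.\<close>

lemma exists_velocity_less:
  assumes "t > 0" "t < 1"
  shows "\<exists>l>0. velocity l < t"
proof -
  define C where "C = (1 - t) * Polygamma 1 \<beta> / t"
  have P1: "Polygamma 1 x > 0" if "(x::real) > 0" for x
    using that by (intro Polygamma_real_odd_pos not_nonpos_Int) auto
  have "filterlim (\<lambda>x::real. 1 / x ^ 2 - Polygamma 1 \<beta>) at_top (at_right 0)"
    by real_asymp
  then have "eventually (\<lambda>x. 1 / x ^ 2 - Polygamma 1 \<beta> > C) (at_right 0)"
    by (simp add: filterlim_at_top_dense)
  then have "eventually (\<lambda>x. 1 / x ^ 2 - Polygamma 1 \<beta> > C \<and> x > 0) (at_right 0)"
    by (intro eventually_conj eventually_at_right_less)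
  then obtain l where l: "1 / l ^ 2 - Polygamma 1 \<beta> > C" "l > 0"
    by (metis (mono_tags, lifting) eventually_happens' trivial_limit_at_right_real)
  have "1 / l ^ 2 \<le> Polygamma 1 l"
  proof -
    have s: "(\<lambda>k. 1 / (l + real k) ^ 2) sums Polygamma 1 l"
      using Polygamma_real_sums[OF l(2), of 1] by (simp add: eval_nat_numeral)
    show ?thesis using sum_le_suminf[OF sums_summable[OF s], of "{0}"] sums_unique[OF s] l by simp
  qed
  moreover have "Polygamma 1 (l + \<beta>) < Polygamma 1 \<beta>"
    using l ab by (intro Polygamma_real_strict_antimono) auto
  moreover have "Polygamma 1 (l + \<beta> + \<alpha>) > 0" using l ab by (intro P1) auto
  ultimately have "drift2 l > C" "drift1 l < Polygamma 1 \<beta>"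
    using l by (auto simp: drift1_def drift2_def)
  then have "(1 - t) * drift1 l < (1 - t) * Polygamma 1 \<beta>" "(1 - t) * Polygamma 1 \<beta> < t * drift2 l"
    using assms by (auto simp: C_def divide_less_eq mult.commute intro: mult_strict_left_mono)
  then show ?thesis using velocity_less_iff(1)[of l t] assms l by (intro exI[of _ l]) linarith
qed

text \<open>For large l the drifts are close to \<alpha> and \<beta> times
  \<open>- Polygamma 2 l\<close>. The cube measures the loss from evaluating at l + \<beta> +
  \<alpha> instead of l.\<close>

lemma exists_less_velocity:
  assumes "t > 0" "t < \<alpha> / (\<alpha> + \<beta>)"
  shows "\<exists>l>0. t < velocity l"
proof -
  have t1: "t < 1" using assms ab by (smt (verit) divide_less_eq_1_pos)
  have "((\<lambda>l. (1 - t) * \<alpha> * (l / (l + (\<beta> + \<alpha>))) ^ 3) \<longlongrightarrow> (1 - t) * \<alpha> * 1 ^ 3) at_top"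
    by (intro tendsto_intros) real_asymp
  moreover have "(1 - t) * \<alpha> * 1 ^ 3 > t * \<beta>" using assms ab by (simp add: field_simps)
  ultimately have "eventually (\<lambda>l. (1 - t) * \<alpha> * (l / (l + (\<beta> + \<alpha>))) ^ 3 > t * \<beta>) at_top"
    by (rule order_tendstoD(1))
  then have "eventually (\<lambda>l. (1 - t) * \<alpha> * (l / (l + (\<beta> + \<alpha>))) ^ 3 > t * \<beta> \<and> l > 0) at_top"
    by (intro eventually_conj eventually_gt_at_top)
  then obtain l where l: "(1 - t) * \<alpha> * (l / (l + (\<beta> + \<alpha>))) ^ 3 > t * \<beta>" "l > 0"
    by (metis (mono_tags, lifting) eventually_happens' trivial_limit_at_top_linorder)
  obtain c where c: "l + \<beta> < c" "c < l + \<beta> + \<alpha>" "drift1 l = \<alpha> * - Polygamma 2 c"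
    using Polygamma_1_diff[of "l + \<beta>" "l + \<beta> + \<alpha>"] ab l by (auto simp: drift1_def)
  obtain d where d: "l < d" "d < l + \<beta>" "drift2 l = \<beta> * - Polygamma 2 d"
    using Polygamma_1_diff[of l "l + \<beta>"] ab l by (auto simp: drift2_def)
  have n: "- Polygamma 2 l > 0" using Polygamma_real_even_neg[of l 2] l by (auto intro!: not_nonpos_Int)
  have "t * drift2 l \<le> t * \<beta> * - Polygamma 2 l"
    using Polygamma_real_strict_mono[of l d 2] l d assms ab by auto
  also have "\<dots> < (1 - t) * \<alpha> * (l / (l + (\<beta> + \<alpha>))) ^ 3 * - Polygamma 2 l"
    using l n by (intro mult_strict_right_mono)
  also have "\<dots> \<le> (1 - t) * \<alpha> * - Polygamma 2 (l + (\<beta> + \<alpha>))"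
    using Polygamma_2_shift[OF l(2), of "\<beta> + \<alpha>"] ab t1
    by (subst mult.assoc, intro mult_left_mono) auto
  also have "\<dots> \<le> (1 - t) * drift1 l"
    using Polygamma_real_strict_mono[of c "l + (\<beta> + \<alpha>)" 2] l c ab t1
    by (auto simp: add_ac)
  finally show ?thesis using velocity_less_iff(2)[of l t] assms l t1 by auto
qed

lemma exists_velocity_eq:
  assumes "t > 0" "t < \<alpha> / (\<alpha> + \<beta>)"
  shows "\<exists>l>0. velocity l = t"
proof -
  have t1: "t < 1" using assms ab by (smt (verit) divide_less_eq_1_pos)
  obtain l where l: "l > 0" "velocity l < t" using exists_velocity_less[of t] assms t1 by auto
  obtain m where m: "m > 0" "t < velocity m" using exists_less_velocity[OF assms] by auto
  have lm: "l \<le> m" using velocity_strict_mono[of m l] l m by linarith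
  have "isCont velocity x" if "x > 0" for x
    unfolding velocity_def[abs_def]
    using that drift_pos[OF that] by (intro continuous_intros DERIV_isCont[OF has_derivative_drift(1)]
      DERIV_isCont[OF has_derivative_drift(2)]) auto
  then have "\<exists>x. l \<le> x \<and> x \<le> m \<and> velocity x = t"
    using l m lm by (intro IVT) auto
  then show ?thesis using l(1) by (metis less_le_trans)
qed

section \<open>Moments of the increments under two parameters\<close>

definition mean1 :: "real \<Rightarrow> real" where
  "mean1 l = Digamma (l + \<beta>) - Digamma l"

definition mean2 :: "real \<Rightarrow> real" where
  "mean2 l = Digamma (l + \<beta>) - Digamma (l + \<beta> + \<alpha>)"

text \<open>Let a and b have the laws Beta(l, \<beta>) and Beta(l + \<beta>, \<alpha>) under the
  parameter l. Then \<open>tilt1 l m s\<close> is the mean of a powr (-s) under m times the mean of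
  a powr s under l, and \<open>tilt2 l m s\<close> is the mean of b powr s under m times the mean of
  b powr (-s) under l. They are the costs of a horizontal and of a vertical step.\<close>

definition tilt1 :: "real \<Rightarrow> real \<Rightarrow> real \<Rightarrow> real" where
  "tilt1 l m s = Beta (m - s) \<beta> / Beta m \<beta> * (Beta (l + s) \<beta> / Beta l \<beta>)"

definition tilt2 :: "real \<Rightarrow> real \<Rightarrow> real \<Rightarrow> real" where
  "tilt2 l m s = Beta (m + \<beta> + s) \<alpha> / Beta (m + \<beta>) \<alpha> * (Beta (l + \<beta> - s) \<alpha> / Beta (l + \<beta>) \<alpha>)"

lemma has_derivative_mean:
  assumes "l > 0"
  shows "(mean1 has_real_derivative - drift2 l) (at l)"
    and "(mean2 has_real_derivative drift1 l) (at l)"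
  unfolding mean1_def mean2_def drift1_def drift2_def using assms ab
  by (auto intro!: derivative_eq_intros not_nonpos_Int)

text \<open>At s = 0 the logarithm of a moment has the mean of the logarithm as its derivative, and
  the two parameters enter with opposite signs. One computation serves both claims:
  \<open>tilt2\<close> is the same expression with p = l + \<beta>, q = \<alpha> and r = m +
  \<beta>.\<close>

lemma has_derivative_ln_tilt:
  assumes "l > 0" "m > 0"
  shows "((\<lambda>s. ln (tilt1 l m s)) has_real_derivative mean1 m - mean1 l) (at 0)"
    and "((\<lambda>s. ln (tilt2 l m s)) has_real_derivative mean2 m - mean2 l) (at 0)"
proof -
  have pos: "Beta l \<beta> > 0" "Beta m \<beta> > 0" "Beta (l + \<beta>) \<alpha> > 0" "Beta (m + \<beta>) \<alpha> > 0"
    using ab assms by (auto intro!: Beta_real_pos)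
  have ni: "l \<notin> \<int>\<^sub>\<le>\<^sub>0" "m \<notin> \<int>\<^sub>\<le>\<^sub>0" "l + \<beta> \<notin> \<int>\<^sub>\<le>\<^sub>0" "m + \<beta> \<notin> \<int>\<^sub>\<le>\<^sub>0"
    "l + \<beta> + \<alpha> \<notin> \<int>\<^sub>\<le>\<^sub>0" "m + \<beta> + \<alpha> \<notin> \<int>\<^sub>\<le>\<^sub>0"
    using ab assms by (auto intro!: not_nonpos_Int)
  have B: "((\<lambda>s. Beta (f s) q) has_real_derivative
      Beta (f 0) q * (Digamma (f 0) - Digamma (f 0 + q)) * d) (at 0)"
    if "(f has_real_derivative d) (at 0)" "f 0 \<notin> \<int>\<^sub>\<le>\<^sub>0" "f 0 + q \<notin> \<int>\<^sub>\<le>\<^sub>0" for f q d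
    using DERIV_chain2[OF has_field_derivative_Beta1[OF that(2,3)] that(1)] by simp
  have *: "((\<lambda>s. ln (Beta (p - s) q / Beta p q * (Beta (r + s) q / Beta r q))) has_real_derivative
      Digamma (p + q) - Digamma p - (Digamma (r + q) - Digamma r)) (at 0)"
    if "Beta p q > 0" "Beta r q > 0" "p \<notin> \<int>\<^sub>\<le>\<^sub>0" "p + q \<notin> \<int>\<^sub>\<le>\<^sub>0" "r \<notin> \<int>\<^sub>\<le>\<^sub>0" "r + q \<notin> \<int>\<^sub>\<le>\<^sub>0" for p q r
  proof -
    have "((\<lambda>s. Beta (p - s) q) has_real_derivative Beta p q * (Digamma p - Digamma (p + q)) * -1) (at 0)"
    proof -
      have "((\<lambda>s. p - s) has_real_derivative -1) (at 0)" by (auto intro!: derivative_eq_intros)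
      from B[OF this] that show ?thesis by simp
    qed
    moreover have "((\<lambda>s. Beta (r + s) q) has_real_derivative Beta r q * (Digamma r - Digamma (r + q)) * 1) (at 0)"
    proof -
      have "((\<lambda>s. r + s) has_real_derivative 1) (at 0)" by (auto intro!: derivative_eq_intros)
      from B[OF this] that show ?thesis by simp
    qed
    ultimately have "((\<lambda>s. Beta (p - s) q / Beta p q * (Beta (r + s) q / Beta r q)) has_real_derivative
      Beta p q * (Digamma p - Digamma (p + q)) * -1 / Beta p q * (Beta (r + 0) q / Beta r q) +
      Beta r q * (Digamma r - Digamma (r + q)) * 1 / Beta r q * (Beta (p - 0) q / Beta p q)) (at 0)"
      by (intro DERIV_mult DERIV_cdivide)
    moreover have "Beta p q * (Digamma p - Digamma (p + q)) * -1 / Beta p q * (Beta (r + 0) q / Beta r q) +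
      Beta r q * (Digamma r - Digamma (r + q)) * 1 / Beta r q * (Beta (p - 0) q / Beta p q) =
      Digamma (p + q) - Digamma p - (Digamma (r + q) - Digamma r)"
      using that by simp
    ultimately have "((\<lambda>s. Beta (p - s) q / Beta p q * (Beta (r + s) q / Beta r q)) has_real_derivative
      Digamma (p + q) - Digamma p - (Digamma (r + q) - Digamma r)) (at 0)"
      by (simp only:)
    from DERIV_chain2[of ln 1 "\<lambda>s. Beta (p - s) q / Beta p q * (Beta (r + s) q / Beta r q)" 0, OF _ this]
    show ?thesis using that DERIV_ln_divide[of 1] by simp
  qed
  show "((\<lambda>s. ln (tilt1 l m s)) has_real_derivative mean1 m - mean1 l) (at 0)"
    unfolding tilt1_def mean1_def using *[of m \<beta> l] pos ni by simp
  show "((\<lambda>s. ln (tilt2 l m s)) has_real_derivative mean2 m - mean2 l) (at 0)"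
    unfolding tilt2_def mean2_def using *[of "l + \<beta>" \<alpha> "m + \<beta>"] pos ni by (simp add: mult.commute algebra_simps)
qed

text \<open>All the functions involved vanish at s = 0, so the signs of their derivatives decide for
  small s. The bounds on s keep the moments finite and, later, the exponent s / 4 below 1.\<close>

lemma exists_tilt_exponent:
  assumes "l > 0" "m > 0" "t * mean1 m + (1 - t) * mean2 m < t * mean1 l + (1 - t) * mean2 l"
  shows "eventually (\<lambda>s. 0 < s \<and> s < 1 \<and> s < m \<and> s < l \<and>
    t * ln (tilt1 l m s) + (1 - t) * ln (tilt2 l m s) < 0) (at_right 0)"
    and "mean1 m - mean1 l < mean2 m - mean2 l \<Longrightarrow>
      eventually (\<lambda>s. ln (tilt1 l m s) < ln (tilt2 l m s)) (at_right 0)"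
    and "mean2 m - mean2 l < mean1 m - mean1 l \<Longrightarrow>
      eventually (\<lambda>s. ln (tilt2 l m s) < ln (tilt1 l m s)) (at_right 0)"
proof -
  note D = has_derivative_ln_tilt[OF assms(1,2)]
  have z: "tilt1 l m 0 = 1" "tilt2 l m 0 = 1"
    using Beta_real_pos[of l \<beta>] Beta_real_pos[of m \<beta>] Beta_real_pos[of "l + \<beta>" \<alpha>] Beta_real_pos[of "m + \<beta>" \<alpha>] ab assms(1,2)
    by (auto simp: tilt1_def tilt2_def)
  have "((\<lambda>s. t * ln (tilt1 l m s) + (1 - t) * ln (tilt2 l m s)) has_real_derivative
      t * (mean1 m - mean1 l) + (1 - t) * (mean2 m - mean2 l)) (at 0)"
    by (intro DERIV_add DERIV_cmult D)
  moreover have "t * (mean1 m - mean1 l) + (1 - t) * (mean2 m - mean2 l) < 0"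
    using assms(3) by (simp add: algebra_simps)
  ultimately have "eventually (\<lambda>s. t * ln (tilt1 l m s) + (1 - t) * ln (tilt2 l m s) < 0) (at_right 0)"
    using eventually_at_right_DERIV_neg[of "\<lambda>s. t * ln (tilt1 l m s) + (1 - t) * ln (tilt2 l m s)" _ 0]
    by (simp add: z)
  moreover have "eventually (\<lambda>s. 0 < s \<and> s < 1 \<and> s < m \<and> s < l) (at_right 0)"
    using assms(1,2) unfolding eventually_at_right_field
    by (intro exI[of _ "min 1 (min m l)"]) auto
  ultimately show "eventually (\<lambda>s. 0 < s \<and> s < 1 \<and> s < m \<and> s < l \<and>
    t * ln (tilt1 l m s) + (1 - t) * ln (tilt2 l m s) < 0) (at_right 0)"
    by eventually_elim auto
  show "eventually (\<lambda>s. ln (tilt1 l m s) < ln (tilt2 l m s)) (at_right 0)"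
    if "mean1 m - mean1 l < mean2 m - mean2 l"
    using eventually_at_right_DERIV_neg[OF DERIV_diff[OF D]] that by (simp add: z)
  show "eventually (\<lambda>s. ln (tilt2 l m s) < ln (tilt1 l m s)) (at_right 0)"
    if "mean2 m - mean2 l < mean1 m - mean1 l"
    using eventually_at_right_DERIV_neg[OF DERIV_diff[OF D(2,1)]] that by (simp add: z)
qed

text \<open>To the right of the velocity the rate decreases at l, so m is taken just above l. The
  last inequality makes horizontal steps cheaper than vertical ones, which extends the decay from
  direction t to everything on its right.\<close>

lemma exists_tilt_right:
  assumes "l > 0" "0 < t" "t < 1" "velocity l < t"
  shows "\<exists>m>0. \<exists>s. 0 < s \<and> s < 1 \<and> s < m \<and> s < l \<and>
    t * ln (tilt1 l m s) + (1 - t) * ln (tilt2 l m s) < 0 \<and> ln (tilt1 l m s) < ln (tilt2 l m s)"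
proof -
  note M = has_derivative_mean[OF assms(1)] and pos = drift_pos[OF assms(1)]
  have "((\<lambda>m. t * mean1 m + (1 - t) * mean2 m) has_real_derivative
      t * - drift2 l + (1 - t) * drift1 l) (at l)"
    by (intro DERIV_add DERIV_cmult M)
  moreover have "t * - drift2 l + (1 - t) * drift1 l < 0"
    using assms(4) velocity_less_iff(1)[OF assms(1,2,3)] by simp
  ultimately have 1: "eventually (\<lambda>m. t * mean1 m + (1 - t) * mean2 m < t * mean1 l + (1 - t) * mean2 l) (at_right l)"
    by (rule eventually_at_right_DERIV_neg)
  have 2: "eventually (\<lambda>m. mean1 m - mean2 m < mean1 l - mean2 l) (at_right l)"
    using pos by (intro eventually_at_right_DERIV_neg[OF DERIV_diff[OF M]]) auto
  have "eventually (\<lambda>m. m > 0 \<and> t * mean1 m + (1 - t) * mean2 m < t * mean1 l + (1 - t) * mean2 l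
      \<and> mean1 m - mean2 m < mean1 l - mean2 l) (at_right l)"
    using 1 2 eventually_at_right_less[of l] by eventually_elim (use assms in auto)
  then obtain m where m: "m > 0" "t * mean1 m + (1 - t) * mean2 m < t * mean1 l + (1 - t) * mean2 l"
      "mean1 m - mean2 m < mean1 l - mean2 l"
    by (metis (mono_tags, lifting) eventually_happens' trivial_limit_at_right_real)
  have "eventually (\<lambda>s. (0 < s \<and> s < 1 \<and> s < m \<and> s < l \<and>
    t * ln (tilt1 l m s) + (1 - t) * ln (tilt2 l m s) < 0) \<and> ln (tilt1 l m s) < ln (tilt2 l m s)) (at_right 0)"
    using m(3) by (intro eventually_conj[OF exists_tilt_exponent(1)[OF assms(1) m(1,2)]]
      exists_tilt_exponent(2)[OF assms(1) m(1,2)]) linarith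
  then obtain s where "(0 < s \<and> s < 1 \<and> s < m \<and> s < l \<and>
    t * ln (tilt1 l m s) + (1 - t) * ln (tilt2 l m s) < 0) \<and> ln (tilt1 l m s) < ln (tilt2 l m s)"
    by (metis (mono_tags, lifting) eventually_happens' trivial_limit_at_right_real)
  with m(1) show ?thesis by blast
qed

text \<open>Here the rate increases at l, so m is taken just below l, and the comparison of the two
  step costs is reversed.\<close>

lemma exists_tilt_left:
  assumes "l > 0" "0 < t" "t < 1" "t < velocity l"
  shows "\<exists>m>0. \<exists>s. 0 < s \<and> s < 1 \<and> s < m \<and> s < l \<and>
    t * ln (tilt1 l m s) + (1 - t) * ln (tilt2 l m s) < 0 \<and> ln (tilt2 l m s) < ln (tilt1 l m s)"
proof -
  note M = has_derivative_mean[OF assms(1)] and pos = drift_pos[OF assms(1)]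
  have "((\<lambda>m. t * mean1 m + (1 - t) * mean2 m) has_real_derivative
      t * - drift2 l + (1 - t) * drift1 l) (at l)"
    by (intro DERIV_add DERIV_cmult M)
  moreover have "t * - drift2 l + (1 - t) * drift1 l > 0"
    using assms(4) velocity_less_iff(2)[OF assms(1,2,3)] by simp
  ultimately have 1: "eventually (\<lambda>m. t * mean1 m + (1 - t) * mean2 m < t * mean1 l + (1 - t) * mean2 l) (at_left l)"
    by (rule eventually_at_left_DERIV_pos)
  have 2: "eventually (\<lambda>m. mean2 m - mean1 m < mean2 l - mean1 l) (at_left l)"
    using pos by (intro eventually_at_left_DERIV_pos[OF DERIV_diff[OF M(2,1)]]) auto
  have "eventually (\<lambda>m. m > 0) (at_left l)"
    using assms(1) unfolding eventually_at_left_field by (intro exI[of _ 0]) auto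
  with 1 2 have "eventually (\<lambda>m. m > 0 \<and> t * mean1 m + (1 - t) * mean2 m < t * mean1 l + (1 - t) * mean2 l
      \<and> mean2 m - mean1 m < mean2 l - mean1 l) (at_left l)"
    by eventually_elim auto
  then obtain m where m: "m > 0" "t * mean1 m + (1 - t) * mean2 m < t * mean1 l + (1 - t) * mean2 l"
      "mean2 m - mean1 m < mean2 l - mean1 l"
    by (metis (mono_tags, lifting) eventually_happens' trivial_limit_at_left_real)
  have "eventually (\<lambda>s. (0 < s \<and> s < 1 \<and> s < m \<and> s < l \<and>
    t * ln (tilt1 l m s) + (1 - t) * ln (tilt2 l m s) < 0) \<and> ln (tilt2 l m s) < ln (tilt1 l m s)) (at_right 0)"
    using m(3) by (intro eventually_conj[OF exists_tilt_exponent(1)[OF assms(1) m(1,2)]]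
      exists_tilt_exponent(3)[OF assms(1) m(1,2)]) linarith
  then obtain s where "(0 < s \<and> s < 1 \<and> s < m \<and> s < l \<and>
    t * ln (tilt1 l m s) + (1 - t) * ln (tilt2 l m s) < 0) \<and> ln (tilt2 l m s) < ln (tilt1 l m s)"
    by (metis (mono_tags, lifting) eventually_happens' trivial_limit_at_right_real)
  with m(1) show ?thesis by blast
qed

end

section \<open>Quenched transition probabilities\<close>

text \<open>\<open>lev \<omega> x n k\<close> is the quenched probability of moving from \<open>x\<close> to \<open>x + (k, n - k)\<close> in \<open>n\<close> steps.\<close>

primrec lev :: "(site \<Rightarrow> real) \<Rightarrow> site \<Rightarrow> nat \<Rightarrow> int \<Rightarrow> real" where
  "lev \<omega> x 0 k = of_bool (k = 0)"
| "lev \<omega> x (Suc n) k = lev \<omega> x n (k - 1) * \<omega> (x + (k - 1, int n - (k - 1))) +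
     lev \<omega> x n k * (1 - \<omega> (x + (k, int n - k)))"

definition elliptic :: "(site \<Rightarrow> real) \<Rightarrow> bool" where
  "elliptic \<omega> \<longleftrightarrow> (\<forall>x. 0 < \<omega> x \<and> \<omega> x < 1)"

lemma ellipticD: "elliptic \<omega> \<Longrightarrow> 0 < \<omega> x" "elliptic \<omega> \<Longrightarrow> \<omega> x < 1"
  by (auto simp: elliptic_def simp del: split_paired_All)

lemma lev_eq_0: "k < 0 \<or> k > int n \<Longrightarrow> lev \<omega> x n k = 0"
  by (induction n arbitrary: k) auto

lemma lev_nonneg: "elliptic \<omega> \<Longrightarrow> 0 \<le> lev \<omega> x n k"
  by (induction n arbitrary: k) (auto simp: ellipticD less_imp_le intro!: add_nonneg_nonneg mult_nonneg_nonneg)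

lemma lev_pos: "elliptic \<omega> \<Longrightarrow> 0 \<le> k \<Longrightarrow> k \<le> int n \<Longrightarrow> 0 < lev \<omega> x n k"
proof (induction n arbitrary: k)
  case (Suc n)
  show ?case
  proof (cases "k \<le> int n")
    case True
    then show ?thesis using Suc
      by (auto simp: ellipticD less_imp_le intro!: add_nonneg_pos mult_nonneg_nonneg mult_pos_pos lev_nonneg)
  next
    case False
    then show ?thesis using Suc
      by (auto simp: ellipticD less_imp_le intro!: add_pos_nonneg mult_nonneg_nonneg mult_pos_pos lev_nonneg)
  qed
qed auto

text \<open>\<open>lev\<close> recurses on the last step; the comparison of the starting points e1
  and e2 rests on the first one. The two decompositions commute, which is the induction
  step.\<close>

lemma lev_first_step:
  "lev \<omega> x (Suc n) k = \<omega> x * lev \<omega> (x + e1) n (k - 1) + (1 - \<omega> x) * lev \<omega> (x + e2) n k"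
proof (induction n arbitrary: k)
  case 0
  show ?case by (cases "k = 0"; cases "k = 1") (auto simp: zero_prod_def[symmetric])
next
  case (Suc n)
  have 1: "x + e1 + (k - 1 - 1, int n - (k - 1 - 1)) = x + (k - 1, int (Suc n) - (k - 1))"
    "x + e1 + (k - 1, int n - (k - 1)) = x + (k, int (Suc n) - k)"
    "x + e2 + (k - 1, int n - (k - 1)) = x + (k - 1, int (Suc n) - (k - 1))"
    "x + e2 + (k, int n - k) = x + (k, int (Suc n) - k)"
    by (auto simp: e1_def e2_def add.commute add.left_commute prod_eq_iff)
  have "lev \<omega> x (Suc (Suc n)) k =
    (\<omega> x * lev \<omega> (x + e1) n (k - 1 - 1) + (1 - \<omega> x) * lev \<omega> (x + e2) n (k - 1)) *
      \<omega> (x + (k - 1, int (Suc n) - (k - 1))) +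
    (\<omega> x * lev \<omega> (x + e1) n (k - 1) + (1 - \<omega> x) * lev \<omega> (x + e2) n k) *
      (1 - \<omega> (x + (k, int (Suc n) - k)))"
    by (simp only: lev.simps(2)[of _ _ "Suc n"] Suc.IH)
  then show ?case
    unfolding lev.simps(2)[of \<omega> "x + e1" n] lev.simps(2)[of \<omega> "x + e2" n] 1
    by (simp add: algebra_simps)
qed

text \<open>The martingale property of a harmonic function along the walk. The alternative
  \<open>lev \<omega> x n k = 0\<close> confines harmonicity to the sites that carry mass, which
  permits functions harmonic only in a quadrant.\<close>

lemma lev_sum:
  assumes "\<And>k. h (x + (k, int n - k)) = \<omega> (x + (k, int n - k)) * h (x + (k + 1, int n - k)) +
      (1 - \<omega> (x + (k, int n - k))) * h (x + (k, int n - k + 1)) \<or> lev \<omega> x n k = 0"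
  shows "(\<Sum>k = 0..int (Suc n). lev \<omega> x (Suc n) k * h (x + (k, int (Suc n) - k))) =
    (\<Sum>k = 0..int n. lev \<omega> x n k * h (x + (k, int n - k)))"
proof -
  have z: "lev \<omega> x n (int n + 1) = 0" "lev \<omega> x n (- 1) = 0" by (auto intro: lev_eq_0)
  have "(\<Sum>k = 0..int (Suc n). lev \<omega> x (Suc n) k * h (x + (k, int (Suc n) - k))) =
    (\<Sum>k = 0..int n + 1. lev \<omega> x n (k - 1) * \<omega> (x + (k - 1, int n - (k - 1))) * h (x + (k, int n - (k - 1)))) +
    (\<Sum>k = 0..int n + 1. lev \<omega> x n k * (1 - \<omega> (x + (k, int n - k))) * h (x + (k, int n - k + 1)))"
    unfolding sum.distrib[symmetric]
    by (intro sum.cong) (auto simp: algebra_simps)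
  also have "(\<Sum>k = 0..int n + 1. lev \<omega> x n (k - 1) * \<omega> (x + (k - 1, int n - (k - 1))) * h (x + (k, int n - (k - 1)))) =
    (\<Sum>k = - 1..int n. lev \<omega> x n k * \<omega> (x + (k, int n - k)) * h (x + (k + 1, int n - k)))"
    by (intro sum.reindex_bij_witness[of _ "\<lambda>k. k + 1" "\<lambda>k. k - 1"]) auto
  also have "\<dots> = (\<Sum>k = 0..int n. lev \<omega> x n k * \<omega> (x + (k, int n - k)) * h (x + (k + 1, int n - k)))"
    using z by (intro sum.mono_neutral_right) (auto intro!: lev_eq_0)
  also have "(\<Sum>k = 0..int n + 1. lev \<omega> x n k * (1 - \<omega> (x + (k, int n - k))) * h (x + (k, int n - k + 1))) =
    (\<Sum>k = 0..int n. lev \<omega> x n k * (1 - \<omega> (x + (k, int n - k))) * h (x + (k, int n - k + 1)))"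
    by (intro sum.mono_neutral_right) (auto intro!: lev_eq_0)
  finally show ?thesis
    unfolding sum.distrib[symmetric]
  proof (rule trans, intro sum.cong refl)
    fix k
    show "lev \<omega> x n k * \<omega> (x + (k, int n - k)) * h (x + (k + 1, int n - k)) +
         lev \<omega> x n k * (1 - \<omega> (x + (k, int n - k))) * h (x + (k, int n - k + 1)) =
         lev \<omega> x n k * h (x + (k, int n - k))"
      using assms[of k]
    proof
      assume e: "h (x + (k, int n - k)) = \<omega> (x + (k, int n - k)) * h (x + (k + 1, int n - k)) +
        (1 - \<omega> (x + (k, int n - k))) * h (x + (k, int n - k + 1))"
      show ?thesis unfolding e by (simp add: algebra_simps)
    qed simp
  qed
qed

text \<open>Total positivity of order two; the induction step is the Cauchy--Binet formula.\<close>

lemma lev_cross: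
  assumes "elliptic \<omega>" "k \<le> k'"
  shows "lev \<omega> (x + e1) n (k - 1) * lev \<omega> (x + e2) n k' \<le>
    lev \<omega> (x + e1) n (k' - 1) * lev \<omega> (x + e2) n k"
  using assms(2)
proof (induction n arbitrary: k k')
  case 0
  then show ?case by auto
next
  case (Suc n)
  \<comment> \<open>Both rows are indexed by the absolute position x + (k, Suc n - k); seen from x +
    e1 its first coordinate is k - 1.\<close>
  define f where "f k = lev \<omega> (x + e1) n (k - 1)" for k
  define g where "g k = lev \<omega> (x + e2) n k" for k
  define p where "p k = \<omega> (x + (k, int (Suc n) - k))" for k
  have p: "0 \<le> p k" "p k \<le> 1" for k
    using ellipticD[OF assms(1)] by (auto simp: p_def less_imp_le)
  have e: "x + e1 + (k - 1 - 1, int n - (k - 1 - 1)) = x + (k - 1, int (Suc n) - (k - 1))"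
    "x + e1 + (k - 1, int n - (k - 1)) = x + (k, int (Suc n) - k)"
    "x + e2 + (k - 1, int n - (k - 1)) = x + (k - 1, int (Suc n) - (k - 1))"
    "x + e2 + (k, int n - k) = x + (k, int (Suc n) - k)" for k
    by (auto simp: e1_def e2_def add.commute add.left_commute prod_eq_iff)
  have F: "lev \<omega> (x + e1) (Suc n) (k - 1) = f (k - 1) * p (k - 1) + f k * (1 - p k)" for k
    unfolding lev.simps(2) e f_def p_def by simp
  have G: "lev \<omega> (x + e2) (Suc n) k = g (k - 1) * p (k - 1) + g k * (1 - p k)" for k
    unfolding lev.simps(2) e g_def p_def by simp
  have IH: "0 \<le> f j' * g j - f j * g j'" if "j \<le> j'" for j j'
    using Suc.IH[OF that] by (simp add: f_def g_def)
  show ?case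
  proof (cases "k = k'")
    case False
    then have lt: "k \<le> k' - 1" using Suc.prems by simp
    \<comment> \<open>The minor of the next level as a nonnegative combination of four minors of
      this level. Since k < k', all four pairs of columns are in order, including k and k' -
      1.\<close>
    have "0 \<le> p (k' - 1) * p (k - 1) * (f (k' - 1) * g (k - 1) - f (k - 1) * g (k' - 1)) +
      p (k' - 1) * (1 - p k) * (f (k' - 1) * g k - f k * g (k' - 1)) +
      (1 - p k') * p (k - 1) * (f k' * g (k - 1) - f (k - 1) * g k') +
      (1 - p k') * (1 - p k) * (f k' * g k - f k * g k')"
      using lt p by (intro add_nonneg_nonneg mult_nonneg_nonneg IH) auto
    then show ?thesis unfolding F G by (simp add: algebra_simps)
  qed simp
qed

lemma lev_measurable [measurable]:
  "(\<lambda>\<omega>. lev \<omega> x n k) \<in> borel_measurable (PiM UNIV (\<lambda>_. borel))"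
  by (induction n arbitrary: k) (simp_all del: of_bool_eq_1_iff)

text \<open>Each step raises the coordinate sum by 1, so z determines the number of steps. The guard
  matters: for z on a lower level, \<open>nat\<close> would truncate to 0 and \<open>lev\<close>
  could be 1.\<close>

definition visit_prob :: "(site \<Rightarrow> real) \<Rightarrow> site \<Rightarrow> site \<Rightarrow> real" where
  "visit_prob \<omega> y z = (if fst z + snd z < fst y + snd y then 0
     else lev \<omega> y (nat (fst z + snd z - fst y - snd y)) (fst z - fst y))"

lemma visit_prob_first_step:
  assumes "fst y + snd y < fst z + snd z"
  shows "visit_prob \<omega> y z = \<omega> y * visit_prob \<omega> (y + e1) z + (1 - \<omega> y) * visit_prob \<omega> (y + e2) z"
proof -
  have "nat (fst z + snd z - fst y - snd y) = Suc (nat (fst z + snd z - fst y - snd y - 1))"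
    using assms by simp
  then show ?thesis using assms
    by (simp add: visit_prob_def lev_first_step e1_def e2_def algebra_simps del: lev.simps)
qed

lemma visit_prob_pos:
  "elliptic \<omega> \<Longrightarrow> fst y \<le> fst z \<Longrightarrow> snd y \<le> snd z \<Longrightarrow> 0 < visit_prob \<omega> y z"
  by (auto simp: visit_prob_def intro!: lev_pos)

lemma visit_prob_nonneg: "elliptic \<omega> \<Longrightarrow> 0 \<le> visit_prob \<omega> y z"
  by (auto simp: visit_prob_def intro!: lev_nonneg)

lemma nn_trans_elliptic: "elliptic \<omega> \<Longrightarrow> nn_trans (env_trans \<omega>)"
  by (auto simp: nn_trans_def env_trans_def e1_def e2_def elliptic_def less_imp_le simp del: split_paired_All)

lemma prefix_measurable:
  assumes "nn_trans p"
  shows "{X. (\<forall>i\<le>n. X i = a i) \<and> X m = z} \<in> sets (path_law p x)"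
    and "{X. \<forall>i\<le>n. X i = a i} \<in> sets (path_law p x)"
    and "{X. X m = z} \<in> sets (path_law p x)"
proof -
  have s: "sets (path_law p x) = sets (PiM UNIV (\<lambda>_::nat. borel :: site measure))"
    using sets_path_law[OF assms] sets_PiM_equal_borel by metis
  have m: "{X :: nat \<Rightarrow> site. X m = z} \<in> sets (PiM UNIV (\<lambda>_::nat. borel :: site measure))" for m z
  proof -
    have "(\<lambda>X. X m) -` {z} \<inter> space (PiM UNIV (\<lambda>_::nat. borel :: site measure)) \<in> sets (PiM UNIV (\<lambda>_::nat. borel :: site measure))"
      by (intro measurable_sets[OF measurable_component_singleton]) auto
    then show ?thesis by (simp add: space_PiM vimage_def)
  qed
  then show 3: "{X. X m = z} \<in> sets (path_law p x)" unfolding s by auto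
  have "{X. \<forall>i\<le>n. X i = a i} = (\<Inter>i\<in>{..n}. {X. X i = a i})" by auto
  also have "\<dots> \<in> sets (path_law p x)" unfolding s by (intro sets.countable_INT') (auto intro!: m)
  finally show 2: "{X. \<forall>i\<le>n. X i = a i} \<in> sets (path_law p x)" .
  have "{X. (\<forall>i\<le>n. X i = a i) \<and> X m = z} = {X. \<forall>i\<le>n. X i = a i} \<inter> {X. X m = z}" by auto
  then show "{X. (\<forall>i\<le>n. X i = a i) \<and> X m = z} \<in> sets (path_law p x)" using 2 3 by auto
qed

lemma measure_path_law_prefix:
  assumes "nn_trans p"
  shows "measure (path_law p x) {X. \<forall>i\<le>n. X i = a i} =
    of_bool (a 0 = x) * (\<Prod>i<n. p (a i) (a (Suc i)))"
  unfolding measure_def emeasure_path_law_cylinder[OF assms]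
  by (simp add: prod_nonneg nn_trans_nonneg[OF assms])

text \<open>What is known about \<open>path_law\<close> are its cylinder probabilities, so the
  induction on m carries a prefix in place of a Markov property: the prefix grows by the next site,
  and only two continuations have positive probability.\<close>

lemma measure_path_law_prefix_visit:
  assumes el: "elliptic \<omega>"
  shows "measure (path_law (env_trans \<omega>) x) {X. (\<forall>i\<le>n. X i = a i) \<and> X (n + m) = z} =
    of_bool (a 0 = x) * (\<Prod>i<n. env_trans \<omega> (a i) (a (Suc i))) *
      (if fst z + snd z = fst (a n) + snd (a n) + int m then visit_prob \<omega> (a n) z else 0)"
proof (induction m arbitrary: n a)
  case 0
  note nn = nn_trans_elliptic[OF el]
  show ?case
  proof (cases "a n = z")
    case True
    then have "{X. (\<forall>i\<le>n. X i = a i) \<and> X (n + 0) = z} = {X. \<forall>i\<le>n. X i = a i}" by auto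
    then show ?thesis using True by (simp add: measure_path_law_prefix[OF nn] visit_prob_def)
  next
    case False
    then have e: "{X. (\<forall>i\<le>n. X i = a i) \<and> X (n + 0) = z} = {}" by auto
    have "fst z + snd z = fst (a n) + snd (a n) \<Longrightarrow> fst z \<noteq> fst (a n)"
      using False by (auto simp: prod_eq_iff)
    then show ?thesis unfolding e by (auto simp: visit_prob_def)
  qed
next
  case (Suc m)
  note nn = nn_trans_elliptic[OF el]
  interpret prob_space "path_law (env_trans \<omega>) x" by (rule prob_space_path_law[OF nn])
  note meas = prefix_measurable[OF nn]
  define b where "b y = a(Suc n := y)" for y
  let ?M = "path_law (env_trans \<omega>) x"
  let ?A = "{X. (\<forall>i\<le>n. X i = a i) \<and> X (n + Suc m) = z}"
  let ?B = "\<lambda>y. {X. (\<forall>i\<le>Suc n. X i = b y i) \<and> X (Suc n + m) = z}"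
  have B: "?B y = {X. (\<forall>i\<le>n. X i = a i) \<and> X (Suc n) = y \<and> X (n + Suc m) = z}" for y
    by (auto simp: b_def le_Suc_eq)
  have ne: "a n + e1 \<noteq> a n + e2" by (simp add: e1_def e2_def)
  \<comment> \<open>The paths whose site number n + 1 is neither of the two neighbours; they lie in
    a countable union of null cylinders.\<close>
  let ?C = "?A - (?B (a n + e1) \<union> ?B (a n + e2))"
  have "prob ?C = 0"
  proof -
    have "AE X in ?M. X \<notin> ?C"
    proof -
      have "AE X in ?M. \<forall>y. y \<noteq> a n + e1 \<longrightarrow> y \<noteq> a n + e2 \<longrightarrow> \<not> (\<forall>i\<le>Suc n. X i = b y i)"
      proof (subst AE_all_countable, rule allI)
        fix y
        show "AE X in ?M. y \<noteq> a n + e1 \<longrightarrow> y \<noteq> a n + e2 \<longrightarrow> \<not> (\<forall>i\<le>Suc n. X i = b y i)"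
        proof (cases "y \<noteq> a n + e1 \<and> y \<noteq> a n + e2")
          case True
          then have "prob {X. \<forall>i\<le>Suc n. X i = b y i} = 0"
            by (simp add: measure_path_law_prefix[OF nn] b_def env_trans_def)
          then have "{X. \<forall>i\<le>Suc n. X i = b y i} \<in> null_sets ?M"
            by (intro null_setsI meas(2)) (simp add: emeasure_eq_measure)
          then have "AE X in ?M. X \<notin> {X. \<forall>i\<le>Suc n. X i = b y i}"
            by (rule AE_not_in)
          then show ?thesis by eventually_elim auto
        qed auto
      qed
      then show ?thesis
      proof eventually_elim
        case (elim X)
        from elim[rule_format, of "X (Suc n)"] show ?case by (auto simp: b_def le_Suc_eq B)
      qed
    qed
    moreover have "?C \<in> events" using meas(1) by (intro sets.Diff sets.Un) auto
    ultimately show ?thesis by (simp add: prob_eq_0)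
  qed
  moreover have "?B y \<subseteq> ?A" for y unfolding B by auto
  then have "prob ?C = prob ?A - prob (?B (a n + e1) \<union> ?B (a n + e2))"
    by (intro finite_measure_Diff meas sets.Un Un_least)
  ultimately have "prob ?A = prob (?B (a n + e1) \<union> ?B (a n + e2))"
    by simp
  also have "\<dots> = prob (?B (a n + e1)) + prob (?B (a n + e2))"
    using ne by (intro finite_measure_Union meas) (unfold B, auto)
  also have "\<dots> = of_bool (a 0 = x) * (\<Prod>i<n. env_trans \<omega> (a i) (a (Suc i))) *
      (if fst z + snd z = fst (a n) + snd (a n) + int (Suc m) then
       \<omega> (a n) * visit_prob \<omega> (a n + e1) z + (1 - \<omega> (a n)) * visit_prob \<omega> (a n + e2) z else 0)"
  proof -
    have P: "(\<Prod>i<Suc n. env_trans \<omega> (b y i) (b y (Suc i))) =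
        (\<Prod>i<n. env_trans \<omega> (a i) (a (Suc i))) * env_trans \<omega> (a n) y" for y
      by (simp add: b_def)
    have Q: "b y 0 = a 0" "b y (Suc n) = y" for y by (auto simp: b_def)
    have R: "env_trans \<omega> (a n) (a n + e1) = \<omega> (a n)" "env_trans \<omega> (a n) (a n + e2) = 1 - \<omega> (a n)"
      using ne by (auto simp: env_trans_def)
    have S: "fst (y + e1) + snd (y + e1) = fst y + snd y + 1"
      "fst (y + e2) + snd (y + e2) = fst y + snd y + 1" for y
      by (auto simp: e1_def e2_def)
    show ?thesis
      unfolding Suc.IH P Q R S by (simp add: algebra_simps)
  qed
  also have "\<dots> = of_bool (a 0 = x) * (\<Prod>i<n. env_trans \<omega> (a i) (a (Suc i))) *
      (if fst z + snd z = fst (a n) + snd (a n) + int (Suc m) then visit_prob \<omega> (a n) z else 0)"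
    using visit_prob_first_step[of "a n" z \<omega>] by auto
  finally show ?case .
qed

lemma measure_path_law_visit:
  assumes el: "elliptic \<omega>"
  shows "measure (path_law (env_trans \<omega>) x) {X. X m = z} =
    (if fst z + snd z = fst x + snd x + int m then visit_prob \<omega> x z else 0)"
proof -
  note nn = nn_trans_elliptic[OF el]
  interpret prob_space "path_law (env_trans \<omega>) x" by (rule prob_space_path_law[OF nn])
  note meas = prefix_measurable[OF nn]
  have "prob {X. \<forall>i\<le>0. X i = (\<lambda>_. x) i} = 1"
    by (subst measure_path_law_prefix[OF nn]) simp
  then have "AE X in path_law (env_trans \<omega>) x. X \<in> {X. \<forall>i\<le>0. X i = (\<lambda>_. x) i}"
    by (subst (asm) prob_eq_1[OF meas(2)])
  then have "prob {X. X m = z} = prob {X. (\<forall>i\<le>0. X i = (\<lambda>_. x) i) \<and> X (0 + m) = z}"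
    by (intro finite_measure_eq_AE meas) (elim eventually_mono, auto)
  then show ?thesis
    by (subst (asm) measure_path_law_prefix_visit[OF el]) simp
qed

lemma hit_prob_eq:
  assumes "elliptic \<omega>" "fst y \<le> fst z" "snd y \<le> snd z"
  shows "hit_prob \<omega> y z = visit_prob \<omega> y z"
  using assms by (simp add: hit_prob_def measure_path_law_visit l1_def)

section \<open>Local moves on infinite products\<close>

text \<open>The preimage of a finite box is a box over the coordinates in the image of J under
  \<pi>, and injectivity matches the two products. It serves reflection, translation and the change
  from the unit interval to the real line.\<close>

lemma distr_PiM_map:
  fixes M :: "'i \<Rightarrow> 'a measure" and N :: "'j \<Rightarrow> 'b measure" and \<pi> :: "'j \<Rightarrow> 'i"
  assumes M: "\<And>i. prob_space (M i)" and \<pi>: "inj \<pi>"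
    and g [measurable]: "\<And>j. g j \<in> measurable (M (\<pi> j)) (N j)"
  shows "distr (PiM UNIV M) (PiM UNIV N) (\<lambda>X j. g j (X (\<pi> j))) =
    PiM UNIV (\<lambda>j. distr (M (\<pi> j)) (N j) (g j))" (is "distr ?K ?N ?t = ?I")
proof (rule measure_eqI_PiM_infinite[symmetric, OF refl])
  have P: "prob_space (distr (M (\<pi> j)) (N j) (g j))" for j
    by (rule prob_space.prob_space_distr[OF M g])
  interpret prob_space ?I
    by (intro prob_space_PiM P)
  show "finite_measure ?I" by unfold_locales
  show "sets (distr ?K ?N ?t) = sets ?I" by (simp cong: sets_PiM_cong)
  have t [measurable]: "?t \<in> measurable ?K ?N"
    by (rule measurable_PiM_single') (auto simp: space_PiM PiE_iff intro: measurable_space[OF g])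
  fix A J assume J: "finite J" and A: "\<And>j. j \<in> J \<Longrightarrow> A j \<in> sets (distr (M (\<pi> j)) (N j) (g j))"
  have [simp]: "the_inv \<pi> (\<pi> j) = j" for j using \<pi> by (rule the_inv_f_f)
  define A' where "A' i = (let j = the_inv \<pi> i in g j -` A j \<inter> space (M i))" for i
  have "?I (prod_emb UNIV (\<lambda>j. distr (M (\<pi> j)) (N j) (g j)) J (Pi\<^sub>E J A)) =
      (\<Prod>j\<in>J. emeasure (distr (M (\<pi> j)) (N j) (g j)) (A j))"
    using J A P by (intro emeasure_PiM_emb) auto
  also have "\<dots> = (\<Prod>j\<in>J. emeasure (M (\<pi> j)) (A' (\<pi> j)))"
    using A by (intro prod.cong refl) (simp add: emeasure_distr A'_def)
  also have "\<dots> = (\<Prod>i\<in>\<pi> ` J. emeasure (M i) (A' i))"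
    using \<pi> by (subst prod.reindex) (auto intro: inj_on_subset)
  also have "\<dots> = ?K (prod_emb UNIV M (\<pi> ` J) (Pi\<^sub>E (\<pi> ` J) A'))"
    using J A M by (intro emeasure_PiM_emb[symmetric]) (auto simp: A'_def intro!: measurable_sets[OF g])
  also have "prod_emb UNIV M (\<pi> ` J) (Pi\<^sub>E (\<pi> ` J) A') =
      ?t -` prod_emb UNIV (\<lambda>j. distr (M (\<pi> j)) (N j) (g j)) J (Pi\<^sub>E J A) \<inter> space ?K"
    using measurable_space[OF g] by (auto simp: prod_emb_def space_PiM PiE_iff A'_def)
  also have "?K \<dots> = distr ?K ?N ?t (prod_emb UNIV (\<lambda>j. distr (M (\<pi> j)) (N j) (g j)) J (Pi\<^sub>E J A))"
  proof (rule emeasure_distr[symmetric, OF t])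
    have "prod_emb UNIV (\<lambda>j. distr (M (\<pi> j)) (N j) (g j)) J (Pi\<^sub>E J A) \<in> sets ?I"
      using J A by (intro sets_PiM_I) auto
    then show "prod_emb UNIV (\<lambda>j. distr (M (\<pi> j)) (N j) (g j)) J (Pi\<^sub>E J A) \<in> sets ?N"
      by (simp cong: sets_PiM_cong)
  qed
  finally show "?I (prod_emb UNIV (\<lambda>j. distr (M (\<pi> j)) (N j) (g j)) J (Pi\<^sub>E J A)) =
    distr ?K ?N ?t (prod_emb UNIV (\<lambda>j. distr (M (\<pi> j)) (N j) (g j)) J (Pi\<^sub>E J A))" .
qed

lemma nn_integral_PiM_resample:
  assumes M: "\<And>i. prob_space (M i)" and f [measurable]: "f \<in> borel_measurable (PiM UNIV M)"
  shows "(\<integral>\<^sup>+X. f X \<partial>PiM UNIV M) = (\<integral>\<^sup>+X. \<integral>\<^sup>+x. f (X(k := x)) \<partial>M k \<partial>PiM UNIV M)"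
proof -
  interpret P: prob_space "PiM UNIV M" by (intro prob_space_PiM M)
  interpret K: prob_space "M k" by (rule M)
  interpret pair_sigma_finite "M k" "PiM UNIV M" ..
  have m: "(\<lambda>(x, X). X(k := x)) \<in> measurable (M k \<Otimes>\<^sub>M PiM UNIV M) (PiM UNIV M)"
    using measurable_fun_upd[of UNIV UNIV k "\<lambda>p. snd p" "M k \<Otimes>\<^sub>M PiM UNIV M" M "\<lambda>p. fst p"]
    by (simp add: case_prod_beta')
  have "(\<integral>\<^sup>+X. f X \<partial>PiM UNIV M) =
      (\<integral>\<^sup>+X. f X \<partial>distr (M k \<Otimes>\<^sub>M PiM UNIV M) (PiM UNIV M) (\<lambda>(x, X). X(k := x)))"
    using distr_pair_PiM_eq_PiM[of UNIV M k] M by simp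
  also have "\<dots> = (\<integral>\<^sup>+p. f ((snd p)(k := fst p)) \<partial>(M k \<Otimes>\<^sub>M PiM UNIV M))"
    using m by (subst nn_integral_distr) (auto simp: case_prod_beta')
  also have "\<dots> = (\<integral>\<^sup>+X. \<integral>\<^sup>+x. f (X(k := x)) \<partial>M k \<partial>PiM UNIV M)"
    using measurable_compose[OF m f]
    by (subst nn_integral_snd[symmetric]) (auto simp: case_prod_beta')
  finally show ?thesis .
qed

lemma nn_integral_PiM_prod:
  assumes M: "\<And>i. prob_space (M i)" and J: "finite J"
    and f [measurable]: "\<And>i. i \<in> J \<Longrightarrow> f i \<in> borel_measurable (M i)"
  shows "(\<integral>\<^sup>+X. (\<Prod>i\<in>J. f i (X i)) \<partial>PiM UNIV M) = (\<Prod>i\<in>J. \<integral>\<^sup>+x. f i x \<partial>M i)"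
proof -
  interpret product_prob_space M UNIV by (intro product_prob_spaceI M)
  have "(\<Prod>i\<in>J. \<integral>\<^sup>+x. f i x \<partial>M i) = (\<integral>\<^sup>+X. (\<Prod>i\<in>J. f i (X i)) \<partial>PiM J M)"
    by (rule product_nn_integral_prod[symmetric, OF J f])
  also have "\<dots> = (\<integral>\<^sup>+X. (\<Prod>i\<in>J. f i (X i)) \<partial>distr (PiM UNIV M) (PiM J M) (\<lambda>X. restrict X J))"
    using J by (subst distr_PiM_restrict_finite) auto
  also have "\<dots> = (\<integral>\<^sup>+X. (\<Prod>i\<in>J. f i (X i)) \<partial>PiM UNIV M)"
    by (subst nn_integral_distr) (auto intro!: nn_integral_cong prod.cong)
  finally show ?thesis ..
qed

text \<open>Resampling the three coordinates with all others frozen reduces the claim to the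
  identity \<open>pres\<close> for three independent variables.\<close>

lemma distr_PiM_local_move:
  fixes M :: "'i \<Rightarrow> real measure" and f1 f2 f3 :: "real \<Rightarrow> real \<Rightarrow> real \<Rightarrow> real"
  assumes M: "\<And>i. prob_space (M i)" and sM [measurable_cong]: "\<And>i. sets (M i) = sets borel"
    and k: "k1 \<noteq> k2" "k1 \<noteq> k3" "k2 \<noteq> k3"
    and f [measurable]: "(\<lambda>(a, b, w). f1 a b w) \<in> borel_measurable (borel \<Otimes>\<^sub>M borel \<Otimes>\<^sub>M borel)"
      "(\<lambda>(a, b, w). f2 a b w) \<in> borel_measurable (borel \<Otimes>\<^sub>M borel \<Otimes>\<^sub>M borel)"
      "(\<lambda>(a, b, w). f3 a b w) \<in> borel_measurable (borel \<Otimes>\<^sub>M borel \<Otimes>\<^sub>M borel)"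
    and pres: "\<And>g :: real \<Rightarrow> real \<Rightarrow> real \<Rightarrow> ennreal.
      (\<lambda>(a, b, w). g a b w) \<in> borel_measurable (borel \<Otimes>\<^sub>M borel \<Otimes>\<^sub>M borel) \<Longrightarrow>
      (\<integral>\<^sup>+w. \<integral>\<^sup>+b. \<integral>\<^sup>+a. g (f1 a b w) (f2 a b w) (f3 a b w) \<partial>M k1 \<partial>M k2 \<partial>M k3) =
      (\<integral>\<^sup>+w. \<integral>\<^sup>+b. \<integral>\<^sup>+a. g a b w \<partial>M k1 \<partial>M k2 \<partial>M k3)"
  defines "T \<equiv> \<lambda>X. X(k1 := f1 (X k1) (X k2) (X k3), k2 := f2 (X k1) (X k2) (X k3),
      k3 := f3 (X k1) (X k2) (X k3))"
  shows "T \<in> measurable (PiM UNIV M) (PiM UNIV M)" "distr (PiM UNIV M) (PiM UNIV M) T = PiM UNIV M"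
proof -
  have sp: "space (M i) = UNIV" for i using sets_eq_imp_space_eq[OF sM] by simp
  have c: "(\<lambda>x. (case p x of (a, b, w) \<Rightarrow> h a b w)) = (\<lambda>x. h (fst (p x)) (fst (snd (p x))) (snd (snd (p x))))"
    for p :: "'z \<Rightarrow> real \<times> real \<times> real" and h :: "real \<Rightarrow> real \<Rightarrow> real \<Rightarrow> real"
    by (auto simp: case_prod_beta')
  have fm [measurable]: "(\<lambda>x. f1 (u x) (v x) (w x)) \<in> borel_measurable L"
      "(\<lambda>x. f2 (u x) (v x) (w x)) \<in> borel_measurable L"
      "(\<lambda>x. f3 (u x) (v x) (w x)) \<in> borel_measurable L"
    if "u \<in> borel_measurable L" "v \<in> borel_measurable L" "w \<in> borel_measurable L"
    for u v w and L :: "'z measure"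
    using measurable_compose[OF _ f(1), of "\<lambda>x. (u x, v x, w x)" L]
      measurable_compose[OF _ f(2), of "\<lambda>x. (u x, v x, w x)" L]
      measurable_compose[OF _ f(3), of "\<lambda>x. (u x, v x, w x)" L] that by auto
  have comp [measurable]: "(\<lambda>X. X i) \<in> borel_measurable (PiM UNIV M)" for i
    using measurable_component_singleton[of i UNIV M] measurable_cong_sets[OF refl sM] by blast
  have upd [measurable]: "(\<lambda>x. (X x)(k := u x)) \<in> measurable L (PiM UNIV M)"
    if "X \<in> measurable L (PiM UNIV M)" "u \<in> borel_measurable L" for X u k and L :: "'z measure"
    using that by (intro measurable_fun_upd[of UNIV UNIV]) (auto simp: measurable_cong_sets[OF refl sM])
  show T [measurable]: "T \<in> measurable (PiM UNIV M) (PiM UNIV M)"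
    unfolding T_def by measurable
  have sf: "sigma_finite_measure (M i)" for i
    using M prob_space_imp_sigma_finite by blast
  interpret S1: sigma_finite_measure "M k1" by (rule sf)
  interpret S2: sigma_finite_measure "M k2" by (rule sf)
  interpret S3: sigma_finite_measure "M k3" by (rule sf)
  have res: "(\<integral>\<^sup>+X. F X \<partial>PiM UNIV M) =
    (\<integral>\<^sup>+X. \<integral>\<^sup>+w. \<integral>\<^sup>+b. \<integral>\<^sup>+a. F (X(k3 := w, k2 := b, k1 := a)) \<partial>M k1 \<partial>M k2 \<partial>M k3 \<partial>PiM UNIV M)"
    if F [measurable]: "F \<in> borel_measurable (PiM UNIV M)" for F
  proof -
    have "(\<integral>\<^sup>+X. F X \<partial>PiM UNIV M) = (\<integral>\<^sup>+X. \<integral>\<^sup>+a. F (X(k1 := a)) \<partial>M k1 \<partial>PiM UNIV M)"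
      by (rule nn_integral_PiM_resample[OF M F])
    also have "\<dots> = (\<integral>\<^sup>+X. \<integral>\<^sup>+b. \<integral>\<^sup>+a. F (X(k2 := b, k1 := a)) \<partial>M k1 \<partial>M k2 \<partial>PiM UNIV M)"
      by (rule nn_integral_PiM_resample[OF M]) measurable
    also have "\<dots> = (\<integral>\<^sup>+X. \<integral>\<^sup>+w. \<integral>\<^sup>+b. \<integral>\<^sup>+a. F (X(k3 := w, k2 := b, k1 := a)) \<partial>M k1 \<partial>M k2 \<partial>M k3 \<partial>PiM UNIV M)"
      by (rule nn_integral_PiM_resample[OF M]) measurable
    finally show ?thesis .
  qed
  have main: "(\<integral>\<^sup>+X. F (T X) \<partial>PiM UNIV M) = (\<integral>\<^sup>+X. F X \<partial>PiM UNIV M)"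
    if F [measurable]: "F \<in> borel_measurable (PiM UNIV M)" for F
  proof -
    have "(\<integral>\<^sup>+X. F (T X) \<partial>PiM UNIV M) =
      (\<integral>\<^sup>+X. \<integral>\<^sup>+w. \<integral>\<^sup>+b. \<integral>\<^sup>+a. F (T (X(k3 := w, k2 := b, k1 := a))) \<partial>M k1 \<partial>M k2 \<partial>M k3 \<partial>PiM UNIV M)"
      by (rule res) measurable
    also have "\<dots> = (\<integral>\<^sup>+X. \<integral>\<^sup>+w. \<integral>\<^sup>+b. \<integral>\<^sup>+a. F (X(k3 := w, k2 := b, k1 := a)) \<partial>M k1 \<partial>M k2 \<partial>M k3 \<partial>PiM UNIV M)"
    proof (rule nn_integral_cong)
      fix X assume X: "X \<in> space (PiM UNIV M)"
      have g: "(\<lambda>(a, b, w). F (X(k3 := w, k2 := b, k1 := a))) \<in> borel_measurable (borel \<Otimes>\<^sub>M borel \<Otimes>\<^sub>M borel)"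
        using X by (simp add: case_prod_beta') measurable
      have T': "T (X(k3 := w, k2 := b, k1 := a)) = X(k3 := f3 a b w, k2 := f2 a b w, k1 := f1 a b w)" for w b a
        using k by (auto simp: T_def fun_eq_iff)
      show "(\<integral>\<^sup>+w. \<integral>\<^sup>+b. \<integral>\<^sup>+a. F (T (X(k3 := w, k2 := b, k1 := a))) \<partial>M k1 \<partial>M k2 \<partial>M k3) =
        (\<integral>\<^sup>+w. \<integral>\<^sup>+b. \<integral>\<^sup>+a. F (X(k3 := w, k2 := b, k1 := a)) \<partial>M k1 \<partial>M k2 \<partial>M k3)"
        unfolding T' by (rule pres[OF g])
    qed
    also have "\<dots> = (\<integral>\<^sup>+X. F X \<partial>PiM UNIV M)" by (rule res[symmetric]) measurable
    finally show ?thesis .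
  qed
  show "distr (PiM UNIV M) (PiM UNIV M) T = PiM UNIV M"
  proof (rule measure_eqI)
    fix S assume "S \<in> sets (distr (PiM UNIV M) (PiM UNIV M) T)"
    then have [measurable]: "S \<in> sets (PiM UNIV M)" by simp
    have "emeasure (distr (PiM UNIV M) (PiM UNIV M) T) S = (\<integral>\<^sup>+X. indicator S X \<partial>distr (PiM UNIV M) (PiM UNIV M) T)"
      by simp
    also have "\<dots> = (\<integral>\<^sup>+X. indicator S (T X) \<partial>PiM UNIV M)"
      by (subst nn_integral_distr) auto
    also have "\<dots> = (\<integral>\<^sup>+X. indicator S X \<partial>PiM UNIV M)" by (rule main) measurable
    finally show "emeasure (distr (PiM UNIV M) (PiM UNIV M) T) S = emeasure (PiM UNIV M) S" by simp
  qed simp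
qed

text \<open>The exchange turns (a, b) into the independent pair c = a * b and r = (1 - b) / (1 - a *
  b). Here r has the same law as w, so the two may trade places; undoing the exchange with w instead
  of r produces the new increments, and r becomes the new weight.\<close>

lemma beta_law_local_move:
  fixes g :: "real \<Rightarrow> real \<Rightarrow> real \<Rightarrow> ennreal"
  assumes pos: "l > 0" "\<beta> > 0" "\<alpha> > 0"
    and g: "(\<lambda>(a, b, w). g a b w) \<in> borel_measurable (borel \<Otimes>\<^sub>M borel \<Otimes>\<^sub>M borel)"
  shows "(\<integral>\<^sup>+w. \<integral>\<^sup>+b. \<integral>\<^sup>+a. g (a * b / (1 - w * (1 - a * b))) (1 - w * (1 - a * b)) ((1 - b) / (1 - a * b))
      \<partial>beta_law l \<beta> \<partial>beta_law (l + \<beta>) \<alpha> \<partial>beta_law \<alpha> \<beta>) =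
    (\<integral>\<^sup>+w. \<integral>\<^sup>+b. \<integral>\<^sup>+a. g a b w \<partial>beta_law l \<beta> \<partial>beta_law (l + \<beta>) \<alpha> \<partial>beta_law \<alpha> \<beta>)"
proof -
  have gm [measurable]: "(\<lambda>x. g (u x) (v x) (w x)) \<in> borel_measurable L"
    if "u \<in> borel_measurable L" "v \<in> borel_measurable L" "w \<in> borel_measurable L"
    for u v w and L :: "'z measure"
    using measurable_compose[OF _ g, of "\<lambda>x. (u x, v x, w x)" L] that by auto
  define G where "G w c r = g (c / (1 - w * (1 - c))) (1 - w * (1 - c)) r" for w c r
  have Gm [measurable]: "(\<lambda>x. G (u x) (v x) (w x)) \<in> borel_measurable L"
    if "u \<in> borel_measurable L" "v \<in> borel_measurable L" "w \<in> borel_measurable L"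
    for u v w and L :: "'z measure"
    unfolding G_def using that by measurable
  let ?L = "beta_law l \<beta>" and ?K = "beta_law (l + \<beta>) \<alpha>" and ?W = "beta_law \<alpha> \<beta>" and ?C = "beta_law l (\<alpha> + \<beta>)"
  interpret W: prob_space ?W using pos by (intro prob_space_beta_law) auto
  interpret C: prob_space ?C using pos by (intro prob_space_beta_law) auto
  interpret WW: pair_sigma_finite ?W ?W ..
  interpret CW: pair_sigma_finite ?C ?W ..
  interpret L: prob_space ?L using pos by (intro prob_space_beta_law) auto
  have "(\<integral>\<^sup>+w. \<integral>\<^sup>+b. \<integral>\<^sup>+a. G w (a * b) ((1 - b) / (1 - a * b)) \<partial>?L \<partial>?K \<partial>?W) =
    (\<integral>\<^sup>+w. \<integral>\<^sup>+c. \<integral>\<^sup>+r. G w c r \<partial>?W \<partial>?C \<partial>?W)"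
    by (intro nn_integral_cong beta_law_exchange pos) measurable
  also have "\<dots> = (\<integral>\<^sup>+w. \<integral>\<^sup>+r. \<integral>\<^sup>+c. G w c r \<partial>?C \<partial>?W \<partial>?W)"
    by (intro nn_integral_cong CW.Fubini'[symmetric]) measurable
  also have "\<dots> = (\<integral>\<^sup>+r. \<integral>\<^sup>+w. \<integral>\<^sup>+c. G w c r \<partial>?C \<partial>?W \<partial>?W)"
    by (rule WW.Fubini'[symmetric]) measurable
  also have "\<dots> = (\<integral>\<^sup>+r. \<integral>\<^sup>+c. \<integral>\<^sup>+w. G w c r \<partial>?W \<partial>?C \<partial>?W)"
    by (intro nn_integral_cong CW.Fubini') measurable
  also have "\<dots> = (\<integral>\<^sup>+r. \<integral>\<^sup>+b. \<integral>\<^sup>+a. G ((1 - b) / (1 - a * b)) (a * b) r \<partial>?L \<partial>?K \<partial>?W)"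
    by (intro nn_integral_cong beta_law_exchange[OF pos, symmetric]) measurable
  \<comment> \<open>Undoing the exchange recovers a and b wherever b > 0 and a * b < 1, that is,
    almost surely.\<close>
  also have "\<dots> = (\<integral>\<^sup>+r. \<integral>\<^sup>+b. \<integral>\<^sup>+a. g a b r \<partial>?L \<partial>?K \<partial>?W)"
  proof (rule nn_integral_cong, rule nn_integral_cong_AE)
    fix r
    show "AE b in ?K. (\<integral>\<^sup>+a. G ((1 - b) / (1 - a * b)) (a * b) r \<partial>?L) = (\<integral>\<^sup>+a. g a b r \<partial>?L)"
      using AE_beta_law[of "l + \<beta>" \<alpha>]
    proof eventually_elim
      case (elim b)
      show ?case
      proof (rule nn_integral_cong_AE)
        show "AE a in ?L. G ((1 - b) / (1 - a * b)) (a * b) r = g a b r"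
          using AE_beta_law[of l \<beta>]
        proof eventually_elim
          case (elim a)
          have "a * b < 1" using elim \<open>0 < b \<and> b < 1\<close> by (metis mult_strict_mono' less_imp_le mult_1)
          then have "1 - (1 - b) / (1 - a * b) * (1 - a * b) = b" by simp
          then show ?case using \<open>0 < b \<and> b < 1\<close> by (simp add: G_def)
        qed
      qed
    qed
  qed
  finally show ?thesis by (simp add: G_def)
qed

section \<open>The stationary array\<close>

text \<open>Slot \<open>A i\<close> holds the increment on the current top edge of column \<open>i\<close>, \<open>B j\<close> the one on the current
  right edge of row \<open>j\<close>; \<open>W x\<close> holds the dual weight at \<open>x\<close> and, after the move at \<open>x\<close>, the environment there.\<close>

datatype slot = A nat | B nat | W site

instance slot :: countable by countable_datatype

text \<open>The vertical increments of one row of squares, read from left to right, from the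
  increments \<open>a\<close> on its bottom edges, \<open>b\<close> on its left edge and the dual
  weights \<open>w\<close>.\<close>

primrec vert :: "(nat \<Rightarrow> real) \<Rightarrow> real \<Rightarrow> (nat \<Rightarrow> real) \<Rightarrow> nat \<Rightarrow> real" where
  "vert a b w 0 = b"
| "vert a b w (Suc i) = 1 - w i * (1 - a i * vert a b w i)"

text \<open>The quotient states that increments close up around a unit square: bottom times left
  equals right times top. This is what makes the harmonic function well defined.\<close>

primrec hor :: "(slot \<Rightarrow> real) \<Rightarrow> nat \<Rightarrow> nat \<Rightarrow> real" where
  "hor X 0 = (\<lambda>i. X (A i))"
| "hor X (Suc j) = (\<lambda>i. hor X j i * vert (hor X j) (X (B j)) (\<lambda>i. X (W (int i, int j))) i /
     vert (hor X j) (X (B j)) (\<lambda>i. X (W (int i, int j))) (Suc i))"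

definition ver :: "(slot \<Rightarrow> real) \<Rightarrow> nat \<Rightarrow> nat \<Rightarrow> real" where
  "ver X j = vert (hor X j) (X (B j)) (\<lambda>i. X (W (int i, int j)))"

text \<open>In the quadrant this is the weight for which a function with increments
  \<open>hor\<close> and \<open>ver\<close> is harmonic at x. Elsewhere the slot itself supplies the
  weight, so that the environment lives on the whole lattice.\<close>

definition env :: "(slot \<Rightarrow> real) \<Rightarrow> site \<Rightarrow> real" where
  "env X x = (if fst x \<ge> 0 \<and> snd x \<ge> 0 then
     (1 - ver X (nat (snd x)) (nat (fst x))) /
       (1 - hor X (nat (snd x)) (nat (fst x)) * ver X (nat (snd x)) (nat (fst x))) else X (W x))"

lemma ver_0: "ver X j 0 = X (B j)" by (simp add: ver_def)

lemma ver_Suc: "ver X j (Suc i) = 1 - X (W (int i, int j)) * (1 - hor X j i * ver X j i)"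
  by (simp add: ver_def)

lemma hor_Suc: "hor X (Suc j) i = hor X j i * ver X j i / ver X j (Suc i)"
  by (simp add: ver_def)

declare hor.simps(2) [simp del]

text \<open>The array after the moves at all sites of the strip \<open>{0..<n} \<times> \<nat>\<close> that precede \<open>(i, j)\<close>
  in row-by-row order.\<close>

primrec state :: "nat \<Rightarrow> nat \<Rightarrow> nat \<Rightarrow> (slot \<Rightarrow> real) \<Rightarrow> slot \<Rightarrow> real" where
  "state n j i X (A k) = (if k < i then hor X (Suc j) k else if k < n then hor X j k else X (A k))"
| "state n j i X (B m) = (if m < j then ver X m n else if m = j then ver X j i else X (B m))"
| "state n j i X (W x) = (if 0 \<le> fst x \<and> 0 \<le> snd x \<and> nat (fst x) < n \<and>
     (nat (snd x) < j \<or> nat (snd x) = j \<and> nat (fst x) < i) then env X x else X (W x))"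

definition local_move :: "nat \<Rightarrow> nat \<Rightarrow> (slot \<Rightarrow> real) \<Rightarrow> slot \<Rightarrow> real" where
  "local_move j i X = (let a = X (A i); b = X (B j); w = X (W (int i, int j)) in
     X(A i := a * b / (1 - w * (1 - a * b)), B j := 1 - w * (1 - a * b),
       W (int i, int j) := (1 - b) / (1 - a * b)))"

lemma state_0: "state n 0 0 X = X"
proof
  fix s show "state n 0 0 X s = X s" by (cases s) (auto simp: ver_0)
qed

text \<open>After row j is complete its top edges serve as bottom edges of row j + 1, whose left
  edge is still the initial slot.\<close>

lemma state_next_row: "state n (Suc j) 0 X = state n j n X"
proof
  fix s show "state n (Suc j) 0 X s = state n j n X s"
    by (cases s) (auto simp: ver_0 less_Suc_eq)
qed

lemma state_Suc: "i < n \<Longrightarrow> state n j (Suc i) X = local_move j i (state n j i X)"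
proof
  fix s assume i: "i < n"
  show "state n j (Suc i) X s = local_move j i (state n j i X) s"
  proof (cases s)
    case (A k)
    then show ?thesis using i
      by (auto simp: local_move_def Let_def hor_Suc ver_Suc less_Suc_eq)
  next
    case (B m)
    then show ?thesis using i by (auto simp: local_move_def Let_def ver_Suc)
  next
    case (W x)
    show ?thesis
    proof (cases "x = (int i, int j)")
      case True
      then show ?thesis using i W by (auto simp: local_move_def Let_def env_def)
    next
      case False
      then have "nat (fst x) = i \<Longrightarrow> nat (snd x) = j \<Longrightarrow> 0 \<le> fst x \<Longrightarrow> 0 \<le> snd x \<Longrightarrow> False"
        by (auto simp: prod_eq_iff)
      then show ?thesis using i W False by (auto simp: local_move_def Let_def less_Suc_eq)
    qed
  qed
qed

lemma measurable_coord [measurable]: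
  "(\<lambda>X. X (s :: slot)) \<in> borel_measurable (PiM UNIV (\<lambda>_. borel :: real measure))"
  by simp

lemma hor_ver_measurable [measurable]:
  "(\<lambda>X. hor X j i) \<in> borel_measurable (PiM UNIV (\<lambda>_. borel))"
  "(\<lambda>X. ver X j i) \<in> borel_measurable (PiM UNIV (\<lambda>_. borel))"
proof -
  have 1: "(\<lambda>X. ver X j i) \<in> borel_measurable (PiM UNIV (\<lambda>_. borel))"
    if [measurable]: "\<And>i. (\<lambda>X. hor X j i) \<in> borel_measurable (PiM UNIV (\<lambda>_. borel))" for j i
    by (induction i) (simp_all add: ver_0 ver_Suc)
  have 2: "(\<lambda>X. hor X j i) \<in> borel_measurable (PiM UNIV (\<lambda>_. borel))" for j i
  proof (induction j arbitrary: i)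
    case (Suc j)
    note [measurable] = Suc 1[OF Suc]
    show ?case unfolding hor_Suc by measurable
  qed simp
  show "(\<lambda>X. hor X j i) \<in> borel_measurable (PiM UNIV (\<lambda>_. borel))" by (rule 2)
  show "(\<lambda>X. ver X j i) \<in> borel_measurable (PiM UNIV (\<lambda>_. borel))" by (rule 1) (rule 2)
qed

lemma env_measurable [measurable]:
  "(\<lambda>X. env X x) \<in> borel_measurable (PiM UNIV (\<lambda>_. borel))"
  "env \<in> measurable (PiM UNIV (\<lambda>_. borel)) (PiM UNIV (\<lambda>_. borel))"
proof -
  show 1: "(\<lambda>X. env X x) \<in> borel_measurable (PiM UNIV (\<lambda>_. borel))" for x
    unfolding env_def by (cases "fst x \<ge> 0 \<and> snd x \<ge> 0") simp_all
  show "env \<in> measurable (PiM UNIV (\<lambda>_. borel)) (PiM UNIV (\<lambda>_. borel))"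
    by (rule measurable_PiM_single') (auto simp: 1)
qed

definition unit_array :: "(slot \<Rightarrow> real) \<Rightarrow> bool" where
  "unit_array X \<longleftrightarrow> (\<forall>s. 0 < X s \<and> X s < 1)"

text \<open>The local move maps the open unit cube to itself: with c = a * b one has c < 1 - w * (1
  - c) < 1, and the first inequality is what keeps the new horizontal increment below 1.\<close>

lemma hor_ver_bounds:
  assumes "unit_array X"
  shows "0 < hor X j i" "hor X j i < 1" "0 < ver X j i" "ver X j i < 1"
proof -
  have X: "0 < X s" "X s < 1" for s using assms by (auto simp: unit_array_def)
  have step: "a * b < 1 - w * (1 - a * b)" "1 - w * (1 - a * b) < 1"
    if "0 < a" "a < 1" "0 < b" "b < 1" "0 < w" "w < 1" for a b w :: real
  proof -
    have "a * b < 1" using that by (metis mult_strict_mono' less_imp_le mult_1)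
    then have "w * (1 - a * b) < 1 - a * b" "0 < w * (1 - a * b)" using that by auto
    then show "a * b < 1 - w * (1 - a * b)" "1 - w * (1 - a * b) < 1" by auto
  qed
  have 1: "0 < ver X j i \<and> ver X j i < 1" if r: "\<And>i. 0 < hor X j i \<and> hor X j i < 1" for j i
  proof (induction i)
    case 0 then show ?case by (simp add: ver_0 X)
  next
    case (Suc i)
    moreover have "0 < hor X j i * ver X j i" using r[of i] Suc by simp
    ultimately show ?case using step[of "hor X j i" "ver X j i" "X (W (int i, int j))"] r[of i] X
      unfolding ver_Suc by (meson less_trans)
  qed
  have 2: "0 < hor X j i \<and> hor X j i < 1" for j i
  proof (induction j arbitrary: i)
    case 0 then show ?case by (simp add: X)
  next
    case (Suc j)
    have "hor X j i * ver X j i < ver X j (Suc i)"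
      using step[of "hor X j i" "ver X j i" "X (W (int i, int j))"] Suc[of i] 1[of j i] Suc X
      by (auto simp: ver_Suc)
    then show ?case using Suc[of i] 1[of j i] 1[of j "Suc i"] Suc
      by (auto simp: hor_Suc divide_less_eq)
  qed
  show "0 < hor X j i" "hor X j i < 1" using 2 by auto
  show "0 < ver X j i" "ver X j i < 1" using 1 2 by auto
qed

lemma hor_mult_ver_less:
  assumes "unit_array X"
  shows "hor X j i * ver X j i < ver X j i" "hor X j i * ver X j i < 1"
proof -
  note b = hor_ver_bounds[OF assms, of j i]
  show "hor X j i * ver X j i < ver X j i" using b by simp
  then show "hor X j i * ver X j i < 1" using b by linarith
qed

lemma elliptic_env:
  assumes "unit_array X"
  shows "elliptic (env X)"
  unfolding elliptic_def
proof
  fix x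
  show "0 < env X x \<and> env X x < 1"
    using hor_mult_ver_less[OF assms, of "nat (snd x)" "nat (fst x)"]
      hor_ver_bounds[OF assms, of "nat (snd x)" "nat (fst x)"] assms
    by (auto simp: env_def unit_array_def)
qed

text \<open>The harmonic function with increments \<open>h (x + e1) / h x = a\<close> and \<open>h x / h (x + e2) = b\<close>.\<close>

definition hfun :: "(slot \<Rightarrow> real) \<Rightarrow> site \<Rightarrow> real" where
  "hfun X x = (\<Prod>k<nat (fst x). hor X (nat (snd x)) k) / (\<Prod>l<nat (snd x). ver X l 0)"

lemma hfun_pos: "unit_array X \<Longrightarrow> 0 < hfun X x"
  unfolding hfun_def by (intro divide_pos_pos prod_pos) (auto intro: hor_ver_bounds)

lemma hfun_right: "hfun X (int (Suc i), int j) = hfun X (int i, int j) * hor X j i"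
  by (simp add: hfun_def del: of_nat_Suc)

text \<open>\<open>hfun\<close> is defined along the path that goes up first and then right. The
  closing relation in each square carries the vertical increment from column 0 to column i.\<close>

lemma hfun_up:
  assumes "unit_array X"
  shows "hfun X (int i, int j) = hfun X (int i, int (Suc j)) * ver X j i"
proof (induction i)
  case 0
  then show ?case using hor_ver_bounds(3)[OF assms] by (simp add: hfun_def less_imp_neq[symmetric] del: of_nat_Suc)
next
  case (Suc i)
  show ?case
    unfolding hfun_right Suc.IH using hor_ver_bounds(3)[OF assms, of j "Suc i"]
    by (simp add: hor_Suc)
qed

lemma hfun_harmonic:
  assumes X: "unit_array X" and "fst x \<ge> 0" "snd x \<ge> 0"
  shows "hfun X x = env X x * hfun X (x + e1) + (1 - env X x) * hfun X (x + e2)"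
proof -
  obtain i j where x: "x = (int i, int j)"
    using assms(2,3) by (metis nat_eq_iff2 prod.collapse)
  define a b where "a = hor X j i" and "b = ver X j i"
  have ab: "0 < b" "a * b < 1" using hor_mult_ver_less[OF X, of j i] hor_ver_bounds[OF X, of j i]
    by (auto simp: a_def b_def)
  have e: "env X x = (1 - b) / (1 - a * b)" by (simp add: env_def x a_def b_def)
  have h1: "hfun X (x + e1) = hfun X x * a"
    using hfun_right[of X i j] by (simp add: x e1_def a_def add.commute)
  have h2: "hfun X (x + e2) = hfun X x / b"
    using hfun_up[OF X, of i j] ab by (simp add: x e2_def b_def add.commute)
  \<comment> \<open>After clearing denominators this is (1 - b) * a + (1 - a) = 1 - a * b.\<close>
  have "(1 - b) / (1 - a * b) * a + (1 - (1 - b) / (1 - a * b)) / b = 1"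
    using ab by (simp add: divide_simps) (simp add: algebra_simps)
  then have "hfun X x = hfun X x * (env X x * a + (1 - env X x) / b)"
    unfolding e by simp
  then show ?thesis unfolding h1 h2 by (simp add: algebra_simps)
qed

lemma hfun_sum:
  assumes X: "unit_array X" and x: "fst x \<ge> 0" "snd x \<ge> 0"
  shows "(\<Sum>k = 0..int n. lev (env X) x n k * hfun X (x + (k, int n - k))) = hfun X x"
proof (induction n)
  case (Suc n)
  show ?case
    unfolding Suc.IH[symmetric]
  proof (rule lev_sum)
    fix k
    show "hfun X (x + (k, int n - k)) =
         env X (x + (k, int n - k)) * hfun X (x + (k + 1, int n - k)) +
         (1 - env X (x + (k, int n - k))) * hfun X (x + (k, int n - k + 1)) \<or>
         lev (env X) x n k = 0"
    proof (cases "0 \<le> k \<and> k \<le> int n")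
      case True
      have e: "x + (k, int n - k) + e1 = x + (k + 1, int n - k)"
        "x + (k, int n - k) + e2 = x + (k, int n - k + 1)"
        by (simp_all add: e1_def e2_def prod_eq_iff)
      show ?thesis
        using hfun_harmonic[OF X, of "x + (k, int n - k)", unfolded e] True x by auto
    qed (auto intro: lev_eq_0)
  qed
qed (simp add: zero_prod_def[symmetric])

text \<open>A single term of the sum over level n, whose total is \<open>hfun X 0\<close> = 1. Every
  parameter thus bounds transition probabilities by the inverse of its harmonic function.\<close>

lemma lev_hfun_le:
  assumes X: "unit_array X" and k: "0 \<le> k" "k \<le> int n"
  shows "lev (env X) 0 n k * hfun X (k, int n - k) \<le> 1"
proof -
  have "lev (env X) 0 n k * hfun X (0 + (k, int n - k)) \<le>
      (\<Sum>k = 0..int n. lev (env X) 0 n k * hfun X (0 + (k, int n - k)))"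
    using k by (intro member_le_sum) (auto intro!: mult_nonneg_nonneg lev_nonneg elliptic_env X less_imp_le[OF hfun_pos])
  also have "\<dots> = 1" by (subst hfun_sum[OF X]) (auto simp: hfun_def)
  finally show ?thesis by simp
qed

section \<open>Product laws carried by the array\<close>

context beta_parameters
begin

definition env_law :: "(site \<Rightarrow> real) measure" where
  "env_law = PiM UNIV (\<lambda>_. beta_law \<alpha> \<beta>)"

primrec slot_law :: "real \<Rightarrow> slot \<Rightarrow> real measure" where
  "slot_law l (A i) = beta_law l \<beta>"
| "slot_law l (B j) = beta_law (l + \<beta>) \<alpha>"
| "slot_law l (W x) = beta_law \<alpha> \<beta>"

definition array_law :: "real \<Rightarrow> (slot \<Rightarrow> real) measure" where
  "array_law l = PiM UNIV (slot_law l)"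

lemma sets_slot_law: "sets (slot_law l s) = sets borel"
  by (cases s) auto

lemma prob_space_slot_law: "l > 0 \<Longrightarrow> prob_space (slot_law l s)"
  using ab by (cases s) (auto intro!: prob_space_beta_law)

lemma sets_env_law [measurable_cong]: "sets env_law = sets (PiM UNIV (\<lambda>_. borel))"
  unfolding env_law_def by (intro sets_PiM_cong) auto

lemma sets_array_law [measurable_cong]: "sets (array_law l) = sets (PiM UNIV (\<lambda>_. borel))"
  unfolding array_law_def by (intro sets_PiM_cong) (auto simp: sets_slot_law)

lemma prob_space_env_law: "prob_space env_law"
  unfolding env_law_def using ab by (intro prob_space_PiM prob_space_beta_law) auto

lemma prob_space_array_law: "l > 0 \<Longrightarrow> prob_space (array_law l)"
  unfolding array_law_def by (intro prob_space_PiM prob_space_slot_law) auto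

lemma AE_elliptic: "AE \<omega> in env_law. elliptic \<omega>"
  unfolding elliptic_def env_law_def using ab
  by (subst AE_all_countable, intro allI AE_PiM_component AE_beta_law prob_space_beta_law) auto

lemma AE_unit_array: "l > 0 \<Longrightarrow> AE X in array_law l. unit_array X"
proof -
  assume l: "l > 0"
  have "AE t in slot_law l s. 0 < t \<and> t < 1" for s
    by (cases s) (simp_all only: slot_law.simps AE_beta_law)
  then show ?thesis
    unfolding unit_array_def array_law_def using l
    by (subst AE_all_countable, intro allI AE_PiM_component prob_space_slot_law) auto
qed

lemma nn_integral_array_mono:
  assumes "l > 0" "\<And>X. unit_array X \<Longrightarrow> f X \<le> g X"
  shows "(\<integral>\<^sup>+X. f X \<partial>array_law l) \<le> (\<integral>\<^sup>+X. g X \<partial>array_law l)"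
  using AE_unit_array[OF assms(1)] assms(2) by (intro nn_integral_mono_AE) (auto elim: eventually_mono)

lemma nn_integral_array_cong:
  assumes "l > 0" "\<And>X. unit_array X \<Longrightarrow> f X = g X"
  shows "(\<integral>\<^sup>+X. f X \<partial>array_law l) = (\<integral>\<^sup>+X. g X \<partial>array_law l)"
  using assms by (intro antisym nn_integral_array_mono) auto

lemma local_move_preserves:
  assumes l: "l > 0"
  shows "local_move j i \<in> measurable (array_law l) (array_law l)"
    and "distr (array_law l) (array_law l) (local_move j i) = array_law l"
proof -
  have eq: "local_move j i = (\<lambda>X. X(A i := X (A i) * X (B j) / (1 - X (W (int i, int j)) * (1 - X (A i) * X (B j))),
    B j := 1 - X (W (int i, int j)) * (1 - X (A i) * X (B j)),
    W (int i, int j) := (1 - X (B j)) / (1 - X (A i) * X (B j))))"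
    by (simp add: fun_eq_iff local_move_def Let_def)
  note T = distr_PiM_local_move[of "slot_law l" "A i" "B j" "W (int i, int j)"
    "\<lambda>a b w. a * b / (1 - w * (1 - a * b))" "\<lambda>a b w. 1 - w * (1 - a * b)" "\<lambda>a b w. (1 - b) / (1 - a * b)",
    OF prob_space_slot_law[OF l] sets_slot_law]
  have P: "(\<integral>\<^sup>+w. \<integral>\<^sup>+b. \<integral>\<^sup>+a. g (a * b / (1 - w * (1 - a * b))) (1 - w * (1 - a * b)) ((1 - b) / (1 - a * b))
      \<partial>slot_law l (A i) \<partial>slot_law l (B j) \<partial>slot_law l (W (int i, int j))) =
    (\<integral>\<^sup>+w. \<integral>\<^sup>+b. \<integral>\<^sup>+a. g a b w \<partial>slot_law l (A i) \<partial>slot_law l (B j) \<partial>slot_law l (W (int i, int j)))"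
    if "(\<lambda>(a, b, w). g a b w) \<in> borel_measurable (borel \<Otimes>\<^sub>M borel \<Otimes>\<^sub>M borel)" for g
    using beta_law_local_move[of l \<beta> \<alpha> g] that l ab by simp
  show "local_move j i \<in> measurable (array_law l) (array_law l)"
    unfolding eq array_law_def by (rule T(1)) (auto simp: P simp del: slot_law.simps)
  show "distr (array_law l) (array_law l) (local_move j i) = array_law l"
    unfolding eq array_law_def by (rule T(2)) (auto simp: P simp del: slot_law.simps)
qed

text \<open>In a strip of finite width n each row takes finitely many moves, so every state is
  reached from the initial array by finitely many maps that preserve the law.\<close>

lemma state_preserves:
  assumes l: "l > 0"
  shows "i \<le> n \<Longrightarrow> state n j i \<in> measurable (array_law l) (array_law l) \<and>
    distr (array_law l) (array_law l) (state n j i) = array_law l"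
proof (induction j arbitrary: i)
  have row: "state n j i \<in> measurable (array_law l) (array_law l) \<and>
      distr (array_law l) (array_law l) (state n j i) = array_law l"
    if "state n j 0 \<in> measurable (array_law l) (array_law l) \<and>
      distr (array_law l) (array_law l) (state n j 0) = array_law l" "i \<le> n" for i j
    using that(2)
  proof (induction i)
    case 0 then show ?case using that by simp
  next
    case (Suc i)
    have eq: "state n j (Suc i) = local_move j i \<circ> state n j i"
      using Suc.prems by (simp add: fun_eq_iff state_Suc)
    have "distr (array_law l) (array_law l) (local_move j i \<circ> state n j i) =
      distr (distr (array_law l) (array_law l) (state n j i)) (array_law l) (local_move j i)"
      using Suc local_move_preserves(1)[OF l] by (intro distr_distr[symmetric]) auto
    moreover have "local_move j i \<circ> state n j i \<in> measurable (array_law l) (array_law l)"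
      using Suc local_move_preserves(1)[OF l] by (intro measurable_comp) auto
    ultimately show ?case
      using Suc local_move_preserves(2)[OF l] Suc_leD[OF Suc.prems] unfolding eq by presburger
  qed
  {
    case 0
    have "state n 0 0 = (\<lambda>X. X)" by (simp add: fun_eq_iff state_0)
    then have "state n 0 0 \<in> measurable (array_law l) (array_law l) \<and>
      distr (array_law l) (array_law l) (state n 0 0) = array_law l"
      by (simp add: distr_id2)
    then show ?case using 0 by (rule row)
  next
    case (Suc j)
    have "state n (Suc j) 0 = state n j n" by (simp add: fun_eq_iff state_next_row)
    then have "state n (Suc j) 0 \<in> measurable (array_law l) (array_law l) \<and>
      distr (array_law l) (array_law l) (state n (Suc j) 0) = array_law l"
      using Suc.IH[of n] by simp
    then show ?case using Suc.prems by (rule row)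
  }
qed

lemma nn_integral_state:
  assumes l: "l > 0" and [measurable]: "f \<in> borel_measurable (array_law l)"
  shows "(\<integral>\<^sup>+X. f (state n j 0 X) \<partial>array_law l) = (\<integral>\<^sup>+X. f X \<partial>array_law l)"
  using state_preserves[OF l, of 0 n j] nn_integral_distr[of "state n j 0" "array_law l" "array_law l" f] by simp

text \<open>In a strip of width k, once the rows below j are done, the slots \<open>A i\<close> hold
  the increments of row j, and the array has its original product law.\<close>

lemma nn_integral_hor_prod:
  assumes l: "l > 0" and [measurable]: "f \<in> borel_measurable borel"
  shows "(\<integral>\<^sup>+X. (\<Prod>i<k. f (hor X j i)) \<partial>array_law l) = (\<integral>\<^sup>+x. f x \<partial>beta_law l \<beta>) ^ k"
proof -
  have fm: "f \<in> borel_measurable (beta_law p q)" for p q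
    using assms(2) by (simp only: measurable_cong_sets[OF sets_beta_law refl])
  have "(\<integral>\<^sup>+X. (\<Prod>i<k. f (hor X j i)) \<partial>array_law l) = (\<integral>\<^sup>+X. (\<Prod>i<k. f (state k j 0 X (A i))) \<partial>array_law l)"
    by (intro nn_integral_cong prod.cong) auto
  also have "\<dots> = (\<integral>\<^sup>+X. (\<Prod>i<k. f (X (A i))) \<partial>array_law l)"
    by (rule nn_integral_state[OF l]) measurable
  also have "\<dots> = (\<integral>\<^sup>+X. (\<Prod>s\<in>A ` {..<k}. f (X s)) \<partial>array_law l)"
    by (subst prod.reindex) (auto simp: inj_on_def)
  also have "\<dots> = (\<Prod>s\<in>A ` {..<k}. \<integral>\<^sup>+x. f x \<partial>slot_law l s)"
    unfolding array_law_def by (rule nn_integral_PiM_prod) (auto simp: prob_space_slot_law l fm)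
  also have "\<dots> = (\<integral>\<^sup>+x. f x \<partial>beta_law l \<beta>) ^ k"
    by (subst prod.reindex) (auto simp: inj_on_def)
  finally show ?thesis .
qed

lemma nn_integral_ver_prod:
  assumes l: "l > 0" and [measurable]: "f \<in> borel_measurable borel"
  shows "(\<integral>\<^sup>+X. (\<Prod>i<k. f (ver X i 0)) \<partial>array_law l) = (\<integral>\<^sup>+x. f x \<partial>beta_law (l + \<beta>) \<alpha>) ^ k"
proof -
  have fm: "f \<in> borel_measurable (beta_law p q)" for p q
    using assms(2) by (simp only: measurable_cong_sets[OF sets_beta_law refl])
  have "(\<integral>\<^sup>+X. (\<Prod>i<k. f (ver X i 0)) \<partial>array_law l) = (\<integral>\<^sup>+X. (\<Prod>s\<in>B ` {..<k}. f (X s)) \<partial>array_law l)"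
    by (subst prod.reindex) (auto simp: inj_on_def ver_0)
  also have "\<dots> = (\<Prod>s\<in>B ` {..<k}. \<integral>\<^sup>+x. f x \<partial>slot_law l s)"
    unfolding array_law_def by (rule nn_integral_PiM_prod) (auto simp: prob_space_slot_law l fm)
  also have "\<dots> = (\<integral>\<^sup>+x. f x \<partial>beta_law (l + \<beta>) \<alpha>) ^ k"
    by (subst prod.reindex) (auto simp: inj_on_def)
  finally show ?thesis .
qed

text \<open>It suffices to test finite boxes. The sites of the quadrant among finitely many lie in
  an n by n square, and in \<open>state n n 0\<close> all moves of that square have been
  made.\<close>

lemma distr_env:
  assumes l: "l > 0"
  shows "distr (array_law l) env_law env = env_law"
proof -
  have "distr (array_law l) (PiM UNIV (\<lambda>_. beta_law \<alpha> \<beta>)) env = PiM UNIV (\<lambda>_. beta_law \<alpha> \<beta>)"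
  proof (rule measure_eqI_PiM_infinite[symmetric, OF refl])
    interpret prob_space "PiM UNIV (\<lambda>_ :: site. beta_law \<alpha> \<beta>)"
      using prob_space_env_law by (simp add: env_law_def)
    show "finite_measure (PiM UNIV (\<lambda>_ :: site. beta_law \<alpha> \<beta>))" by unfold_locales
    have [measurable]: "env \<in> measurable (array_law l) (PiM UNIV (\<lambda>_. beta_law \<alpha> \<beta>))"
      using env_measurable(2) unfolding env_law_def[symmetric] by measurable
    fix S and J :: "site set" assume J: "finite J" and S: "\<And>j. j \<in> J \<Longrightarrow> S j \<in> sets (beta_law \<alpha> \<beta>)"
    obtain n where n: "\<And>x. x \<in> J \<Longrightarrow> nat (fst x) < n \<and> nat (snd x) < n"
    proof -
      have "finite ((\<lambda>x. nat (fst x)) ` J \<union> (\<lambda>x. nat (snd x)) ` J)" using J by simp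
      then obtain n where "\<forall>m \<in> (\<lambda>x. nat (fst x)) ` J \<union> (\<lambda>x. nat (snd x)) ` J. m < n"
        by (meson finite_nat_set_iff_bounded)
      then show ?thesis by (intro that[of n]) auto
    qed
    have st: "state n n 0 X (W x) = env X x" if "x \<in> J" for X x
      using n[OF that] by (auto simp: env_def)
    let ?E = "prod_emb UNIV (\<lambda>_. beta_law \<alpha> \<beta>) J (Pi\<^sub>E J S)"
    have E: "?E \<in> sets (PiM UNIV (\<lambda>_. beta_law \<alpha> \<beta>))" using J S by (intro sets_PiM_I) auto
    have ind: "indicator ?E \<omega> = (\<Prod>x\<in>J. indicator (S x) (\<omega> x) :: ennreal)" for \<omega>
    proof -
      have "\<omega> \<in> ?E \<longleftrightarrow> (\<forall>x\<in>J. \<omega> x \<in> S x)" by (auto simp: prod_emb_def PiE_iff)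
      then show ?thesis using J by (auto simp: indicator_def prod_zero_iff)
    qed
    have [measurable]: "(\<lambda>X. \<Prod>x\<in>J. indicator (S x) (X (W x)) :: ennreal) \<in> borel_measurable (array_law l)"
      using S by (intro borel_measurable_prod_ennreal) auto
    have "emeasure (distr (array_law l) (PiM UNIV (\<lambda>_. beta_law \<alpha> \<beta>)) env) ?E =
      (\<integral>\<^sup>+\<omega>. indicator ?E \<omega> \<partial>distr (array_law l) (PiM UNIV (\<lambda>_. beta_law \<alpha> \<beta>)) env)"
      using E by simp
    also have "\<dots> = (\<integral>\<^sup>+X. indicator ?E (env X) \<partial>array_law l)"
      using E by (subst nn_integral_distr) auto
    also have "\<dots> = (\<integral>\<^sup>+X. (\<Prod>x\<in>J. indicator (S x) (state n n 0 X (W x))) \<partial>array_law l)"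
      unfolding ind by (intro nn_integral_cong prod.cong) (auto simp: st simp del: state.simps)
    also have "\<dots> = (\<integral>\<^sup>+X. (\<Prod>x\<in>J. indicator (S x) (X (W x))) \<partial>array_law l)"
      by (rule nn_integral_state[OF l]) measurable
    also have "\<dots> = (\<integral>\<^sup>+X. (\<Prod>s\<in>W ` J. indicator (S (the_inv W s)) (X s)) \<partial>array_law l)"
      by (subst prod.reindex) (auto simp: inj_on_def the_inv_f_f)
    also have "\<dots> = (\<Prod>s\<in>W ` J. \<integral>\<^sup>+x. indicator (S (the_inv W s)) x \<partial>slot_law l s)"
    proof -
      have "indicator (S x) \<in> borel_measurable (beta_law \<alpha> \<beta>)" if "x \<in> J" for x
        using S[OF that] by (intro borel_measurable_indicator)
      then show ?thesis
        unfolding array_law_def using J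
        by (intro nn_integral_PiM_prod) (auto simp: prob_space_slot_law l the_inv_f_f inj_on_def)
    qed
    also have "\<dots> = (\<Prod>x\<in>J. emeasure (beta_law \<alpha> \<beta>) (S x))"
      using S by (subst prod.reindex) (auto simp: inj_on_def the_inv_f_f intro!: prod.cong)
    also have "\<dots> = emeasure (PiM UNIV (\<lambda>_. beta_law \<alpha> \<beta>)) ?E"
      using J S ab by (intro emeasure_PiM_emb[symmetric] prob_space_beta_law) auto
    finally show "emeasure (PiM UNIV (\<lambda>_. beta_law \<alpha> \<beta>)) ?E =
      emeasure (distr (array_law l) (PiM UNIV (\<lambda>_. beta_law \<alpha> \<beta>)) env) ?E" ..
  qed simp
  then show ?thesis unfolding env_law_def .
qed

end

section \<open>Concentration of the transformed walk\<close>

text \<open>The ratio of the probabilities to reach \<open>(k, n + 1 - k)\<close> from \<open>e1\<close> and from \<open>e2\<close>.\<close>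

definition ratio :: "(site \<Rightarrow> real) \<Rightarrow> nat \<Rightarrow> int \<Rightarrow> real" where
  "ratio \<omega> n k = lev \<omega> e1 n (k - 1) / lev \<omega> e2 n k"

lemma ratio_mono:
  assumes "elliptic \<omega>" "0 \<le> k" "k \<le> k'" "k' \<le> int n"
  shows "ratio \<omega> n k \<le> ratio \<omega> n k'"
  using lev_cross[OF assms(1,3), of 0 n] lev_pos[OF assms(1), of k n e2] lev_pos[OF assms(1), of k' n e2] assms
  by (simp add: ratio_def divide_le_eq le_divide_eq mult.commute frac_le_eq divide_simps)

lemma ratio_measurable [measurable]:
  "(\<lambda>\<omega>. ratio \<omega> n k) \<in> borel_measurable (PiM UNIV (\<lambda>_. borel))"
  unfolding ratio_def by measurable

lemma hfun_sum_e1: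
  assumes X: "unit_array X"
  shows "(\<Sum>k = 0..int (Suc n). lev (env X) e1 n (k - 1) * hfun X (k, int (Suc n) - k)) = hfun X e1"
proof -
  have "(\<Sum>k = 0..int (Suc n). lev (env X) e1 n (k - 1) * hfun X (k, int (Suc n) - k)) =
      (\<Sum>k = 1..int (Suc n). lev (env X) e1 n (k - 1) * hfun X (k, int (Suc n) - k))"
    by (intro sum.mono_neutral_right) (auto intro!: lev_eq_0)
  also have "\<dots> = (\<Sum>k = 0..int n. lev (env X) e1 n k * hfun X (e1 + (k, int n - k)))"
    by (intro sum.reindex_bij_witness[of _ "\<lambda>k. k + 1" "\<lambda>k. k - 1"]) (auto simp: e1_def algebra_simps)
  also have "\<dots> = hfun X e1"
    by (rule hfun_sum[OF X]) (auto simp: e1_def)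
  finally show ?thesis .
qed

lemma hfun_sum_e2:
  assumes X: "unit_array X"
  shows "(\<Sum>k = 0..int (Suc n). lev (env X) e2 n k * hfun X (k, int (Suc n) - k)) = hfun X e2"
proof -
  have "(\<Sum>k = 0..int (Suc n). lev (env X) e2 n k * hfun X (k, int (Suc n) - k)) =
      (\<Sum>k = 0..int n. lev (env X) e2 n k * hfun X (k, int (Suc n) - k))"
    by (intro sum.mono_neutral_right) (auto intro!: lev_eq_0)
  also have "\<dots> = (\<Sum>k = 0..int n. lev (env X) e2 n k * hfun X (e2 + (k, int n - k)))"
    by (intro sum.cong refl) (auto simp: e2_def algebra_simps)
  also have "\<dots> = hfun X e2"
    by (rule hfun_sum[OF X]) (auto simp: e2_def)
  finally show ?thesis .
qed

lemma hfun_e1: "hfun X e1 = X (A 0)" and hfun_e2: "hfun X e2 = 1 / X (B 0)"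
  by (simp_all add: hfun_def e1_def e2_def ver_0)

text \<open>The walk from the origin may start with a step to e1, so the mass from e1 is controlled
  by the mass from the origin at the price 1 / \<omega> 0.\<close>

lemma lev_e1_le:
  assumes "elliptic \<omega>"
  shows "lev \<omega> e1 n (k - 1) \<le> lev \<omega> 0 (Suc n) k / \<omega> 0"
proof -
  have "\<omega> 0 * lev \<omega> e1 n (k - 1) \<le> lev \<omega> 0 (Suc n) k"
    using ellipticD[OF assms, of 0] lev_nonneg[OF assms, of e2 n k]
    unfolding lev_first_step[of \<omega> 0] by simp
  then show ?thesis using ellipticD[OF assms, of 0] by (simp add: le_divide_eq mult.commute)
qed

lemma lev_e2_le:
  assumes "elliptic \<omega>"
  shows "lev \<omega> e2 n k \<le> lev \<omega> 0 (Suc n) k / (1 - \<omega> 0)"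
proof -
  have "(1 - \<omega> 0) * lev \<omega> e2 n k \<le> lev \<omega> 0 (Suc n) k"
    using ellipticD[OF assms, of 0] lev_nonneg[OF assms, of e1 n "k - 1"]
    unfolding lev_first_step[of \<omega> 0] by simp
  then show ?thesis using ellipticD[OF assms, of 0] by (simp add: le_divide_eq mult.commute)
qed

text \<open>The probability that the Doob transform by \<open>hfun X\<close>, started at the origin,
  is at some (k, n - k) with k in K at time n; \<open>hfun X 0\<close> = 1 is the
  normalisation.\<close>

definition mass :: "(slot \<Rightarrow> real) \<Rightarrow> nat \<Rightarrow> int set \<Rightarrow> real" where
  "mass X n K = (\<Sum>k\<in>K. lev (env X) 0 n k * hfun X (k, int n - k))"

text \<open>By total positivity the ratio at \<open>K\<close> dominates the ratios to its left, hence also the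
  ratio of the parts of \<open>hfun X e1\<close> and \<open>hfun X e2\<close> that come from the left of \<open>K\<close>.\<close>

lemma ratio_ge:
  assumes X: "unit_array X" and K: "0 \<le> K" "K \<le> int n"
  shows "(X (A 0) - mass X (Suc n) {K<..int (Suc n)} / env X 0) * X (B 0) \<le> ratio (env X) n K"
proof -
  note el = elliptic_env[OF X] and hp = less_imp_le[OF hfun_pos[OF X]]
  define f where "f k = lev (env X) e1 n (k - 1)" for k
  define g where "g k = lev (env X) e2 n k" for k
  define h where "h k = hfun X (k, int (Suc n) - k)" for k
  have fg: "0 \<le> f k" "0 \<le> g k" "0 \<le> h k" for k
    by (auto simp: f_def g_def h_def lev_nonneg el hp)
  have gK: "g K > 0" unfolding g_def using K by (intro lev_pos el)
  have split: "{0..int (Suc n)} = {0..K} \<union> {K<..int (Suc n)}" using K by auto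
  have F: "(\<Sum>k = 0..K. f k * h k) + (\<Sum>k\<in>{K<..int (Suc n)}. f k * h k) = X (A 0)"
    using hfun_sum_e1[OF X, of n] unfolding split hfun_e1 f_def h_def
    by (subst (asm) sum.union_disjoint) auto
  have "(\<Sum>k = 0..K. g k * h k) \<le> (\<Sum>k = 0..int (Suc n). g k * h k)"
    using K fg by (intro sum_mono2) auto
  then have G: "(\<Sum>k = 0..K. g k * h k) \<le> 1 / X (B 0)"
    using hfun_sum_e2[OF X, of n] unfolding hfun_e2 g_def h_def by simp
  have "(\<Sum>k\<in>{K<..int (Suc n)}. f k * h k) \<le> (\<Sum>k\<in>{K<..int (Suc n)}. lev (env X) 0 (Suc n) k / env X 0 * h k)"
    unfolding f_def using fg by (intro sum_mono mult_right_mono lev_e1_le el) auto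
  also have "\<dots> = mass X (Suc n) {K<..int (Suc n)} / env X 0"
    by (simp add: mass_def h_def sum_divide_distrib)
  finally have T: "X (A 0) - mass X (Suc n) {K<..int (Suc n)} / env X 0 \<le> (\<Sum>k = 0..K. f k * h k)"
    using F by simp
  have "g K * (\<Sum>k = 0..K. f k * h k) \<le> f K * (\<Sum>k = 0..K. g k * h k)"
    unfolding sum_distrib_left
  proof (rule sum_mono)
    fix k assume "k \<in> {0..K}"
    then have "f k * g K \<le> f K * g k" using lev_cross[OF el, of k K 0 n] by (simp add: f_def g_def)
    then have "f k * g K * h k \<le> f K * g k * h k" using fg by (intro mult_right_mono) auto
    then show "g K * (f k * h k) \<le> f K * (g k * h k)" by (simp add: mult_ac)
  qed
  also have "\<dots> \<le> f K * (1 / X (B 0))" using G fg by (intro mult_left_mono) auto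
  finally have "g K * (\<Sum>k = 0..K. f k * h k) \<le> f K * (1 / X (B 0))" .
  then have "(\<Sum>k = 0..K. f k * h k) \<le> f K / g K / X (B 0)"
  proof -
    have "(\<Sum>k = 0..K. f k * h k) \<le> f K * (1 / X (B 0)) / g K"
      using \<open>g K * (\<Sum>k = 0..K. f k * h k) \<le> f K * (1 / X (B 0))\<close>
      by (subst pos_le_divide_eq[OF gK]) (simp add: mult.commute)
    then show ?thesis by (simp add: mult.commute)
  qed
  then have "X (A 0) - mass X (Suc n) {K<..int (Suc n)} / env X 0 \<le> f K / g K / X (B 0)"
    using T by linarith
  moreover have "X (B 0) > 0" using X by (auto simp: unit_array_def)
  ultimately show ?thesis
    unfolding ratio_def f_def[symmetric] g_def[symmetric] by (simp only: pos_le_divide_eq)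
qed

text \<open>Mirror image of \<open>ratio_ge\<close>: the ratio at K is compared with the ratios to
  its right. The error now reduces the share of \<open>hfun X e2\<close>, which is a denominator,
  hence the positivity assumption.\<close>

lemma ratio_le:
  assumes X: "unit_array X" and K: "0 \<le> K" "K \<le> int n"
    and pos: "1 / X (B 0) - mass X (Suc n) {0..<K} / (1 - env X 0) > 0"
  shows "ratio (env X) n K \<le> X (A 0) / (1 / X (B 0) - mass X (Suc n) {0..<K} / (1 - env X 0))"
proof -
  note el = elliptic_env[OF X] and hp = less_imp_le[OF hfun_pos[OF X]]
  define f where "f k = lev (env X) e1 n (k - 1)" for k
  define g where "g k = lev (env X) e2 n k" for k
  define h where "h k = hfun X (k, int (Suc n) - k)" for k
  have fg: "0 \<le> f k" "0 \<le> g k" "0 \<le> h k" for k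
    by (auto simp: f_def g_def h_def lev_nonneg el hp)
  have gK: "g K > 0" unfolding g_def using K by (intro lev_pos el)
  have split: "{0..int (Suc n)} = {0..<K} \<union> {K..int (Suc n)}" using K by auto
  have G: "(\<Sum>k = 0..<K. g k * h k) + (\<Sum>k\<in>{K..int (Suc n)}. g k * h k) = 1 / X (B 0)"
    using hfun_sum_e2[OF X, of n] unfolding split hfun_e2 g_def h_def
    by (subst (asm) sum.union_disjoint) auto
  have "(\<Sum>k = K..int (Suc n). f k * h k) \<le> (\<Sum>k = 0..int (Suc n). f k * h k)"
    using K fg by (intro sum_mono2) auto
  then have F: "(\<Sum>k = K..int (Suc n). f k * h k) \<le> X (A 0)"
    using hfun_sum_e1[OF X, of n] unfolding hfun_e1 f_def h_def by simp
  have "(\<Sum>k = 0..<K. g k * h k) \<le> (\<Sum>k = 0..<K. lev (env X) 0 (Suc n) k / (1 - env X 0) * h k)"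
    unfolding g_def using fg by (intro sum_mono mult_right_mono lev_e2_le el) auto
  also have "\<dots> = mass X (Suc n) {0..<K} / (1 - env X 0)"
    by (simp add: mass_def h_def sum_divide_distrib)
  finally have T: "1 / X (B 0) - mass X (Suc n) {0..<K} / (1 - env X 0) \<le> (\<Sum>k = K..int (Suc n). g k * h k)"
    using G by simp
  have "f K * (1 / X (B 0) - mass X (Suc n) {0..<K} / (1 - env X 0)) \<le> f K * (\<Sum>k = K..int (Suc n). g k * h k)"
    using T fg by (intro mult_left_mono)
  also have "\<dots> \<le> g K * (\<Sum>k = K..int (Suc n). f k * h k)"
    unfolding sum_distrib_left
  proof (rule sum_mono)
    fix k assume "k \<in> {K..int (Suc n)}"
    then have "f K * g k \<le> f k * g K" using lev_cross[OF el, of K k 0 n] by (simp add: f_def g_def)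
    then have "f K * g k * h k \<le> f k * g K * h k" using fg by (intro mult_right_mono) auto
    then show "f K * (g k * h k) \<le> g K * (f k * h k)" by (simp add: mult_ac)
  qed
  also have "\<dots> \<le> g K * X (A 0)" using F fg by (intro mult_left_mono) auto
  finally have "f K * (1 / X (B 0) - mass X (Suc n) {0..<K} / (1 - env X 0)) \<le> g K * X (A 0)" .
  then show ?thesis using gK pos
    by (simp only: ratio_def f_def[symmetric] g_def[symmetric] pos_divide_le_eq pos_le_divide_eq times_divide_eq_left)
      (simp add: mult.commute)
qed

section \<open>Exponential decay of the transformed mass away from the velocity\<close>

lemma powr_ge_self:
  assumes "0 \<le> (x::real)" "x \<le> 1" "0 \<le> p" "p \<le> 1"
  shows "x \<le> x powr p"
proof (cases "x = 0")
  case False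
  then have "x powr 1 \<le> x powr p" using assms by (intro powr_mono') auto
  then show ?thesis using False assms by simp
qed simp

lemma hfun_measurable [measurable]:
  "(\<lambda>X. hfun X x) \<in> borel_measurable (PiM UNIV (\<lambda>_. borel))"
  unfolding hfun_def by measurable

lemma lev_env_measurable [measurable]:
  "(\<lambda>X. lev (env X) x n k) \<in> borel_measurable (PiM UNIV (\<lambda>_. borel))"
  by (rule measurable_compose[OF env_measurable(2) lev_measurable])

text \<open>A Borel--Cantelli argument with expectations: the series has finite integral, so it
  converges almost surely and its terms vanish.\<close>

lemma AE_tendsto_0_of_summable:
  fixes f :: "nat \<Rightarrow> 'z \<Rightarrow> real"
  assumes [measurable]: "\<And>n. f n \<in> borel_measurable M"
    and nn: "AE x in M. \<forall>n. 0 \<le> f n x"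
    and b: "\<And>n. (\<integral>\<^sup>+x. ennreal (f n x) \<partial>M) \<le> ennreal (c n)" "\<And>n. 0 \<le> c n" "summable c"
  shows "AE x in M. (\<lambda>n. f n x) \<longlonglongrightarrow> 0"
proof -
  have "(\<integral>\<^sup>+x. (\<Sum>n. ennreal (f n x)) \<partial>M) = (\<Sum>n. \<integral>\<^sup>+x. ennreal (f n x) \<partial>M)"
    by (rule nn_integral_suminf) measurable
  also have "\<dots> \<le> (\<Sum>n. ennreal (c n))" by (intro suminf_le b) auto
  also have "\<dots> < \<infinity>" using b by (simp add: ennreal_suminf_neq_top less_top[symmetric])
  finally have "AE x in M. (\<Sum>n. ennreal (f n x)) \<noteq> \<infinity>"
    by (intro nn_integral_PInf_AE) (auto simp: less_top[symmetric])
  with nn show ?thesis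
  proof eventually_elim
    case (elim x)
    then have "summable (\<lambda>n. f n x)" by (intro summable_suminf_not_top) auto
    then show ?case by (rule summable_LIMSEQ_zero)
  qed
qed

lemma summable_linear_exp:
  assumes "d > 0"
  shows "summable (\<lambda>n. (real n + 1) * exp (- d * real n))"
proof (rule summable_comparison_test_bigo)
  show "summable (\<lambda>n. norm (exp (- (d / 2)) ^ n))"
    using assms by (simp add: summable_geometric)
  have "(\<lambda>n. (real n + 1) * exp (- d * real n)) \<in> O(\<lambda>n. exp (- (d / 2) * real n))"
    using assms by real_asymp
  then show "(\<lambda>n. (real n + 1) * exp (- d * real n)) \<in> O(\<lambda>n. exp (- (d / 2)) ^ n)"
    by (simp add: exp_of_nat_mult[symmetric] mult.commute)
qed

text \<open>The left side is affine in k with slope x - y \<le> 0 and agrees with the right side at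
  k = t * N.\<close>

lemma linear_interpolation_le:
  fixes x y t :: real
  assumes "x \<le> y" "t * N \<le> k" shows "k * x + (N - k) * y \<le> (t * x + (1 - t) * y) * N"
proof -
  have "(k - t * N) * (x - y) \<le> 0" using assms by (intro mult_nonneg_nonpos) auto
  then show ?thesis by (simp add: algebra_simps)
qed

lemma linear_interpolation_le':
  fixes x y t :: real
  assumes "y \<le> x" "k \<le> t * N" shows "k * x + (N - k) * y \<le> (t * x + (1 - t) * y) * N"
proof -
  have "(k - t * N) * (x - y) \<le> 0" using assms by (intro mult_nonpos_nonneg) auto
  then show ?thesis by (simp add: algebra_simps)
qed

text \<open>\<open>ratio\<close> with n steps refers to sites at distance n + 1 from the origin. The
  bound by n keeps its denominator \<open>lev \<omega> e2 n k\<close> positive.\<close>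

lemma floor_level:
  assumes "0 < t" "t < 1"
  shows "0 \<le> \<lfloor>t * real (Suc n)\<rfloor>" "\<lfloor>t * real (Suc n)\<rfloor> \<le> int n"
proof -
  show "0 \<le> \<lfloor>t * real (Suc n)\<rfloor>" using assms by simp
  have "t * real (Suc n) < 1 * real (Suc n)" by (rule mult_strict_right_mono) (use assms in auto)
  moreover have "real_of_int (int n + 1) = 1 * real (Suc n)" by simp
  ultimately have "\<lfloor>t * real (Suc n)\<rfloor> < int n + 1" by (simp only: floor_less_iff)
  then show "\<lfloor>t * real (Suc n)\<rfloor> \<le> int n" by simp
qed

context beta_parameters
begin

text \<open>The product along row j and the product along column 0 each have independent factors,
  but nothing makes the two products independent of each other. Cauchy--Schwarz separates them,
  which costs the square and the exponent p / 2.\<close>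

lemma nn_integral_hfun_powr:
  assumes l: "l > 0" and p: "l + p > 0" "l + \<beta> - p > 0"
  shows "(\<integral>\<^sup>+X. ennreal (hfun X (int k, int j) powr (p / 2)) \<partial>array_law l)\<^sup>2 \<le>
    ennreal ((Beta (l + p) \<beta> / Beta l \<beta>) ^ k * (Beta (l + \<beta> - p) \<alpha> / Beta (l + \<beta>) \<alpha>) ^ j)"
proof -
  define P where "P X = (\<Prod>i<k. hor X j i)" for X
  define Q where "Q X = (\<Prod>i<j. ver X i 0)" for X
  have [measurable]: "P \<in> borel_measurable (array_law l)" "Q \<in> borel_measurable (array_law l)"
    unfolding P_def Q_def by measurable
  have sq: "(ennreal (x powr (r / 2)))\<^sup>2 = ennreal (x powr r)" for x r :: real
    unfolding power2_eq_square by (subst ennreal_mult[symmetric]) (auto simp flip: powr_add)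
  have "(\<integral>\<^sup>+X. ennreal (hfun X (int k, int j) powr (p / 2)) \<partial>array_law l) =
      (\<integral>\<^sup>+X. ennreal (P X powr (p / 2)) * ennreal (Q X powr (- p / 2)) \<partial>array_law l)"
  proof (rule nn_integral_array_cong[OF l])
    fix X assume elim: "unit_array X"
      have "hfun X (int k, int j) = P X / Q X" by (simp add: hfun_def P_def Q_def)
      then have "hfun X (int k, int j) powr (p / 2) = P X powr (p / 2) * Q X powr (- p / 2)"
    by (simp add: powr_divide powr_minus_divide)
      then show "ennreal (hfun X (int k, int j) powr (p / 2)) =
      ennreal (P X powr (p / 2)) * ennreal (Q X powr (- p / 2))" by (simp add: ennreal_mult)
  qed
  then have "(\<integral>\<^sup>+X. ennreal (hfun X (int k, int j) powr (p / 2)) \<partial>array_law l)\<^sup>2 \<le>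
    (\<integral>\<^sup>+X. (ennreal (P X powr (p / 2)))\<^sup>2 \<partial>array_law l) * (\<integral>\<^sup>+X. (ennreal (Q X powr (- p / 2)))\<^sup>2 \<partial>array_law l)"
    using Cauchy_Schwarz_nn_integral[of "\<lambda>X. ennreal (P X powr (p / 2))" "array_law l"
      "\<lambda>X. ennreal (Q X powr (- p / 2))"] by simp
  also have "\<dots> = (\<integral>\<^sup>+X. ennreal (P X powr p) \<partial>array_law l) * (\<integral>\<^sup>+X. ennreal (Q X powr (- p)) \<partial>array_law l)"
    by (simp only: sq)
  also have "(\<integral>\<^sup>+X. ennreal (P X powr p) \<partial>array_law l) = (\<integral>\<^sup>+X. (\<Prod>i<k. ennreal (hor X j i powr p)) \<partial>array_law l)"
  proof (rule nn_integral_array_cong[OF l])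
    fix X assume elim: "unit_array X"
      then show "ennreal (P X powr p) = (\<Prod>i<k. ennreal (hor X j i powr p))" unfolding P_def
    by (subst prod_ennreal) (auto simp: prod_powr_distrib less_imp_le[OF hor_ver_bounds(1)])
  qed
  also have "\<dots> = ennreal (Beta (l + p) \<beta> / Beta l \<beta>) ^ k"
    using nn_integral_hor_prod[OF l, of "\<lambda>x. ennreal (x powr p)"] nn_integral_beta_law_powr[of l \<beta> p] l p ab
    by simp
  also have "(\<integral>\<^sup>+X. ennreal (Q X powr (- p)) \<partial>array_law l) = (\<integral>\<^sup>+X. (\<Prod>i<j. ennreal (ver X i 0 powr (- p))) \<partial>array_law l)"
  proof (rule nn_integral_array_cong[OF l])
    fix X assume elim: "unit_array X"
      then show "ennreal (Q X powr (- p)) = (\<Prod>i<j. ennreal (ver X i 0 powr (- p)))" unfolding Q_def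
    by (subst prod_ennreal) (auto simp: prod_powr_distrib less_imp_le[OF hor_ver_bounds(3)])
  qed
  also have "\<dots> = ennreal (Beta (l + \<beta> - p) \<alpha> / Beta (l + \<beta>) \<alpha>) ^ j"
    using nn_integral_ver_prod[OF l, of "\<lambda>x. ennreal (x powr (- p))"]
      nn_integral_beta_law_powr[of "l + \<beta>" \<alpha> "- p"] l p ab
    by simp
  finally show ?thesis
    using p l ab by (simp add: ennreal_power ennreal_mult Beta_real_pos less_imp_le)
qed

text \<open>The integrand is at most 1, hence below its power s / 4. Cauchy--Schwarz then isolates
  the transition probability; its law depends on the environment alone, so it can be evaluated under
  \<open>m\<close>, where it is at most the inverse of the harmonic function. Together with the
  Cauchy--Schwarz step in the moments this yields a fourth root.\<close>

lemma mass_bound: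
  assumes l: "l > 0" and m: "m > 0" and s: "0 < s" "s < 1" "s < m" "s < l" and k: "k \<le> n"
  shows "(\<integral>\<^sup>+X. ennreal (lev (env X) 0 n (int k) * hfun X (int k, int (n - k))) \<partial>array_law l) \<le>
    ennreal (exp ((real k * ln (tilt1 l m s) + real (n - k) * ln (tilt2 l m s)) / 4))"
proof -
  define j where "j = n - k"
  let ?H = "\<lambda>X. hfun X (int k, int j)" and ?L = "\<lambda>X. lev (env X) 0 n (int k)"
  have jk: "int j = int n - int k" using k by (simp add: j_def)
  interpret L: prob_space "array_law l" by (rule prob_space_array_law[OF l])
  define E where "E = (\<integral>\<^sup>+X. ennreal (?L X * ?H X) \<partial>array_law l)"
  have Q: "0 \<le> ?L X * ?H X" "?L X * ?H X \<le> 1" "0 < ?L X" "0 < ?H X" if "unit_array X" for X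
  proof -
    show "0 < ?L X" using k by (intro lev_pos elliptic_env that) auto
    moreover show "0 < ?H X" by (rule hfun_pos[OF that])
    ultimately show "0 \<le> ?L X * ?H X" by simp
    show "?L X * ?H X \<le> 1" using lev_hfun_le[OF that, of "int k" n] k jk by simp
  qed
  have sq: "(ennreal (x powr (s / 4)))\<^sup>2 = ennreal (x powr (s / 2))" for x :: real
    unfolding power2_eq_square by (subst ennreal_mult[symmetric]) (auto simp flip: powr_add)
  have "E \<le> (\<integral>\<^sup>+X. ennreal (?L X powr (s / 4)) * ennreal (?H X powr (s / 4)) \<partial>array_law l)"
    unfolding E_def
  proof (rule nn_integral_array_mono[OF l])
    fix X assume elim: "unit_array X"
      have "?L X * ?H X \<le> (?L X * ?H X) powr (s / 4)"
    using Q[OF elim] s by (intro powr_ge_self) auto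
      also have "\<dots> = ?L X powr (s / 4) * ?H X powr (s / 4)"
    by (rule powr_mult)
      finally show "ennreal (?L X * ?H X) \<le> ennreal (?L X powr (s / 4)) * ennreal (?H X powr (s / 4))" by (simp add: ennreal_leI flip: ennreal_mult)
  qed
  then have "E\<^sup>2 \<le> (\<integral>\<^sup>+X. ennreal (?L X powr (s / 4)) * ennreal (?H X powr (s / 4)) \<partial>array_law l)\<^sup>2"
    by (intro power_mono) auto
  also have "\<dots> \<le> (\<integral>\<^sup>+X. (ennreal (?L X powr (s / 4)))\<^sup>2 \<partial>array_law l) * (\<integral>\<^sup>+X. (ennreal (?H X powr (s / 4)))\<^sup>2 \<partial>array_law l)"
    by (rule Cauchy_Schwarz_nn_integral) measurable
  also have "\<dots> = (\<integral>\<^sup>+X. ennreal (?L X powr (s / 2)) \<partial>array_law l) * (\<integral>\<^sup>+X. ennreal (?H X powr (s / 2)) \<partial>array_law l)"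
    by (simp only: sq)
  \<comment> \<open>The passage from \<open>l\<close> to \<open>m\<close>, through the law of the
    environment that both arrays share.\<close>
  also have "(\<integral>\<^sup>+X. ennreal (?L X powr (s / 2)) \<partial>array_law l) = (\<integral>\<^sup>+\<omega>. ennreal (lev \<omega> 0 n (int k) powr (s / 2)) \<partial>distr (array_law l) env_law env)"
    by (subst nn_integral_distr) auto
  also have "\<dots> = (\<integral>\<^sup>+\<omega>. ennreal (lev \<omega> 0 n (int k) powr (s / 2)) \<partial>distr (array_law m) env_law env)"
    by (simp add: distr_env l m)
  also have "\<dots> = (\<integral>\<^sup>+X. ennreal (?L X powr (s / 2)) \<partial>array_law m)"
    by (subst nn_integral_distr) auto
  also have "\<dots> \<le> (\<integral>\<^sup>+X. ennreal (?H X powr (- s / 2)) \<partial>array_law m)"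
  proof (rule nn_integral_array_mono[OF m])
    fix X assume elim: "unit_array X"
      have "?L X \<le> 1 / ?H X" using Q[OF elim] by (simp add: field_simps)
      then have "?L X powr (s / 2) \<le> (1 / ?H X) powr (s / 2)"
    using Q[OF elim] s by (intro powr_mono2) auto
      also have "\<dots> = ?H X powr (- s / 2)"
    using Q[OF elim] by (simp add: powr_minus_divide powr_divide)
      finally show "ennreal (?L X powr (s / 2)) \<le> ennreal (?H X powr (- s / 2))" by (rule ennreal_leI)
  qed
  finally have E2: "E\<^sup>2 \<le> (\<integral>\<^sup>+X. ennreal (?H X powr (- s / 2)) \<partial>array_law m) *
      (\<integral>\<^sup>+X. ennreal (?H X powr (s / 2)) \<partial>array_law l)"
    by (simp add: mult_right_mono)
  have t: "tilt1 l m s > 0" "tilt2 l m s > 0"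
    unfolding tilt1_def tilt2_def using s l m ab by (auto intro!: mult_pos_pos divide_pos_pos Beta_real_pos)
  have "E ^ 4 = (E\<^sup>2)\<^sup>2" by simp
  also have "\<dots> \<le> ((\<integral>\<^sup>+X. ennreal (?H X powr (- s / 2)) \<partial>array_law m) *
      (\<integral>\<^sup>+X. ennreal (?H X powr (s / 2)) \<partial>array_law l))\<^sup>2"
    by (intro power_mono E2) auto
  also have "\<dots> \<le> ennreal ((Beta (m + - s) \<beta> / Beta m \<beta>) ^ k * (Beta (m + \<beta> - - s) \<alpha> / Beta (m + \<beta>) \<alpha>) ^ j) *
     ennreal ((Beta (l + s) \<beta> / Beta l \<beta>) ^ k * (Beta (l + \<beta> - s) \<alpha> / Beta (l + \<beta>) \<alpha>) ^ j)"
    unfolding power_mult_distrib using s ab l m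
    by (intro mult_mono nn_integral_hfun_powr) auto
  also have "\<dots> = ennreal (tilt1 l m s ^ k * tilt2 l m s ^ j)"
    using s l m ab
    by (subst ennreal_mult[symmetric])
       (auto simp: tilt1_def tilt2_def power_mult_distrib mult_ac power_divide less_imp_le[OF Beta_real_pos] intro!: mult_nonneg_nonneg divide_nonneg_nonneg)
  also have "tilt1 l m s ^ k * tilt2 l m s ^ j = exp ((real k * ln (tilt1 l m s) + real j * ln (tilt2 l m s)) / 4) ^ 4"
  proof -
    have "exp (y / 4) ^ 4 = exp y" for y :: real by (simp flip: exp_of_nat_mult)
    then show ?thesis using t by (simp add: exp_add exp_of_nat_mult)
  qed
  finally have E4: "E ^ 4 \<le> ennreal (exp ((real k * ln (tilt1 l m s) + real j * ln (tilt2 l m s)) / 4) ^ 4)" .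
  \<comment> \<open>Finiteness of E, which allows the fourth root to be taken among real
    numbers.\<close>
  have "E \<le> (\<integral>\<^sup>+X. 1 \<partial>array_law l)"
    unfolding E_def
  proof (rule nn_integral_mono_AE)
    show "AE X in array_law l. ennreal (?L X * ?H X) \<le> 1"
      using AE_unit_array[OF l] by eventually_elim (use Q in auto)
  qed
  then have "E \<le> 1" by (simp add: L.emeasure_space_1)
  then obtain e where e: "E = ennreal e" "e \<ge> 0" by (cases E) (auto simp: top_unique)
  have "e ^ 4 \<le> exp ((real k * ln (tilt1 l m s) + real j * ln (tilt2 l m s)) / 4) ^ 4"
    using E4 e by (simp add: ennreal_power)
  then have "e \<le> exp ((real k * ln (tilt1 l m s) + real j * ln (tilt2 l m s)) / 4)"
    by (rule power_le_imp_le_base[of _ 3, simplified]) simp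
  then show ?thesis using e by (simp add: E_def j_def ennreal_leI)
qed

text \<open>A union bound: \<open>K n\<close> has at most n + 1 elements, each of mean mass at most
  exp (- d * n / 4), and this is summable in n.\<close>

lemma mass_vanishes:
  assumes l: "l > 0" and m: "m > 0" and s: "0 < s" "s < 1" "s < m" "s < l" and d: "d > 0"
    and K: "\<And>n. K n \<subseteq> {0..int n}"
      "\<And>n k. k \<in> K n \<Longrightarrow> of_int k * ln (tilt1 l m s) + (real n - of_int k) * ln (tilt2 l m s) \<le> - d * real n"
  shows "AE X in array_law l. (\<lambda>n. mass X n (K n)) \<longlonglongrightarrow> 0"
proof (rule AE_tendsto_0_of_summable)
  have fin: "finite (K n)" for n using K(1) finite_subset by blast
  show "(\<lambda>X. mass X n (K n)) \<in> borel_measurable (array_law l)" for n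
    unfolding mass_def by measurable
  show "AE X in array_law l. \<forall>n. 0 \<le> mass X n (K n)"
    using AE_unit_array[OF l]
  proof eventually_elim
    case (elim X)
    then show ?case unfolding mass_def
      by (intro allI sum_nonneg mult_nonneg_nonneg lev_nonneg elliptic_env less_imp_le[OF hfun_pos])
  qed
  show "0 \<le> (real n + 1) * exp (- (d / 4) * real n)" for n by simp
  show "summable (\<lambda>n. (real n + 1) * exp (- (d / 4) * real n))"
    using d by (intro summable_linear_exp) simp
  show "(\<integral>\<^sup>+X. ennreal (mass X n (K n)) \<partial>array_law l) \<le> ennreal ((real n + 1) * exp (- (d / 4) * real n))" for n
  proof -
    have "(\<integral>\<^sup>+X. ennreal (mass X n (K n)) \<partial>array_law l) \<le>
        (\<integral>\<^sup>+X. (\<Sum>k\<in>K n. ennreal (lev (env X) 0 n k * hfun X (k, int n - k))) \<partial>array_law l)"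
    proof (rule nn_integral_array_mono[OF l])
      fix X assume elim: "unit_array X"
        then show "ennreal (mass X n (K n)) \<le> (\<Sum>k\<in>K n. ennreal (lev (env X) 0 n k * hfun X (k, int n - k)))" unfolding mass_def
      by (subst sum_ennreal) (auto intro!: mult_nonneg_nonneg lev_nonneg elliptic_env less_imp_le[OF hfun_pos])
    qed
    also have "\<dots> = (\<Sum>k\<in>K n. \<integral>\<^sup>+X. ennreal (lev (env X) 0 n k * hfun X (k, int n - k)) \<partial>array_law l)"
      by (rule nn_integral_sum) measurable
    also have "\<dots> \<le> (\<Sum>k\<in>K n. ennreal (exp (- (d / 4) * real n)))"
    proof (rule sum_mono)
      fix k assume k: "k \<in> K n"
      then have "k \<in> {0..int n}" using K(1)[of n] by blast
      then have kn: "0 \<le> k" "k \<le> int n" by auto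
      then obtain i where i: "k = int i" "i \<le> n" by (metis nat_int nat_le_iff zero_le_imp_eq_int)
      have "(\<integral>\<^sup>+X. ennreal (lev (env X) 0 n k * hfun X (k, int n - k)) \<partial>array_law l) \<le>
        ennreal (exp ((real i * ln (tilt1 l m s) + real (n - i) * ln (tilt2 l m s)) / 4))"
        using mass_bound[OF l m s i(2)] i by (simp add: of_nat_diff)
      also have "\<dots> \<le> ennreal (exp (- (d / 4) * real n))"
        using K(2)[OF k] i by (intro ennreal_leI) (simp add: of_nat_diff)
      finally show "(\<integral>\<^sup>+X. ennreal (lev (env X) 0 n k * hfun X (k, int n - k)) \<partial>array_law l) \<le>
        ennreal (exp (- (d / 4) * real n))" .
    qed
    also have "\<dots> = ennreal (real (card (K n)) * exp (- (d / 4) * real n))"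
      by (simp add: ennreal_mult ennreal_of_nat_eq_real_of_nat)
    also have "\<dots> \<le> ennreal ((real n + 1) * exp (- (d / 4) * real n))"
    proof -
      have "card (K n) \<le> card {0..int n}" by (intro card_mono K) simp
      then have "real (card (K n)) \<le> real n + 1" by simp
      then show ?thesis by (intro ennreal_leI mult_right_mono) auto
    qed
    finally show ?thesis .
  qed
qed

lemma mass_right_vanishes:
  assumes l: "l > 0" and t: "0 < t" "t < 1" "velocity l < t"
  shows "AE X in array_law l. (\<lambda>n. mass X n {\<lfloor>t * real n\<rfloor><..int n}) \<longlonglongrightarrow> 0"
proof -
  obtain m s where m: "m > 0" and s: "0 < s" "s < 1" "s < m" "s < l"
    and neg: "t * ln (tilt1 l m s) + (1 - t) * ln (tilt2 l m s) < 0" "ln (tilt1 l m s) < ln (tilt2 l m s)"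
    using exists_tilt_right[OF l t] by blast
  show ?thesis
  proof (rule mass_vanishes[OF l m s])
    show "0 < - (t * ln (tilt1 l m s) + (1 - t) * ln (tilt2 l m s))" using neg by simp
    fix n k
    have "0 \<le> \<lfloor>t * real n\<rfloor>" using t by simp
    then show "{\<lfloor>t * real n\<rfloor><..int n} \<subseteq> {0..int n}" by (auto simp del: zero_le_floor)
    assume "k \<in> {\<lfloor>t * real n\<rfloor><..int n}"
    then have "t * real n \<le> of_int k" by (simp add: floor_less_iff)
    from linear_interpolation_le[OF less_imp_le[OF neg(2)] this]
    show "of_int k * ln (tilt1 l m s) + (real n - of_int k) * ln (tilt2 l m s)
       \<le> - (- (t * ln (tilt1 l m s) + (1 - t) * ln (tilt2 l m s))) * real n"
      by (simp only: minus_minus)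
  qed
qed

lemma mass_left_vanishes:
  assumes l: "l > 0" and t: "0 < t" "t < 1" "t < velocity l"
  shows "AE X in array_law l. (\<lambda>n. mass X n {0..<\<lfloor>t * real n\<rfloor>}) \<longlonglongrightarrow> 0"
proof -
  obtain m s where m: "m > 0" and s: "0 < s" "s < 1" "s < m" "s < l"
    and neg: "t * ln (tilt1 l m s) + (1 - t) * ln (tilt2 l m s) < 0" "ln (tilt2 l m s) < ln (tilt1 l m s)"
    using exists_tilt_left[OF l t] by blast
  show ?thesis
  proof (rule mass_vanishes[OF l m s])
    show "0 < - (t * ln (tilt1 l m s) + (1 - t) * ln (tilt2 l m s))" using neg by simp
    fix n k
    have "t * real n \<le> real n" using t by (simp add: mult_left_le_one_le)
    then have "\<lfloor>t * real n\<rfloor> \<le> int n" by linarith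
    then show "{0..<\<lfloor>t * real n\<rfloor>} \<subseteq> {0..int n}" by auto
    assume "k \<in> {0..<\<lfloor>t * real n\<rfloor>}"
    then have "of_int k \<le> t * real n" by (auto simp: less_floor_iff)
    from linear_interpolation_le'[OF less_imp_le[OF neg(2)] this]
    show "of_int k * ln (tilt1 l m s) + (real n - of_int k) * ln (tilt2 l m s)
       \<le> - (- (t * ln (tilt1 l m s) + (1 - t) * ln (tilt2 l m s))) * real n"
      by (simp only: minus_minus)
  qed
qed

text \<open>\<open>X (A 0) * X (B 0)\<close> is \<open>hfun X e1\<close> divided by
  \<open>hfun X e2\<close>, and the correction in \<open>ratio_ge\<close> is the transformed mass to
  the right of t on level n + 1, which vanishes.\<close>

lemma liminf_ratio_ge:
  assumes l: "l > 0" and t: "0 < t" "t < 1" "velocity l < t"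
  shows "AE X in array_law l. ennreal (X (A 0) * X (B 0)) \<le>
    liminf (\<lambda>n. ennreal (ratio (env X) n \<lfloor>t * real (Suc n)\<rfloor>))"
  using mass_right_vanishes[OF assms] AE_unit_array[OF l]
proof eventually_elim
  case (elim X)
  let ?m = "\<lambda>n. mass X (Suc n) {\<lfloor>t * real (Suc n)\<rfloor><..int (Suc n)}"
  have "?m \<longlonglongrightarrow> 0"
    using LIMSEQ_Suc[OF elim(1)] by simp
  then have "(\<lambda>n. (X (A 0) - ?m n / env X 0) * X (B 0)) \<longlonglongrightarrow> (X (A 0) - 0 / env X 0) * X (B 0)"
    using ellipticD[OF elliptic_env[OF elim(2)], of 0] by (intro tendsto_intros) auto
  then have lim: "(\<lambda>n. ennreal ((X (A 0) - ?m n / env X 0) * X (B 0))) \<longlonglongrightarrow> ennreal (X (A 0) * X (B 0))"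
    by (intro tendsto_ennrealI) simp
  have "ennreal (X (A 0) * X (B 0)) = liminf (\<lambda>n. ennreal ((X (A 0) - ?m n / env X 0) * X (B 0)))"
    using lim_imp_Liminf[OF _ lim] by simp
  also have "\<dots> \<le> liminf (\<lambda>n. ennreal (ratio (env X) n \<lfloor>t * real (Suc n)\<rfloor>))"
    by (intro Liminf_mono always_eventually allI ennreal_leI ratio_ge elim(2) floor_level t)
  finally show ?case .
qed

text \<open>The bound of \<open>ratio_le\<close> is available once the mass to the left of t is
  small enough for its denominator to be positive, hence for all large n.\<close>

lemma limsup_ratio_le:
  assumes l: "l > 0" and t: "0 < t" "t < 1" "t < velocity l"
  shows "AE X in array_law l. 
    limsup (\<lambda>n. ennreal (ratio (env X) n \<lfloor>t * real (Suc n)\<rfloor>)) \<le> ennreal (X (A 0) * X (B 0))"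
  using mass_left_vanishes[OF assms] AE_unit_array[OF l]
proof eventually_elim
  case (elim X)
  let ?m = "\<lambda>n. mass X (Suc n) {0..<\<lfloor>t * real (Suc n)\<rfloor>}"
  have B: "X (B 0) > 0" using elim by (auto simp: unit_array_def)
  have "?m \<longlonglongrightarrow> 0"
    using LIMSEQ_Suc[OF elim(1)] by simp
  then have D: "(\<lambda>n. 1 / X (B 0) - ?m n / (1 - env X 0)) \<longlonglongrightarrow> 1 / X (B 0) - 0 / (1 - env X 0)"
    using ellipticD[OF elliptic_env[OF elim(2)], of 0] by (intro tendsto_intros) auto
  have "(\<lambda>n. X (A 0) / (1 / X (B 0) - ?m n / (1 - env X 0))) \<longlonglongrightarrow> X (A 0) / (1 / X (B 0) - 0 / (1 - env X 0))"
    using B by (intro tendsto_divide D tendsto_const) simp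
  then have lim: "(\<lambda>n. ennreal (X (A 0) / (1 / X (B 0) - ?m n / (1 - env X 0)))) \<longlonglongrightarrow> ennreal (X (A 0) * X (B 0))"
    by (intro tendsto_ennrealI) simp
  have "eventually (\<lambda>n. 1 / X (B 0) - ?m n / (1 - env X 0) > 0) sequentially"
    using B by (intro order_tendstoD(1)[OF D]) simp
  then have "limsup (\<lambda>n. ennreal (ratio (env X) n \<lfloor>t * real (Suc n)\<rfloor>)) \<le>
      limsup (\<lambda>n. ennreal (X (A 0) / (1 / X (B 0) - ?m n / (1 - env X 0))))"
    by (intro Limsup_mono) (elim eventually_mono, intro ennreal_leI ratio_le elim(2) floor_level t)
  also have "\<dots> = ennreal (X (A 0) * X (B 0))"
    using lim_imp_Limsup[OF _ lim] by simp
  finally show ?case .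
qed

text \<open>The two slots are independent and the factor l + \<beta> cancels. Continuity in l
  settles the directions left of the drift, the limit 1 for large l the direction of the
  drift.\<close>

lemma nn_integral_corner:
  assumes l: "l > 0"
  shows "(\<integral>\<^sup>+X. ennreal (X (A 0) * X (B 0)) \<partial>array_law l) = ennreal (l / (l + \<alpha> + \<beta>))"
proof -
  have "(\<integral>\<^sup>+X. ennreal (X (A 0) * X (B 0)) \<partial>array_law l) =
      (\<integral>\<^sup>+X. (\<Prod>s\<in>{A 0, B 0}. ennreal (X s)) \<partial>array_law l)"
  proof (rule nn_integral_cong_AE)
    show "AE X in array_law l. ennreal (X (A 0) * X (B 0)) = (\<Prod>s\<in>{A 0, B 0}. ennreal (X s))"
      using AE_unit_array[OF l] by eventually_elim (auto simp: unit_array_def ennreal_mult less_imp_le)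
  qed
  also have "\<dots> = (\<Prod>s\<in>{A 0, B 0}. \<integral>\<^sup>+x. ennreal x \<partial>slot_law l s)"
    unfolding array_law_def
    by (rule nn_integral_PiM_prod) (auto simp: prob_space_slot_law l measurable_cong_sets[OF sets_slot_law refl])
  also have "\<dots> = ennreal (l / (l + \<beta>)) * ennreal ((l + \<beta>) / (l + \<beta> + \<alpha>))"
    using l ab by (simp add: nn_integral_beta_law_id)
  also have "\<dots> = ennreal (l / (l + \<alpha> + \<beta>))"
    using l ab by (subst ennreal_mult[symmetric]) (auto simp: add_ac)
  finally show ?thesis .
qed

end

section \<open>Almost sure limits of hitting ratios\<close>

definition liminf_ratio :: "real \<Rightarrow> (site \<Rightarrow> real) \<Rightarrow> ennreal" where
  "liminf_ratio t \<omega> = liminf (\<lambda>n. ennreal (ratio \<omega> n \<lfloor>t * real (Suc n)\<rfloor>))"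

definition limsup_ratio :: "real \<Rightarrow> (site \<Rightarrow> real) \<Rightarrow> ennreal" where
  "limsup_ratio t \<omega> = limsup (\<lambda>n. ennreal (ratio \<omega> n \<lfloor>t * real (Suc n)\<rfloor>))"

definition slope_below :: "real \<Rightarrow> nat \<Rightarrow> real" where "slope_below t i = t - t / (real i + 2)"

definition slope_above :: "real \<Rightarrow> nat \<Rightarrow> real" where "slope_above t i = t + (1 - t) / (real i + 2)"

text \<open>Every sequence of sites in direction (t, 1 - t) is eventually to the right of each slope
  below t and to the left of each slope above t. Countably many slopes keep the supremum and the
  infimum measurable; the summand 2 keeps the slopes inside the open unit interval.\<close>

definition lower_ratio :: "real \<Rightarrow> (site \<Rightarrow> real) \<Rightarrow> ennreal" where
  "lower_ratio t \<omega> = (SUP i. liminf_ratio (slope_below t i) \<omega>)"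

definition upper_ratio :: "real \<Rightarrow> (site \<Rightarrow> real) \<Rightarrow> ennreal" where
  "upper_ratio t \<omega> = (INF i. limsup_ratio (slope_above t i) \<omega>)"

lemma liminf_ratio_measurable [measurable]:
  "liminf_ratio t \<in> borel_measurable (PiM UNIV (\<lambda>_. borel))"
  "limsup_ratio t \<in> borel_measurable (PiM UNIV (\<lambda>_. borel))"
  unfolding liminf_ratio_def[abs_def] limsup_ratio_def[abs_def] by measurable

lemma lower_ratio_measurable [measurable]:
  "lower_ratio t \<in> borel_measurable (PiM UNIV (\<lambda>_. borel))"
  "upper_ratio t \<in> borel_measurable (PiM UNIV (\<lambda>_. borel))"
  unfolding lower_ratio_def[abs_def] upper_ratio_def[abs_def] by measurable

lemma slope_below_bounds:
  assumes "0 < t" "t < 1"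
  shows "0 < slope_below t i" "slope_below t i < t" "slope_below t i < 1"
proof -
  have "t / (real i + 2) \<le> t / 2" by (rule divide_left_mono) (use assms in simp_all)
  moreover have "0 < t / (real i + 2)" using assms by simp
  ultimately show "0 < slope_below t i" "slope_below t i < t" "slope_below t i < 1"
    unfolding slope_below_def using assms by linarith+
qed

lemma slope_above_bounds:
  assumes "0 < t" "t < 1"
  shows "0 < slope_above t i" "t < slope_above t i" "slope_above t i < 1"
proof -
  define d where "d = (1 - t) / (real i + 2)"
  have "d * (real i + 2) = 1 - t" by (simp add: d_def)
  then have "d * real i + d * 2 = 1 - t" by (simp only: distrib_left)
  moreover have "0 \<le> d * real i" using assms by (simp add: d_def)
  moreover have "0 < d" using assms by (simp add: d_def)
  moreover have "slope_above t i = t + d" by (simp add: slope_above_def d_def)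
  ultimately show "0 < slope_above t i" "t < slope_above t i" "slope_above t i < 1"
    using assms by linarith+
qed

lemma slope_below_LIMSEQ: "slope_below t \<longlonglongrightarrow> t"
proof -
  have "(\<lambda>i. t - t / (real i + 2)) \<longlonglongrightarrow> t" by real_asymp
  then show ?thesis by (simp add: slope_below_def[abs_def])
qed

lemma slope_above_LIMSEQ: "slope_above t \<longlonglongrightarrow> t"
proof -
  have "(\<lambda>i. t + (1 - t) / (real i + 2)) \<longlonglongrightarrow> t" by real_asymp
  then show ?thesis by (simp add: slope_above_def[abs_def])
qed

lemma lower_le_upper_ratio:
  assumes "elliptic \<omega>" "0 < t" "t < 1"
  shows "lower_ratio t \<omega> \<le> upper_ratio t \<omega>"
  unfolding lower_ratio_def upper_ratio_def
proof (intro SUP_least INF_greatest)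
  fix i j
  have "liminf_ratio (slope_below t i) \<omega> \<le> limsup_ratio (slope_below t i) \<omega>"
    unfolding liminf_ratio_def limsup_ratio_def by (rule Liminf_le_Limsup) simp
  also have "\<dots> \<le> limsup_ratio (slope_above t j) \<omega>"
    unfolding limsup_ratio_def
  proof (intro Limsup_mono always_eventually allI ennreal_leI ratio_mono assms(1))
    fix n
    show "0 \<le> \<lfloor>slope_below t i * real (Suc n)\<rfloor>"
      using slope_below_bounds[OF assms(2,3), of i] by (intro floor_level) auto
    show "\<lfloor>slope_above t j * real (Suc n)\<rfloor> \<le> int n"
      using slope_above_bounds[OF assms(2,3), of j] by (intro floor_level) auto
    show "\<lfloor>slope_below t i * real (Suc n)\<rfloor> \<le> \<lfloor>slope_above t j * real (Suc n)\<rfloor>"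
      using slope_below_bounds[OF assms(2,3), of i] slope_above_bounds[OF assms(2,3), of j]
      by (intro floor_mono mult_right_mono) auto
  qed
  finally show "liminf_ratio (slope_below t i) \<omega> \<le> limsup_ratio (slope_above t j) \<omega>" .
qed

lemma AE_eq_of_nn_integral_le:
  fixes f g :: "'z \<Rightarrow> ennreal"
  assumes [measurable]: "f \<in> borel_measurable M" "g \<in> borel_measurable M"
    and le: "AE x in M. f x \<le> g x" and int: "(\<integral>\<^sup>+x. g x \<partial>M) \<le> (\<integral>\<^sup>+x. f x \<partial>M)" "(\<integral>\<^sup>+x. g x \<partial>M) < \<infinity>"
  shows "AE x in M. f x = g x"
proof -
  have fin: "(\<integral>\<^sup>+x. f x \<partial>M) \<noteq> \<infinity>"
    using nn_integral_mono_AE[OF le] int(2) by (auto simp: top_unique)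
  have "(\<integral>\<^sup>+x. g x - f x \<partial>M) = (\<integral>\<^sup>+x. g x \<partial>M) - (\<integral>\<^sup>+x. f x \<partial>M)"
    by (rule nn_integral_diff[OF _ _ fin le]) auto
  also have "\<dots> = 0" using int fin by (simp add: diff_eq_0_iff_ennreal less_top)
  finally have "AE x in M. g x - f x = 0"
    by (subst (asm) nn_integral_0_iff_AE) auto
  moreover have "AE x in M. g x \<noteq> \<infinity>" using int(2) by (intro nn_integral_noteq_infinite) auto
  ultimately show ?thesis using le
    by eventually_elim (auto simp: diff_eq_0_iff_ennreal less_top)
qed

section \<open>Sequences of sites in a fixed direction\<close>

lemma to_infinityD:
  assumes "to_infinity_in_direction z (t, 1 - t)" "0 < t" "t < 1"
  shows "filterlim (\<lambda>N. l1 (z N)) at_top sequentially"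
    and "(\<lambda>N. real_of_int (fst (z N)) / real (l1 (z N))) \<longlonglongrightarrow> t"
    and "(\<lambda>N. real_of_int (snd (z N)) / real (l1 (z N))) \<longlonglongrightarrow> 1 - t"
    and "filterlim (\<lambda>N. fst (z N)) at_top sequentially"
    and "filterlim (\<lambda>N. snd (z N)) at_top sequentially"
proof -
  show l: "filterlim (\<lambda>N. l1 (z N)) at_top sequentially"
    using assms by (simp add: to_infinity_in_direction_def)
  have "(\<lambda>N. rvec (z N) /\<^sub>R real (l1 (z N))) \<longlonglongrightarrow> (t, 1 - t)"
    using assms by (simp add: to_infinity_in_direction_def)
  from tendsto_fst[OF this] tendsto_snd[OF this]
  show f: "(\<lambda>N. real_of_int (fst (z N)) / real (l1 (z N))) \<longlonglongrightarrow> t"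
    and s: "(\<lambda>N. real_of_int (snd (z N)) / real (l1 (z N))) \<longlonglongrightarrow> 1 - t"
    by (simp_all add: rvec_def divide_inverse mult.commute)
  have rl: "filterlim (\<lambda>N. real (l1 (z N))) at_top sequentially"
    by (rule filterlim_compose[OF filterlim_real_sequentially l])
  have nz: "eventually (\<lambda>N. real (l1 (z N)) \<noteq> 0) sequentially"
    using filterlim_at_top_dense[THEN iffD1, OF rl, rule_format, of 0] by eventually_elim simp
  have "filterlim (\<lambda>N. real_of_int (fst (z N)) / real (l1 (z N)) * real (l1 (z N))) at_top sequentially"
    by (rule filterlim_tendsto_pos_mult_at_top[OF f assms(2) rl])
  then have "filterlim (\<lambda>N. real_of_int (fst (z N))) at_top sequentially"
    by (rule filterlim_mono_eventually[OF _ order_refl order_refl]) (use nz in eventually_elim, simp)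
  then show "filterlim (\<lambda>N. fst (z N)) at_top sequentially"
    unfolding filterlim_at_top
    by (metis (mono_tags, lifting) eventually_mono of_int_le_iff)
  have "filterlim (\<lambda>N. real_of_int (snd (z N)) / real (l1 (z N)) * real (l1 (z N))) at_top sequentially"
    using assms(3) by (intro filterlim_tendsto_pos_mult_at_top[OF s _ rl]) simp
  then have "filterlim (\<lambda>N. real_of_int (snd (z N))) at_top sequentially"
    by (rule filterlim_mono_eventually[OF _ order_refl order_refl]) (use nz in eventually_elim, simp)
  then show "filterlim (\<lambda>N. snd (z N)) at_top sequentially"
    unfolding filterlim_at_top
    by (metis (mono_tags, lifting) eventually_mono of_int_le_iff)
qed

lemma to_infinity_ge:
  assumes "to_infinity_in_direction z (t, 1 - t)" "0 < t" "t < 1"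
  shows "eventually (\<lambda>N. a \<le> fst (z N) \<and> a \<le> snd (z N)) sequentially"
  using to_infinityD(4,5)[OF assms] by (auto simp: filterlim_at_top eventually_conj_iff)

text \<open>Once all coordinates are positive, the length changes exactly by fst x + snd x. Dividing
  numerator and denominator by the old length makes the shift vanish in the limit.\<close>

lemma to_infinity_shift:
  assumes z: "to_infinity_in_direction z (t, 1 - t)" and t: "0 < t" "t < 1"
  shows "to_infinity_in_direction (\<lambda>N. z N - x) (t, 1 - t)"
proof -
  define c where "c = fst x + snd x"
  have ev: "eventually (\<lambda>N. l1 (z N) = nat (fst (z N) + snd (z N)) \<and> 0 < fst (z N) \<and> 0 < snd (z N) \<and>
     0 < fst (z N - x) \<and> 0 < snd (z N - x)) sequentially"
    using to_infinity_ge[OF assms, of "\<bar>fst x\<bar> + \<bar>snd x\<bar> + 1"]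
    by eventually_elim (auto simp: l1_def)
  have l: "filterlim (\<lambda>N. real (l1 (z N))) at_top sequentially"
    by (rule filterlim_compose[OF filterlim_real_sequentially to_infinityD(1)[OF assms]])
  have inv: "(\<lambda>N. r / real (l1 (z N))) \<longlonglongrightarrow> 0" for r
    by (rule tendsto_divide_0[OF tendsto_const filterlim_at_top_imp_at_infinity[OF l]])
  have den: "(\<lambda>N. 1 - real_of_int c / real (l1 (z N))) \<longlonglongrightarrow> 1 - 0"
    by (intro tendsto_intros inv)
  have "(\<lambda>N. ((real_of_int (fst (z N)) / real (l1 (z N)) - real_of_int (fst x) / real (l1 (z N))) / (1 - real_of_int c / real (l1 (z N))),
      (real_of_int (snd (z N)) / real (l1 (z N)) - real_of_int (snd x) / real (l1 (z N))) / (1 - real_of_int c / real (l1 (z N)))))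
    \<longlonglongrightarrow> ((t - 0) / (1 - 0), (1 - t - 0) / (1 - 0))"
    by (intro tendsto_Pair tendsto_divide tendsto_diff to_infinityD(2,3)[OF assms] inv tendsto_const) auto
  then have "(\<lambda>N. rvec (z N - x) /\<^sub>R real (l1 (z N - x))) \<longlonglongrightarrow> ((t - 0) / (1 - 0), (1 - t - 0) / (1 - 0))"
  proof (rule Lim_transform_eventually)
    show "eventually (\<lambda>N. ((real_of_int (fst (z N)) / real (l1 (z N)) - real_of_int (fst x) / real (l1 (z N))) / (1 - real_of_int c / real (l1 (z N))),
      (real_of_int (snd (z N)) / real (l1 (z N)) - real_of_int (snd x) / real (l1 (z N))) / (1 - real_of_int c / real (l1 (z N)))) =
      rvec (z N - x) /\<^sub>R real (l1 (z N - x))) sequentially"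
      using ev
    proof eventually_elim
      case (elim N)
      define L where "L = real (l1 (z N))"
      have L: "L > 0" using elim by (simp add: L_def)
      have L': "real (l1 (z N - x)) = L - of_int c" "L - of_int c > 0"
        using elim by (auto simp: l1_def c_def L_def)
      have e: "(a / L - b / L) / (1 - of_int c / L) = (a - b) / (L - of_int c)" for a b :: real
        using L L' by (simp add: field_simps)
      show ?case unfolding L'(1) L_def[symmetric] e by (simp add: rvec_def divide_inverse mult.commute)
    qed
  qed
  moreover have "filterlim (\<lambda>N. l1 (z N - x)) at_top sequentially"
  proof (rule filterlim_at_top_mono)
    show "filterlim (\<lambda>N. nat (fst (z N) - fst x)) at_top sequentially"
    proof -
      have "filterlim (\<lambda>N. - fst x + fst (z N)) at_top sequentially"
        unfolding filterlim_at_top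
      proof
        fix a show "eventually (\<lambda>N. a \<le> - fst x + fst (z N)) sequentially"
          using to_infinity_ge[OF assms, of "a + fst x"] by eventually_elim auto
      qed
      then have "filterlim (\<lambda>N. nat (- fst x + fst (z N))) at_top sequentially"
        by (rule filterlim_compose[OF filterlim_nat_sequentially])
      then show ?thesis by simp
    qed
    show "eventually (\<lambda>N. nat (fst (z N) - fst x) \<le> l1 (z N - x)) sequentially"
      by (rule always_eventually) (auto simp: l1_def intro!: nat_mono)
  qed
  ultimately show ?thesis by (simp add: to_infinity_in_direction_def)
qed

lemma to_infinity_swap:
  assumes "to_infinity_in_direction z (t, 1 - t)"
  shows "to_infinity_in_direction (\<lambda>N. prod.swap (z N)) (1 - t, 1 - (1 - t))"
proof -
  have "l1 (prod.swap x) = l1 x" for x by (simp add: l1_def add.commute)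
  moreover have "(\<lambda>N. rvec (z N) /\<^sub>R real (l1 (z N))) \<longlonglongrightarrow> (t, 1 - t)"
    using assms by (simp add: to_infinity_in_direction_def)
  from tendsto_Pair[OF tendsto_snd[OF this] tendsto_fst[OF this]]
  have "(\<lambda>N. rvec (prod.swap (z N)) /\<^sub>R real (l1 (z N))) \<longlonglongrightarrow> (1 - t, t)"
    by (simp add: rvec_def)
  ultimately show ?thesis using assms by (simp add: to_infinity_in_direction_def)
qed

definition corner_ratio :: "(site \<Rightarrow> real) \<Rightarrow> site \<Rightarrow> site \<Rightarrow> real" where
  "corner_ratio \<omega> x z = visit_prob \<omega> (x + e1) z / visit_prob \<omega> (x + e2) z"

definition has_corner_limit :: "(site \<Rightarrow> real) \<Rightarrow> site \<Rightarrow> real \<times> real \<Rightarrow> real \<Rightarrow> bool" where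
  "has_corner_limit \<omega> x \<xi> r \<longleftrightarrow> (\<forall>z. to_infinity_in_direction z \<xi> \<longrightarrow> (\<lambda>N. corner_ratio \<omega> x (z N)) \<longlonglongrightarrow> r)"

lemma corner_ratio_eq_ratio:
  assumes "0 < fst z" "0 < snd z"
  shows "corner_ratio \<omega> 0 z = ratio \<omega> (l1 z - 1) (fst z)"
proof -
  have "nat (fst z + snd z - 1) = l1 z - 1" using assms by (simp add: l1_def nat_diff_distrib')
  then show ?thesis using assms
    by (simp add: corner_ratio_def ratio_def visit_prob_def e1_def e2_def algebra_simps)
qed

text \<open>On its own antidiagonal the site is eventually to the right of the floor of each slope
  below t, and there the ratio is monotone. The site is l1 z - 1 steps away from e1 and e2, which
  explains the shifted index.\<close>

lemma liminf_ratio_le_corner: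
  assumes el: "elliptic \<omega>" and z: "to_infinity_in_direction z (t, 1 - t)" and t: "0 < t" "t < 1"
  shows "lower_ratio t \<omega> \<le> liminf (\<lambda>N. ennreal (corner_ratio \<omega> 0 (z N)))"
  unfolding lower_ratio_def
proof (rule SUP_least)
  fix i
  note b = slope_below_bounds[OF t, of i]
  have n: "filterlim (\<lambda>N. l1 (z N) - 1) at_top sequentially"
    by (rule filterlim_compose[OF filterlim_minus_const_nat_at_top to_infinityD(1)[OF z t]])
  show "liminf_ratio (slope_below t i) \<omega> \<le> liminf (\<lambda>N. ennreal (corner_ratio \<omega> 0 (z N)))"
    unfolding le_Liminf_iff
  proof (intro allI impI)
    fix y assume "y < liminf_ratio (slope_below t i) \<omega>"
    then have "eventually (\<lambda>n. y < ennreal (ratio \<omega> n \<lfloor>slope_below t i * real (Suc n)\<rfloor>)) sequentially"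
      unfolding liminf_ratio_def by (rule less_LiminfD)
    then have "eventually (\<lambda>N. y < ennreal (ratio \<omega> (l1 (z N) - 1) \<lfloor>slope_below t i * real (Suc (l1 (z N) - 1))\<rfloor>)) sequentially"
      using n by (rule eventually_compose_filterlim)
    moreover have "eventually (\<lambda>N. slope_below t i < real_of_int (fst (z N)) / real (l1 (z N))) sequentially"
      using order_tendstoD(1)[OF to_infinityD(2)[OF z t] b(2)] .
    ultimately show "eventually (\<lambda>N. y < ennreal (corner_ratio \<omega> 0 (z N))) sequentially"
      using to_infinity_ge[OF z t, of 1]
    proof eventually_elim
      case (elim N)
      have L: "int (l1 (z N)) = fst (z N) + snd (z N)" "0 < l1 (z N)" using elim by (auto simp: l1_def)
      have "ratio \<omega> (l1 (z N) - 1) \<lfloor>slope_below t i * real (Suc (l1 (z N) - 1))\<rfloor> \<le> ratio \<omega> (l1 (z N) - 1) (fst (z N))"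
      proof (rule ratio_mono[OF el])
        show "0 \<le> \<lfloor>slope_below t i * real (Suc (l1 (z N) - 1))\<rfloor>" using b by (intro floor_level) auto
        have "slope_below t i * real (l1 (z N)) \<le> real_of_int (fst (z N))"
          using elim(2) L by (simp add: less_divide_eq)
        then show "\<lfloor>slope_below t i * real (Suc (l1 (z N) - 1))\<rfloor> \<le> fst (z N)" using L by simp linarith
        show "fst (z N) \<le> int (l1 (z N) - 1)" using L elim by simp
      qed
      then show ?case using elim corner_ratio_eq_ratio[of "z N" \<omega>]
        by (auto intro: less_le_trans ennreal_leI)
    qed
  qed
qed

lemma corner_le_limsup_ratio:
  assumes el: "elliptic \<omega>" and z: "to_infinity_in_direction z (t, 1 - t)" and t: "0 < t" "t < 1"
  shows "limsup (\<lambda>N. ennreal (corner_ratio \<omega> 0 (z N))) \<le> upper_ratio t \<omega>"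
  unfolding upper_ratio_def
proof (rule INF_greatest)
  fix i
  note b = slope_above_bounds[OF t, of i]
  have n: "filterlim (\<lambda>N. l1 (z N) - 1) at_top sequentially"
    by (rule filterlim_compose[OF filterlim_minus_const_nat_at_top to_infinityD(1)[OF z t]])
  show "limsup (\<lambda>N. ennreal (corner_ratio \<omega> 0 (z N))) \<le> limsup_ratio (slope_above t i) \<omega>"
    unfolding Limsup_le_iff
  proof (intro allI impI)
    fix y assume "y > limsup_ratio (slope_above t i) \<omega>"
    then have "eventually (\<lambda>n. y > ennreal (ratio \<omega> n \<lfloor>slope_above t i * real (Suc n)\<rfloor>)) sequentially"
      unfolding limsup_ratio_def by (rule Limsup_lessD)
    then have "eventually (\<lambda>N. y > ennreal (ratio \<omega> (l1 (z N) - 1) \<lfloor>slope_above t i * real (Suc (l1 (z N) - 1))\<rfloor>)) sequentially"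
      using n by (rule eventually_compose_filterlim)
    moreover have "eventually (\<lambda>N. real_of_int (fst (z N)) / real (l1 (z N)) < slope_above t i) sequentially"
      using order_tendstoD(2)[OF to_infinityD(2)[OF z t] b(2)] .
    ultimately show "eventually (\<lambda>N. y > ennreal (corner_ratio \<omega> 0 (z N))) sequentially"
      using to_infinity_ge[OF z t, of 1]
    proof eventually_elim
      case (elim N)
      have L: "int (l1 (z N)) = fst (z N) + snd (z N)" "0 < l1 (z N)" using elim by (auto simp: l1_def)
      have "ratio \<omega> (l1 (z N) - 1) (fst (z N)) \<le> ratio \<omega> (l1 (z N) - 1) \<lfloor>slope_above t i * real (Suc (l1 (z N) - 1))\<rfloor>"
      proof (rule ratio_mono[OF el])
        show "0 \<le> fst (z N)" using elim by simp
        show "\<lfloor>slope_above t i * real (Suc (l1 (z N) - 1))\<rfloor> \<le> int (l1 (z N) - 1)" using b by (intro floor_level) auto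
        have "real_of_int (fst (z N)) \<le> slope_above t i * real (l1 (z N))"
          using elim(2) L by (simp add: divide_less_eq)
        then show "fst (z N) \<le> \<lfloor>slope_above t i * real (Suc (l1 (z N) - 1))\<rfloor>" using L by (simp add: le_floor_iff)
      qed
      then show ?case using elim corner_ratio_eq_ratio[of "z N" \<omega>]
        by (auto intro: le_less_trans ennreal_leI)
    qed
  qed
qed

lemma corner_ratio_nonneg: "elliptic \<omega> \<Longrightarrow> 0 \<le> corner_ratio \<omega> x z"
  by (simp add: corner_ratio_def visit_prob_nonneg)

lemma tendsto_of_liminf_limsup:
  fixes f :: "nat \<Rightarrow> real"
  assumes "\<And>n. 0 \<le> f n" "0 \<le> r" "ennreal r \<le> liminf (\<lambda>n. ennreal (f n))" "limsup (\<lambda>n. ennreal (f n)) \<le> ennreal r"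
  shows "f \<longlonglongrightarrow> r"
proof -
  have "liminf (\<lambda>n. ennreal (f n)) \<le> limsup (\<lambda>n. ennreal (f n))"
    by (rule Liminf_le_Limsup) simp
  then have "(\<lambda>n. ennreal (f n)) \<longlonglongrightarrow> ennreal r"
    using assms(3,4) by (intro Liminf_eq_Limsup) auto
  then show ?thesis using assms(1,2) by (simp add: tendsto_ennreal_iff)
qed

section \<open>Reflection and translation of the environment\<close>

definition reflect :: "(site \<Rightarrow> real) \<Rightarrow> site \<Rightarrow> real" where
  "reflect \<omega> x = 1 - \<omega> (prod.swap x)"

text \<open>Reflection in the diagonal exchanges e1 with e2, so k horizontal steps become n - k. An
  environment stores the probability of the step e1, hence the complement in
  \<open>reflect\<close>.\<close>

lemma lev_reflect: "lev (reflect \<omega>) (prod.swap y) n (int n - k) = lev \<omega> y n k"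
proof (induction n arbitrary: k)
  case (Suc n)
  have 1: "lev (reflect \<omega>) (prod.swap y) n (int (Suc n) - k - 1) = lev \<omega> y n k"
    using Suc[of k] by simp
  have 2: "lev (reflect \<omega>) (prod.swap y) n (int (Suc n) - k) = lev \<omega> y n (k - 1)"
    using Suc[of "k - 1"] by (simp add: algebra_simps)
  have 3: "reflect \<omega> (prod.swap y + (int (Suc n) - k - 1, int n - (int (Suc n) - k - 1))) = 1 - \<omega> (y + (k, int n - k))"
    "reflect \<omega> (prod.swap y + (int (Suc n) - k, int n - (int (Suc n) - k))) = 1 - \<omega> (y + (k - 1, int n - (k - 1)))"
    by (auto simp: reflect_def prod.swap_def algebra_simps intro!: arg_cong[of _ _ \<omega>] prod_eqI)
  show ?case unfolding lev.simps 1 2 3 by simp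
qed simp

lemma visit_prob_reflect: "visit_prob (reflect \<omega>) (prod.swap y) (prod.swap z) = visit_prob \<omega> y z"
proof -
  have "lev (reflect \<omega>) (prod.swap y) (nat (fst z + snd z - fst y - snd y)) (snd z - snd y) =
    lev \<omega> y (nat (fst z + snd z - fst y - snd y)) (fst z - fst y)" if "fst z + snd z \<ge> fst y + snd y"
    using lev_reflect[of \<omega> y "nat (fst z + snd z - fst y - snd y)" "fst z - fst y"] that
    by (simp add: algebra_simps)
  then show ?thesis by (simp add: visit_prob_def add.commute diff_diff_eq)
qed

lemma corner_ratio_reflect: "corner_ratio (reflect \<omega>) 0 (prod.swap z) = inverse (corner_ratio \<omega> 0 z)"
  using visit_prob_reflect[of \<omega> e1 z] visit_prob_reflect[of \<omega> e2 z]
  by (simp add: corner_ratio_def e1_def e2_def)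

lemma lev_shift: "lev (\<lambda>y. \<omega> (x + y)) y n k = lev \<omega> (x + y) n k"
  by (induction n arbitrary: k) (simp_all add: add.assoc)

lemma visit_prob_shift: "visit_prob (\<lambda>y. \<omega> (x + y)) y z = visit_prob \<omega> (x + y) (x + z)"
proof -
  have "fst (x + z) + snd (x + z) - fst (x + y) - snd (x + y) = fst z + snd z - fst y - snd y"
    "fst (x + z) + snd (x + z) < fst (x + y) + snd (x + y) \<longleftrightarrow> fst z + snd z < fst y + snd y"
    "fst (x + z) - fst (x + y) = fst z - fst y"
    by auto
  then show ?thesis unfolding visit_prob_def by (simp only: lev_shift)
qed

lemma corner_ratio_shift: "corner_ratio (\<lambda>y. \<omega> (x + y)) 0 z = corner_ratio \<omega> x (x + z)"
  by (simp add: corner_ratio_def visit_prob_shift)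

lemma distr_beta_law_reflect:
  assumes "p > 0" "q > 0"
  shows "distr (beta_law p q) borel (\<lambda>t. 1 - t) = beta_law q p"
proof (rule measure_eqI)
  fix S assume "S \<in> sets (distr (beta_law p q) borel (\<lambda>t. 1 - t))"
  then have [measurable]: "S \<in> sets borel" by simp
  have m: "(\<lambda>t. 1 - t) \<in> borel_measurable (beta_law p q)"
    by (simp add: measurable_cong_sets[OF sets_beta_law refl])
  have "emeasure (distr (beta_law p q) borel (\<lambda>t. 1 - t)) S = (\<integral>\<^sup>+t. indicator S t \<partial>distr (beta_law p q) borel (\<lambda>t. 1 - t))"
    by simp
  also have "\<dots> = (\<integral>\<^sup>+t. indicator S (1 - t) \<partial>beta_law p q)" by (subst nn_integral_distr[OF m]) auto
  also have "\<dots> = (\<integral>\<^sup>+t. ennreal (indicator {0<..<1} t * (t powr (p - 1) * (1 - t) powr (q - 1) / Beta p q)) * indicator S (1 - t) \<partial>lborel)"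
    by (rule nn_integral_beta_law) measurable
  also have "\<dots> = (\<integral>\<^sup>+t. ennreal (indicator {0<..<1} t * (t powr (q - 1) * (1 - t) powr (p - 1) / Beta q p)) * indicator S t \<partial>lborel)"
    by (subst nn_integral_real_affine[where c = "-1" and t = 1])
       (auto intro!: nn_integral_cong simp: Beta_commute mult.commute split: split_indicator)
  also have "\<dots> = (\<integral>\<^sup>+t. indicator S t \<partial>beta_law q p)"
    by (rule nn_integral_beta_law[symmetric]) measurable
  finally show "emeasure (distr (beta_law p q) borel (\<lambda>t. 1 - t)) S = emeasure (beta_law q p) S" by simp
qed simp

section \<open>Almost sure existence of corner limits\<close>

context beta_parameters
begin

lemma swapped: "beta_parameters \<beta> \<alpha>"
  using ab by unfold_locales auto

text \<open>It turns what one parameter shows about its array into a statement on the environment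
  alone, where results from different parameters can be combined.\<close>

lemma AE_env_transfer:
  assumes "l > 0" "AE X in array_law l. P (env X)" and [measurable]: "Measurable.pred env_law P"
  shows "AE \<omega> in env_law. P \<omega>"
proof -
  have "env \<in> measurable (array_law l) env_law" by measurable
  then show ?thesis using assms by (subst distr_env[OF assms(1), symmetric], subst AE_distr_iff) auto
qed

lemma lower_ratio_env:
  assumes l: "l > 0" and t: "0 < t" "t < 1" "velocity l < t"
  shows "AE X in array_law l. ennreal (X (A 0) * X (B 0)) \<le> lower_ratio t (env X)"
proof -
  have "eventually (\<lambda>i. velocity l < slope_below t i) sequentially"
    by (rule order_tendstoD(1)[OF slope_below_LIMSEQ t(3)])
  then obtain i where i: "velocity l < slope_below t i" by (auto simp: eventually_sequentially)
  from liminf_ratio_ge[OF l _ _ i] slope_below_bounds[OF t(1,2)]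
  have "AE X in array_law l. ennreal (X (A 0) * X (B 0)) \<le> liminf_ratio (slope_below t i) (env X)"
    by (simp add: liminf_ratio_def)
  then show ?thesis
    by eventually_elim (auto simp: lower_ratio_def intro: order_trans[OF _ SUP_upper])
qed

lemma upper_ratio_env:
  assumes l: "l > 0" and t: "0 < t" "t < 1" "t < velocity l"
  shows "AE X in array_law l. upper_ratio t (env X) \<le> ennreal (X (A 0) * X (B 0))"
proof -
  have "eventually (\<lambda>i. slope_above t i < velocity l) sequentially"
    by (rule order_tendstoD(2)[OF slope_above_LIMSEQ t(3)])
  then obtain i where i: "slope_above t i < velocity l" by (auto simp: eventually_sequentially)
  from limsup_ratio_le[OF l _ _ i] slope_above_bounds[OF t(1,2)]
  have "AE X in array_law l. limsup_ratio (slope_above t i) (env X) \<le> ennreal (X (A 0) * X (B 0))"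
    by (simp add: limsup_ratio_def)
  then show ?thesis
    by eventually_elim (auto simp: upper_ratio_def intro: order_trans[OF INF_lower])
qed

lemma nn_integral_env:
  assumes "l > 0" and [measurable]: "f \<in> borel_measurable env_law"
  shows "(\<integral>\<^sup>+X. f (env X) \<partial>array_law l) = (\<integral>\<^sup>+\<omega>. f \<omega> \<partial>env_law)"
  by (subst distr_env[OF assms(1), symmetric], subst nn_integral_distr) auto

lemma AE_corner_limit_left:
  assumes t: "0 < t" "t < \<alpha> / (\<alpha> + \<beta>)"
  shows "AE \<omega> in env_law. \<exists>r>0. has_corner_limit \<omega> 0 (t, 1 - t) r"
proof -
  have t1: "t < 1" using t ab by (smt (verit) divide_less_eq_1_pos)
  obtain l0 where l0: "l0 > 0" "velocity l0 = t" using exists_velocity_eq[OF t] by blast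
  let ?f = "\<lambda>l. l / (l + \<alpha> + \<beta>)"
  have cont: "isCont ?f l0" using l0 ab by (intro continuous_intros) auto
  have lower: "ennreal (?f l) \<le> (\<integral>\<^sup>+\<omega>. lower_ratio t \<omega> \<partial>env_law)" if "0 < l" "l < l0" for l
  proof -
    have "ennreal (?f l) = (\<integral>\<^sup>+X. ennreal (X (A 0) * X (B 0)) \<partial>array_law l)"
      using nn_integral_corner[OF that(1)] by simp
    also have "\<dots> \<le> (\<integral>\<^sup>+X. lower_ratio t (env X) \<partial>array_law l)"
      using velocity_strict_mono[OF that] l0 by (intro nn_integral_mono_AE lower_ratio_env that t t1) simp
    also have "\<dots> = (\<integral>\<^sup>+\<omega>. lower_ratio t \<omega> \<partial>env_law)"
      by (rule nn_integral_env[OF that(1)]) measurable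
    finally show ?thesis .
  qed
  have upper: "(\<integral>\<^sup>+\<omega>. upper_ratio t \<omega> \<partial>env_law) \<le> ennreal (?f l)" if "l0 < l" for l
  proof -
    have l: "l > 0" using that l0 by simp
    have "(\<integral>\<^sup>+\<omega>. upper_ratio t \<omega> \<partial>env_law) = (\<integral>\<^sup>+X. upper_ratio t (env X) \<partial>array_law l)"
      by (rule nn_integral_env[OF l, symmetric]) measurable
    also have "\<dots> \<le> (\<integral>\<^sup>+X. ennreal (X (A 0) * X (B 0)) \<partial>array_law l)"
      using velocity_strict_mono[OF l0(1) that] l0 by (intro nn_integral_mono_AE upper_ratio_env l t t1) simp
    also have "\<dots> = ennreal (?f l)" using nn_integral_corner[OF l] by simp
    finally show ?thesis .
  qed
  \<comment> \<open>The ratio bounds demand a velocity different from t, so the value at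
    \<open>l0\<close> is obtained only as a one-sided limit, from the left here and from the right
    for the upper ratio.\<close>
  have "ennreal (?f l0) \<le> (\<integral>\<^sup>+\<omega>. lower_ratio t \<omega> \<partial>env_law)"
  proof (rule tendsto_upperbound)
    show "((\<lambda>l. ennreal (?f l)) \<longlongrightarrow> ennreal (?f l0)) (at_left l0)"
      using cont by (intro tendsto_ennrealI) (auto simp: isCont_def filterlim_at_split)
    have "eventually (\<lambda>l. 0 < l \<and> l < l0) (at_left l0)"
      using l0 unfolding eventually_at_left_field by (intro exI[of _ 0]) auto
    then show "eventually (\<lambda>l. ennreal (?f l) \<le> (\<integral>\<^sup>+\<omega>. lower_ratio t \<omega> \<partial>env_law)) (at_left l0)"
      by eventually_elim (use lower in auto)
  qed simp
  moreover have up: "(\<integral>\<^sup>+\<omega>. upper_ratio t \<omega> \<partial>env_law) \<le> ennreal (?f l0)"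
  proof (rule tendsto_lowerbound)
    show "((\<lambda>l. ennreal (?f l)) \<longlongrightarrow> ennreal (?f l0)) (at_right l0)"
      using cont by (intro tendsto_ennrealI) (auto simp: isCont_def filterlim_at_split)
    show "eventually (\<lambda>l. (\<integral>\<^sup>+\<omega>. upper_ratio t \<omega> \<partial>env_law) \<le> ennreal (?f l)) (at_right l0)"
      using eventually_at_right_less[of l0] by eventually_elim (use upper in auto)
  qed simp
  ultimately have le: "(\<integral>\<^sup>+\<omega>. upper_ratio t \<omega> \<partial>env_law) \<le> (\<integral>\<^sup>+\<omega>. lower_ratio t \<omega> \<partial>env_law)" by simp
  have "AE \<omega> in env_law. lower_ratio t \<omega> \<le> upper_ratio t \<omega>"
    using AE_elliptic by eventually_elim (intro lower_le_upper_ratio t t1)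
  then have eq: "AE \<omega> in env_law. lower_ratio t \<omega> = upper_ratio t \<omega>"
    using le up by (intro AE_eq_of_nn_integral_le) (auto intro: le_less_trans)
  have fin: "AE \<omega> in env_law. upper_ratio t \<omega> \<noteq> \<infinity>"
    using up by (intro nn_integral_noteq_infinite) (auto simp: top_unique)
  \<comment> \<open>Positivity of the limit, without which it has no logarithm: any parameter with
    velocity below t bounds the lower ratio by a positive variable.\<close>
  obtain l where l: "l > 0" "velocity l < t" using exists_velocity_less[of t] t t1 by auto
  have "AE \<omega> in env_law. 0 < lower_ratio t \<omega>"
  proof (rule AE_env_transfer[OF l(1)])
    show "AE X in array_law l. 0 < lower_ratio t (env X)"
      using lower_ratio_env[OF l(1) t(1) t1 l(2)] AE_unit_array[OF l(1)]
    proof eventually_elim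
      case (elim X)
      have "0 < ennreal (X (A 0) * X (B 0))" using elim(2) by (auto simp: unit_array_def)
      then show ?case using elim(1) by (rule less_le_trans)
    qed
  qed measurable
  with eq fin AE_elliptic show ?thesis
  proof eventually_elim
    case (elim \<omega>)
    then obtain r where r: "upper_ratio t \<omega> = ennreal r" "r > 0"
      by (cases "upper_ratio t \<omega>") (auto simp: ennreal_less_zero_iff)
    have el: "elliptic \<omega>" and lu: "lower_ratio t \<omega> = ennreal r" using elim r by auto
    have "has_corner_limit \<omega> 0 (t, 1 - t) r"
      unfolding has_corner_limit_def
    proof (intro allI impI)
      fix z assume z: "to_infinity_in_direction z (t, 1 - t)"
      show "(\<lambda>N. corner_ratio \<omega> 0 (z N)) \<longlonglongrightarrow> r"
        using liminf_ratio_le_corner[OF el z t(1) t1] corner_le_limsup_ratio[OF el z t(1) t1] r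
        unfolding lu by (intro tendsto_of_liminf_limsup corner_ratio_nonneg el) auto
    qed
    with r show ?case by blast
  qed
qed

text \<open>Here every l > 0 has velocity below t, so the lower ratio dominates variables whose
  means tend to 1 as l grows. Truncating at 1 turns a mean of at least 1 into almost sure
  equality.\<close>

lemma AE_corner_ge_1:
  assumes t: "\<alpha> / (\<alpha> + \<beta>) \<le> t" "t < 1"
  shows "AE \<omega> in env_law. elliptic \<omega> \<and> (\<forall>z. to_infinity_in_direction z (t, 1 - t) \<longrightarrow>
     1 \<le> liminf (\<lambda>N. ennreal (corner_ratio \<omega> 0 (z N))))"
proof -
  interpret E: prob_space env_law by (rule prob_space_env_law)
  have t0: "0 < t" using t ab by (smt (verit) divide_pos_pos)
  let ?f = "\<lambda>l. l / (l + \<alpha> + \<beta>)"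
  have lower: "ennreal (?f l) \<le> (\<integral>\<^sup>+\<omega>. min 1 (lower_ratio t \<omega>) \<partial>env_law)" if l: "0 < l" for l
  proof -
    have "ennreal (?f l) = (\<integral>\<^sup>+X. ennreal (X (A 0) * X (B 0)) \<partial>array_law l)"
      using nn_integral_corner[OF that(1)] by simp
    also have "\<dots> \<le> (\<integral>\<^sup>+X. min 1 (lower_ratio t (env X)) \<partial>array_law l)"
    proof (rule nn_integral_mono_AE)
      have v: "velocity l < t" using velocity_bounds(2)[OF l] t by simp
      show "AE X in array_law l. ennreal (X (A 0) * X (B 0)) \<le> min 1 (lower_ratio t (env X))"
        using lower_ratio_env[OF l t0 t(2) v] AE_unit_array[OF l]
      proof eventually_elim
        case (elim X)
        have "X (A 0) * X (B 0) \<le> 1"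
          using elim(2) by (intro mult_le_one) (auto simp: unit_array_def less_imp_le)
        then show ?case using elim(1) by simp
      qed
    qed
    also have "\<dots> = (\<integral>\<^sup>+\<omega>. min 1 (lower_ratio t \<omega>) \<partial>env_law)"
      by (rule nn_integral_env[OF that(1)]) measurable
    finally show ?thesis .
  qed
  have "ennreal 1 \<le> (\<integral>\<^sup>+\<omega>. min 1 (lower_ratio t \<omega>) \<partial>env_law)"
  proof (rule tendsto_upperbound)
    have "(?f \<longlongrightarrow> 1) at_top" by real_asymp
    then show "((\<lambda>l. ennreal (?f l)) \<longlongrightarrow> ennreal 1) at_top" by (rule tendsto_ennrealI)
    show "eventually (\<lambda>l. ennreal (?f l) \<le> (\<integral>\<^sup>+\<omega>. min 1 (lower_ratio t \<omega>) \<partial>env_law)) at_top"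
      using eventually_gt_at_top[of 0] by eventually_elim (use lower in auto)
  qed simp
  then have "AE \<omega> in env_law. min 1 (lower_ratio t \<omega>) = 1"
    by (intro AE_eq_of_nn_integral_le) (auto simp: E.emeasure_space_1)
  then show ?thesis using AE_elliptic
  proof eventually_elim
    case (elim \<omega>)
    then have "1 \<le> lower_ratio t \<omega>" by (metis min.cobounded2)
    then show ?case using liminf_ratio_le_corner[OF elim(2) _ t0 t(2)] elim(2) by (auto intro: order_trans)
  qed
qed

lemma distr_reflect:
  "distr env_law (PiM UNIV (\<lambda>_. borel)) reflect = beta_parameters.env_law \<beta> \<alpha>"
proof -
  interpret sw: beta_parameters \<beta> \<alpha> by (rule swapped)
  have "distr (PiM UNIV (\<lambda>_ :: site. beta_law \<alpha> \<beta>)) (PiM UNIV (\<lambda>_. borel)) (\<lambda>X j. 1 - X (prod.swap j)) =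
    PiM UNIV (\<lambda>j. distr (beta_law \<alpha> \<beta>) borel (\<lambda>t. 1 - t))"
    using ab by (intro distr_PiM_map[of "\<lambda>_. beta_law \<alpha> \<beta>" prod.swap "\<lambda>_ t. 1 - t"] prob_space_beta_law)
      (auto simp: measurable_cong_sets[OF sets_beta_law refl])
  then show ?thesis
    using ab by (simp add: env_law_def sw.env_law_def reflect_def[abs_def] distr_beta_law_reflect)
qed

lemma AE_reflect:
  assumes "AE \<omega> in beta_parameters.env_law \<beta> \<alpha>. P \<omega>"
  shows "AE \<omega> in env_law. P (reflect \<omega>)"
proof -
  have "reflect \<in> measurable (PiM UNIV (\<lambda>_. borel)) (PiM UNIV (\<lambda>_. borel))"
    by (rule measurable_PiM_single') (auto simp: reflect_def)
  then have m: "reflect \<in> measurable env_law (PiM UNIV (\<lambda>_. borel))" by measurable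
  have "AE \<omega> in distr env_law (PiM UNIV (\<lambda>_. borel)) reflect. P \<omega>"
    unfolding distr_reflect by (rule assms)
  then show ?thesis by (rule AE_distrD[OF m])
qed

lemma AE_corner_limit:
  assumes t: "0 < t" "t < 1"
  shows "AE \<omega> in env_law. \<exists>r>0. has_corner_limit \<omega> 0 (t, 1 - t) r"
proof -
  interpret sw: beta_parameters \<beta> \<alpha> by (rule swapped)
  have d: "1 - \<alpha> / (\<alpha> + \<beta>) = \<beta> / (\<beta> + \<alpha>)" using ab by (simp add: field_simps)
  consider "t < \<alpha> / (\<alpha> + \<beta>)" | "\<alpha> / (\<alpha> + \<beta>) < t" | "t = \<alpha> / (\<alpha> + \<beta>)" by linarith
  then show ?thesis
  proof cases
    case 1
    then show ?thesis using t by (intro AE_corner_limit_left)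
  next
    case 2
    then have "1 - t < \<beta> / (\<beta> + \<alpha>)" using d by simp
    then have "AE \<omega> in sw.env_law. \<exists>r>0. has_corner_limit \<omega> 0 (1 - t, 1 - (1 - t)) r"
      using t by (intro sw.AE_corner_limit_left) auto
    from AE_reflect[OF this] show ?thesis
    proof eventually_elim
      case (elim \<omega>)
      then obtain r where r: "r > 0" "has_corner_limit (reflect \<omega>) 0 (1 - t, 1 - (1 - t)) r" by blast
      have "has_corner_limit \<omega> 0 (t, 1 - t) (inverse r)"
        unfolding has_corner_limit_def
      proof (intro allI impI)
        fix z assume z: "to_infinity_in_direction z (t, 1 - t)"
        have "(\<lambda>N. corner_ratio (reflect \<omega>) 0 (prod.swap (z N))) \<longlonglongrightarrow> r"
          using r(2) to_infinity_swap[OF z] unfolding has_corner_limit_def by blast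
        then have "(\<lambda>N. inverse (inverse (corner_ratio \<omega> 0 (z N)))) \<longlonglongrightarrow> inverse r"
          unfolding corner_ratio_reflect using r by (intro tendsto_inverse) auto
        then show "(\<lambda>N. corner_ratio \<omega> 0 (z N)) \<longlonglongrightarrow> inverse r" by simp
      qed
      with r show ?case by (intro exI[of _ "inverse r"]) auto
    qed
  next
    case 3
    have "\<beta> / (\<beta> + \<alpha>) \<le> 1 - t" using 3 d by simp
    then have "AE \<omega> in sw.env_law. elliptic \<omega> \<and> (\<forall>z. to_infinity_in_direction z (1 - t, 1 - (1 - t)) \<longrightarrow>
     1 \<le> liminf (\<lambda>N. ennreal (corner_ratio \<omega> 0 (z N))))"
      using t by (intro sw.AE_corner_ge_1) auto
    from AE_reflect[OF this] AE_corner_ge_1[OF eq_refl[OF 3[symmetric]] t(2)] show ?thesis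
    proof eventually_elim
      case (elim \<omega>)
      have "has_corner_limit \<omega> 0 (t, 1 - t) 1"
        unfolding has_corner_limit_def
      proof (intro allI impI)
        fix z assume z: "to_infinity_in_direction z (t, 1 - t)"
        have a: "1 \<le> liminf (\<lambda>N. ennreal (corner_ratio \<omega> 0 (z N)))" using elim(2) z by blast
        have b: "1 \<le> liminf (\<lambda>N. ennreal (inverse (corner_ratio \<omega> 0 (z N))))"
          using elim(1) to_infinity_swap[OF z] unfolding corner_ratio_reflect[symmetric] by blast
        show "(\<lambda>N. corner_ratio \<omega> 0 (z N)) \<longlonglongrightarrow> 1"
        proof (rule order_tendstoI)
          fix c :: real assume c: "c < 1"
          show "eventually (\<lambda>N. c < corner_ratio \<omega> 0 (z N)) sequentially"
          proof (cases "c < 0")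
            case True
            moreover have "0 \<le> corner_ratio \<omega> 0 (z N)" for N
              using elim(2) by (intro corner_ratio_nonneg) simp
            ultimately show ?thesis by (intro always_eventually allI) (rule less_le_trans)
          next
            case False
            then have "ennreal c < liminf (\<lambda>N. ennreal (corner_ratio \<omega> 0 (z N)))"
              using c by (intro less_le_trans[OF _ a]) (simp add: ennreal_less_one_iff)
            from less_LiminfD[OF this] show ?thesis
              by eventually_elim (use False in \<open>simp add: ennreal_less_iff\<close>)
          qed
        next
          fix c :: real assume c: "1 < c"
          then have "ennreal (1 / c) < liminf (\<lambda>N. ennreal (inverse (corner_ratio \<omega> 0 (z N))))"
            by (intro less_le_trans[OF _ b]) (simp add: ennreal_less_one_iff)
          from less_LiminfD[OF this] show "eventually (\<lambda>N. corner_ratio \<omega> 0 (z N) < c) sequentially"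
          proof eventually_elim
            case (elim N)
            then have "1 / c < inverse (corner_ratio \<omega> 0 (z N))"
              using c by (simp add: ennreal_less_iff)
            \<comment> \<open>Since \<open>inverse 0\<close> is 0, positivity of the ratio has to be
              secured before the inequality for its inverse can be inverted.\<close>
            moreover from this have "0 < inverse (corner_ratio \<omega> 0 (z N))" using c
              by (smt (verit) divide_pos_pos)
            then have "0 < corner_ratio \<omega> 0 (z N)" by simp
            ultimately show ?case using c by (simp add: field_simps)
          qed
        qed
      qed
      then show ?case by (intro exI[of _ 1]) simp
    qed
  qed
qed

text \<open>The law of the environment is translation invariant and there are countably many sites;
  the direction of a sequence is unaffected by the shift.\<close>

lemma AE_corner_limit_all:
  assumes t: "0 < t" "t < 1"
  shows "AE \<omega> in env_law. \<forall>x. \<exists>r>0. has_corner_limit \<omega> x (t, 1 - t) r"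
proof (subst AE_all_countable, intro allI)
  fix x :: site
  have "distr (PiM UNIV (\<lambda>_ :: site. beta_law \<alpha> \<beta>)) (PiM UNIV (\<lambda>_. beta_law \<alpha> \<beta>)) (\<lambda>X j. X (x + j)) =
    PiM UNIV (\<lambda>j. distr (beta_law \<alpha> \<beta>) (beta_law \<alpha> \<beta>) (\<lambda>t. t))"
    using ab by (intro distr_PiM_map[of "\<lambda>_. beta_law \<alpha> \<beta>" "(+) x" "\<lambda>_ t. t"] prob_space_beta_law)
      (auto simp: inj_on_def)
  then have d: "distr env_law env_law (\<lambda>\<omega> j. \<omega> (x + j)) = env_law"
    by (simp add: env_law_def distr_id)
  have m: "(\<lambda>\<omega> j. \<omega> (x + j)) \<in> measurable env_law env_law"
  proof -
    have "(\<lambda>\<omega> j. \<omega> (x + j)) \<in> measurable (PiM UNIV (\<lambda>_. borel)) (PiM UNIV (\<lambda>_. borel :: real measure))"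
      by (rule measurable_PiM_single') auto
    then show ?thesis by measurable
  qed
  have "AE \<omega> in distr env_law env_law (\<lambda>\<omega> j. \<omega> (x + j)). \<exists>r>0. has_corner_limit \<omega> 0 (t, 1 - t) r"
    using AE_corner_limit[OF t] by (simp only: d)
  from AE_distrD[OF m this]
  show "AE \<omega> in env_law. \<exists>r>0. has_corner_limit \<omega> x (t, 1 - t) r"
  proof eventually_elim
    case (elim \<omega>)
    then obtain r where r: "r > 0" "has_corner_limit (\<lambda>j. \<omega> (x + j)) 0 (t, 1 - t) r" by blast
    have "has_corner_limit \<omega> x (t, 1 - t) r"
      unfolding has_corner_limit_def
    proof (intro allI impI)
      fix z assume "to_infinity_in_direction z (t, 1 - t)"
      from to_infinity_shift[OF this t, of x] r(2)
      have "(\<lambda>N. corner_ratio (\<lambda>j. \<omega> (x + j)) 0 (z N - x)) \<longlonglongrightarrow> r"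
        unfolding has_corner_limit_def by blast
      then show "(\<lambda>N. corner_ratio \<omega> x (z N)) \<longlonglongrightarrow> r"
        by (simp add: corner_ratio_shift)
    qed
    with r show ?case by blast
  qed
qed

end

section \<open>Busemann increments and weak convergence\<close>

text \<open>The first-step equation expresses the visit probability from x through those from x + e1
  and x + e2; dividing it by the latter makes both step ratios continuous functions of the corner
  ratio.\<close>

lemma corner_limit_imp_step_ratio:
  assumes el: "elliptic \<omega>" and t: "0 < t" "t < 1" and r: "r > 0" and lim: "has_corner_limit \<omega> x (t, 1 - t) r"
    and z: "to_infinity_in_direction z (t, 1 - t)"
  shows "(\<lambda>N. visit_prob \<omega> (x + e1) (z N) / visit_prob \<omega> x (z N)) \<longlonglongrightarrow> r / (\<omega> x * r + (1 - \<omega> x))"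
    and "(\<lambda>N. visit_prob \<omega> (x + e2) (z N) / visit_prob \<omega> x (z N)) \<longlonglongrightarrow> 1 / (\<omega> x * r + (1 - \<omega> x))"
proof -
  note w = ellipticD[OF el, of x]
  have pos: "\<omega> x * r + (1 - \<omega> x) > 0" using w r by (auto intro!: add_pos_pos)
  have c: "(\<lambda>N. corner_ratio \<omega> x (z N)) \<longlonglongrightarrow> r" using lim z by (auto simp: has_corner_limit_def)
  have ev: "eventually (\<lambda>N. visit_prob \<omega> (x + e1) (z N) / visit_prob \<omega> x (z N) =
        corner_ratio \<omega> x (z N) / (\<omega> x * corner_ratio \<omega> x (z N) + (1 - \<omega> x)) \<and>
      visit_prob \<omega> (x + e2) (z N) / visit_prob \<omega> x (z N) =
        1 / (\<omega> x * corner_ratio \<omega> x (z N) + (1 - \<omega> x))) sequentially"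
    using to_infinity_ge[OF z t, of "\<bar>fst x\<bar> + \<bar>snd x\<bar> + 1"]
  proof eventually_elim
    case (elim N)
    define u v where "u = visit_prob \<omega> (x + e1) (z N)" and "v = visit_prob \<omega> (x + e2) (z N)"
    have uv: "u > 0" "v > 0"
      unfolding u_def v_def using elim by (auto intro!: visit_prob_pos el simp: e1_def e2_def)
    have h: "visit_prob \<omega> x (z N) = \<omega> x * u + (1 - \<omega> x) * v"
      using elim unfolding u_def v_def by (intro visit_prob_first_step) auto
    have "\<omega> x * u + (1 - \<omega> x) * v > 0" using uv w by (auto intro!: add_pos_pos)
    moreover have e: "\<omega> x * (u / v) + (1 - \<omega> x) = (\<omega> x * u + (1 - \<omega> x) * v) / v"
      using uv by (simp add: field_simps)
    ultimately show ?case
      unfolding h corner_ratio_def u_def[symmetric] v_def[symmetric] e using uv by simp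
  qed
  show "(\<lambda>N. visit_prob \<omega> (x + e1) (z N) / visit_prob \<omega> x (z N)) \<longlonglongrightarrow> r / (\<omega> x * r + (1 - \<omega> x))"
  proof (rule Lim_transform_eventually)
    show "(\<lambda>N. corner_ratio \<omega> x (z N) / (\<omega> x * corner_ratio \<omega> x (z N) + (1 - \<omega> x))) \<longlonglongrightarrow>
      r / (\<omega> x * r + (1 - \<omega> x))" using pos by (intro tendsto_intros c) auto
  qed (use ev in eventually_elim, simp)
  show "(\<lambda>N. visit_prob \<omega> (x + e2) (z N) / visit_prob \<omega> x (z N)) \<longlonglongrightarrow> 1 / (\<omega> x * r + (1 - \<omega> x))"
  proof (rule Lim_transform_eventually)
    show "(\<lambda>N. 1 / (\<omega> x * corner_ratio \<omega> x (z N) + (1 - \<omega> x))) \<longlonglongrightarrow>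
      1 / (\<omega> x * r + (1 - \<omega> x))" using pos by (intro tendsto_intros c) auto
  qed (use ev in eventually_elim, simp)
qed

text \<open>\<open>busemann\<close> is a definite description, so \<open>kappa\<close> is computed
  by exhibiting -ln q as a limit along all sequences. Far enough out, z dominates both x and y, and
  there \<open>hit_prob\<close> coincides with \<open>visit_prob\<close>.\<close>

lemma kappa_step_ratio:
  assumes el: "elliptic \<omega>" and t: "0 < t" "t < 1" and q: "q > 0"
    and lim: "\<And>z. to_infinity_in_direction z (t, 1 - t) \<Longrightarrow>
      (\<lambda>N. visit_prob \<omega> y (z N) / visit_prob \<omega> x (z N)) \<longlonglongrightarrow> q"
  shows "kappa (t, 1 - t) \<omega> x y = env_trans \<omega> x y * q"
proof -
  have "is_busemann_limit (t, 1 - t) \<omega> x y (- ln q)"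
    unfolding is_busemann_limit_def
  proof (intro allI impI)
    fix z assume z: "to_infinity_in_direction z (t, 1 - t)"
    have "(\<lambda>N. - ln (visit_prob \<omega> y (z N) / visit_prob \<omega> x (z N))) \<longlonglongrightarrow> - ln q"
      using q by (intro tendsto_intros lim z) auto
    then show "(\<lambda>N. ln (hit_prob \<omega> x (z N)) - ln (hit_prob \<omega> y (z N))) \<longlonglongrightarrow> - ln q"
    proof (rule Lim_transform_eventually)
      show "eventually (\<lambda>N. - ln (visit_prob \<omega> y (z N) / visit_prob \<omega> x (z N)) =
        ln (hit_prob \<omega> x (z N)) - ln (hit_prob \<omega> y (z N))) sequentially"
        using to_infinity_ge[OF z t, of "\<bar>fst x\<bar> + \<bar>snd x\<bar> + \<bar>fst y\<bar> + \<bar>snd y\<bar>"]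
      proof eventually_elim
        case (elim N)
        then have le: "fst x \<le> fst (z N)" "snd x \<le> snd (z N)" "fst y \<le> fst (z N)" "snd y \<le> snd (z N)"
          by auto
        then show ?case
          using visit_prob_pos[OF el le(1,2)] visit_prob_pos[OF el le(3,4)] by (simp add: hit_prob_eq el ln_div)
      qed
    qed
  qed
  moreover have "(t, 1 - t) \<in> riU" using t by (auto simp: riU_def rvec_def e1_def e2_def)
  ultimately have "busemann (t, 1 - t) \<omega> x y = - ln q" by (intro busemann_eqI)
  then show ?thesis using q by (simp add: kappa_def)
qed

lemma kappa_corner_limit:
  assumes el: "elliptic \<omega>" and t: "0 < t" "t < 1" and r: "r > 0" and lim: "has_corner_limit \<omega> x (t, 1 - t) r"
  shows "kappa (t, 1 - t) \<omega> x (x + e1) = \<omega> x * (r / (\<omega> x * r + (1 - \<omega> x)))"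
    and "kappa (t, 1 - t) \<omega> x (x + e2) = (1 - \<omega> x) * (1 / (\<omega> x * r + (1 - \<omega> x)))"
proof -
  have pos: "\<omega> x * r + (1 - \<omega> x) > 0"
    using ellipticD[OF el, of x] r by (auto intro!: add_pos_pos)
  have ne: "x + e1 \<noteq> x + e2" by (simp add: e1_def e2_def)
  show "kappa (t, 1 - t) \<omega> x (x + e1) = \<omega> x * (r / (\<omega> x * r + (1 - \<omega> x)))"
    using kappa_step_ratio[OF el t _ corner_limit_imp_step_ratio(1)[OF assms]] pos r by (simp add: env_trans_def)
  show "kappa (t, 1 - t) \<omega> x (x + e2) = (1 - \<omega> x) * (1 / (\<omega> x * r + (1 - \<omega> x)))"
    using kappa_step_ratio[OF el t _ corner_limit_imp_step_ratio(2)[OF assms]] pos ne by (simp add: env_trans_def)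
qed

lemma visit_ratio_tendsto_kappa:
  assumes el: "elliptic \<omega>" and t: "0 < t" "t < 1" and r: "r > 0" and lim: "has_corner_limit \<omega> x (t, 1 - t) r"
    and z: "to_infinity_in_direction z (t, 1 - t)"
  shows "(\<lambda>N. env_trans \<omega> x y * visit_prob \<omega> y (z N) / visit_prob \<omega> x (z N)) \<longlonglongrightarrow> kappa (t, 1 - t) \<omega> x y"
proof -
  have ne: "x + e1 \<noteq> x + e2" by (simp add: e1_def e2_def)
  note l = corner_limit_imp_step_ratio[OF assms, THEN tendsto_mult_left] and k = kappa_corner_limit[OF assms(1-5)]
  consider "y = x + e1" | "y = x + e2" | "y \<noteq> x + e1" "y \<noteq> x + e2" by blast
  then show ?thesis
  proof cases
    case 1
    then show ?thesis using l(1)[of "\<omega> x"] unfolding 1 k by (simp add: env_trans_def)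
  next
    case 2
    then show ?thesis using l(2)[of "1 - \<omega> x"] ne unfolding 2 k by (simp add: env_trans_def)
  next
    case 3
    \<comment> \<open>Both sides are 0 through the factor \<open>env_trans \<omega> x y\<close>,
      whatever \<open>busemann\<close> returns.\<close>
    then show ?thesis by (simp add: env_trans_def kappa_def)
  qed
qed

lemma nn_trans_kappa_elliptic:
  assumes el: "elliptic \<omega>" and t: "0 < t" "t < 1" and lim: "\<And>x. \<exists>r>0. has_corner_limit \<omega> x (t, 1 - t) r"
  shows "nn_trans (kappa (t, 1 - t) \<omega>)"
proof (rule nn_trans_kappa)
  show "\<omega> \<in> space (env_measure \<alpha> \<beta>)" for \<alpha> \<beta>
    using ellipticD[OF el] by (auto simp: space_env_measure less_imp_le simp del: split_paired_All)
  fix x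
  obtain r where r: "r > 0" "has_corner_limit \<omega> x (t, 1 - t) r" using lim by blast
  have "\<omega> x * r + (1 - \<omega> x) > 0"
    using ellipticD[OF el, of x] r by (auto intro!: add_pos_pos)
  then show "kappa (t, 1 - t) \<omega> x (x + e1) + kappa (t, 1 - t) \<omega> x (x + e2) = 1"
    unfolding kappa_corner_limit[OF el t r] by (simp add: add_divide_distrib[symmetric])
qed

text \<open>Conditioning on the endpoint z is the Doob transform by the function sending y to
  \<open>visit_prob \<omega> y z\<close>; the quotients of this function telescope along the
  prefix.\<close>

lemma cond_path_law_prefix:
  assumes el: "elliptic \<omega>" and pos: "visit_prob \<omega> 0 z > 0" and z: "fst z + snd z = int N" and nN: "n \<le> N"
    and step: "\<And>i. i < n \<Longrightarrow> visit_prob \<omega> (a i) z > 0"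
  shows "measure (cond_path_law (env_trans \<omega>) 0 N z) {X. \<forall>i\<le>n. X i = a i} =
    of_bool (a 0 = 0) * (\<Prod>i<n. env_trans \<omega> (a i) (a (Suc i)) * visit_prob \<omega> (a (Suc i)) z / visit_prob \<omega> (a i) z)"
proof -
  let ?P = "path_law (env_trans \<omega>) 0" and ?S = "{X :: nat \<Rightarrow> site. X N = z}" and ?C = "{X. \<forall>i\<le>n. X i = a i}"
  note nn = nn_trans_elliptic[OF el]
  interpret prob_space ?P by (rule prob_space_path_law[OF nn])
  have S: "measure ?P ?S = visit_prob \<omega> 0 z" using z by (simp add: measure_path_law_visit[OF el])
  \<comment> \<open>A prefix of nonzero weight climbs one level per step, so at time n it is at the
    level from which z is N - n steps away.\<close>
  have lvl: "fst (a k) + snd (a k) = int k" if "a 0 = 0" "k \<le> n" "\<And>i. i < n \<Longrightarrow> env_trans \<omega> (a i) (a (Suc i)) \<noteq> 0" for k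
    using that(2)
  proof (induction k)
    case (Suc k)
    then have "env_trans \<omega> (a k) (a (Suc k)) \<noteq> 0" using that(3)[of k] by simp
    then have "a (Suc k) = a k + e1 \<or> a (Suc k) = a k + e2" by (auto simp: env_trans_def split: if_splits)
    then show ?case using Suc by (auto simp: e1_def e2_def)
  qed (simp add: that)
  have V: "visit_prob \<omega> (a n) z / visit_prob \<omega> (a 0) z = (\<Prod>i<n. visit_prob \<omega> (a (Suc i)) z / visit_prob \<omega> (a i) z)"
    if "a 0 = 0"
    using step
  proof (induction n)
    case 0
    then show ?case using pos that by simp
  next
    case (Suc n)
    have IH: "(\<Prod>i<n. visit_prob \<omega> (a (Suc i)) z / visit_prob \<omega> (a i) z) = visit_prob \<omega> (a n) z / visit_prob \<omega> (a 0) z"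
      using Suc by simp
    show ?case unfolding prod.lessThan_Suc IH using Suc.prems[of n] by simp
  qed
  have "measure (cond_path_law (env_trans \<omega>) 0 N z) ?C = measure ?P (?S \<inter> ?C) / measure ?P ?S"
    unfolding cond_path_law_def using S pos prefix_measurable[OF nn]
    by (intro measure_uniform_measure) (auto simp: emeasure_eq_measure)
  also have "?S \<inter> ?C = {X. (\<forall>i\<le>n. X i = a i) \<and> X (n + (N - n)) = z}" using nN by auto
  also have "measure ?P \<dots> = of_bool (a 0 = 0) * (\<Prod>i<n. env_trans \<omega> (a i) (a (Suc i))) *
      (if fst z + snd z = fst (a n) + snd (a n) + int (N - n) then visit_prob \<omega> (a n) z else 0)"
    by (rule measure_path_law_prefix_visit[OF el])
  also have "\<dots> = of_bool (a 0 = 0) * (\<Prod>i<n. env_trans \<omega> (a i) (a (Suc i))) * visit_prob \<omega> (a n) z"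
  proof (cases "a 0 = 0 \<and> (\<forall>i<n. env_trans \<omega> (a i) (a (Suc i)) \<noteq> 0)")
    case True
    then show ?thesis using lvl[of n] z nN by (simp add: of_nat_diff)
  next
    case False
    then show ?thesis by (auto simp: prod_zero_iff)
  qed
  also have "\<dots> / measure ?P ?S = of_bool (a 0 = 0) *
      ((\<Prod>i<n. env_trans \<omega> (a i) (a (Suc i))) * (visit_prob \<omega> (a n) z / visit_prob \<omega> (a 0) z))"
    unfolding S by auto
  also have "\<dots> =
    of_bool (a 0 = 0) * (\<Prod>i<n. env_trans \<omega> (a i) (a (Suc i)) * (visit_prob \<omega> (a (Suc i)) z / visit_prob \<omega> (a i) z))"
  proof (cases "a 0 = 0")
    case True
    then show ?thesis unfolding prod.distrib V[OF True] by simp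
  qed simp
  finally show ?thesis by simp
qed

text \<open>On a countable product of countable discrete spaces, convergence of the cylinder probabilities
  suffices: replace \<open>f\<close> by its infimum over the cylinder of length \<open>n\<close> and apply Fatou's lemma
  to the law of the first \<open>n\<close> positions.\<close>

definition prefix :: "nat \<Rightarrow> (nat \<Rightarrow> 'a) \<Rightarrow> 'a list" where
  "prefix n X = map X [0..<n]"

lemma prefix_eq_iff: "prefix n X = prefix n Y \<longleftrightarrow> (\<forall>i<n. X i = Y i)"
  by (auto simp: prefix_def)

lemma prefix_vimage:
  "prefix (Suc n) -` {l} = (if length l = Suc n then {X. \<forall>i\<le>n. X i = l ! i} else {})"
proof -
  have "prefix (Suc n) X = l \<longleftrightarrow> length l = Suc n \<and> (\<forall>i\<le>n. X i = l ! i)" for X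
  proof
    assume "prefix (Suc n) X = l"
    then have l: "l = map X [0..<Suc n]" by (simp only: prefix_def)
    show "length l = Suc n \<and> (\<forall>i\<le>n. X i = l ! i)"
      unfolding l by (simp add: less_Suc_eq_le del: upt_Suc)
  next
    assume "length l = Suc n \<and> (\<forall>i\<le>n. X i = l ! i)"
    then show "prefix (Suc n) X = l"
      unfolding prefix_def by (intro nth_equalityI) (simp_all add: less_Suc_eq_le del: upt_Suc)
  qed
  then show ?thesis by auto
qed

lemma measurable_prefix:
  assumes M: "sets M = sets (borel :: (nat \<Rightarrow> site) measure)"
  shows "prefix (Suc n) \<in> measurable M (count_space UNIV)"
proof -
  have c: "{X :: nat \<Rightarrow> site. X i = y} \<in> sets borel" for i y
  proof -
    have "(\<lambda>X :: nat \<Rightarrow> site. X i) -` {y} \<inter> space borel \<in> sets borel"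
      by (intro measurable_sets[OF borel_measurable_continuous_onI]) auto
    then show ?thesis by (simp add: vimage_def)
  qed
  have "prefix (Suc n) -` {l} \<in> sets M" for l :: "site list"
  proof -
    have "{X :: nat \<Rightarrow> site. \<forall>i\<le>n. X i = l ! i} = (\<Inter>i\<in>{..n}. {X. X i = l ! i})" by auto
    also have "\<dots> \<in> sets M" unfolding M by (intro sets.countable_INT') (auto intro!: c)
    finally show ?thesis by (auto simp: prefix_vimage)
  qed
  then show ?thesis
    by (auto simp: measurable_count_space_eq_countable sets_eq_imp_space_eq[OF M])
qed

lemma nn_integral_prefix:
  assumes M: "sets M = sets (borel :: (nat \<Rightarrow> site) measure)"
  shows "(\<integral>\<^sup>+X. G (prefix (Suc n) X) \<partial>M) = (\<integral>\<^sup>+l. emeasure M (prefix (Suc n) -` {l}) * G l \<partial>count_space UNIV)"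
proof -
  note m = measurable_prefix[OF M, of n]
  let ?D = "distr M (count_space UNIV) (prefix (Suc n))"
  have "?D = density (count_space UNIV) (\<lambda>l. emeasure M (prefix (Suc n) -` {l}))"
  proof (rule measure_eqI_countable[of _ UNIV])
    fix l
    have "emeasure ?D {l} = emeasure M (prefix (Suc n) -` {l})"
      using m by (subst emeasure_distr) (auto simp: sets_eq_imp_space_eq[OF M])
    then show "emeasure ?D {l} = emeasure (density (count_space UNIV) (\<lambda>l. emeasure M (prefix (Suc n) -` {l}))) {l}"
      by (simp add: emeasure_density)
  qed auto
  then have "(\<integral>\<^sup>+l. G l \<partial>?D) = (\<integral>\<^sup>+l. emeasure M (prefix (Suc n) -` {l}) * G l \<partial>count_space UNIV)"
    by (simp add: nn_integral_density)
  then show ?thesis using m by (subst (asm) nn_integral_distr) auto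
qed

text \<open>A basic open set of the product topology constrains finitely many coordinates, so all of
  them lie below some n; on discrete factors fixing these coordinates stays inside.\<close>

lemma open_contains_cylinder:
  assumes "open U" "(X :: nat \<Rightarrow> site) \<in> U"
  shows "\<exists>n. \<forall>Y. (\<forall>i\<le>n. Y i = X i) \<longrightarrow> Y \<in> U"
proof -
  have "openin (product_topology (\<lambda>_. euclidean) UNIV) U"
    using assms(1) by (simp add: euclidean_product_topology)
  from product_topology_open_contains_basis[OF this assms(2)]
  obtain V where V: "X \<in> (\<Pi>\<^sub>E i\<in>UNIV. V i)" "finite {i. V i \<noteq> UNIV}" "(\<Pi>\<^sub>E i\<in>UNIV. V i) \<subseteq> U"
    by auto
  obtain n where n: "\<And>i. V i \<noteq> UNIV \<Longrightarrow> i \<le> n"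
    using V(2) by (metis (mono_tags, lifting) finite_nat_set_iff_bounded_le mem_Collect_eq)
  have "Y \<in> U" if Y: "\<forall>i\<le>n. Y i = X i" for Y
  proof -
    have "Y i \<in> V i" for i
    proof (cases "V i = UNIV")
      case False
      then have "Y i = X i" using n Y by blast
      then show ?thesis using V(1) by (auto simp: PiE_iff)
    qed auto
    then show ?thesis using V(3) by (auto simp: PiE_iff)
  qed
  then show ?thesis by blast
qed

lemma nn_integral_le_liminf_of_cylinders:
  fixes M :: "nat \<Rightarrow> (nat \<Rightarrow> site) measure" and f :: "(nat \<Rightarrow> site) \<Rightarrow> real"
  assumes M: "\<And>N. sets (M N) = sets borel" and \<mu>: "sets \<mu> = sets borel"
    and fin: "eventually (\<lambda>N. finite_measure (M N)) sequentially" "finite_measure \<mu>"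
    and conv: "\<And>n a. (\<lambda>N. measure (M N) {X. \<forall>i\<le>n. X i = a i}) \<longlonglongrightarrow> measure \<mu> {X. \<forall>i\<le>n. X i = a i}"
    and f: "continuous_on UNIV f" "\<And>X. 0 \<le> f X"
  shows "(\<integral>\<^sup>+X. ennreal (f X) \<partial>\<mu>) \<le> liminf (\<lambda>N. \<integral>\<^sup>+X. ennreal (f X) \<partial>M N)"
proof -
  define G where "G n l = (INF Y\<in>{Y. prefix (Suc n) Y = l}. ennreal (f Y))" for n l
  have G_le: "G n (prefix (Suc n) X) \<le> ennreal (f X)" for n X
    unfolding G_def by (rule INF_lower) simp
  have G_inc: "incseq (\<lambda>n X. G n (prefix (Suc n) X))"
    unfolding incseq_Suc_iff le_fun_def G_def
    by (intro allI INF_superset_mono) (auto simp: prefix_eq_iff)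
  have G_sup: "(SUP n. G n (prefix (Suc n) X)) = ennreal (f X)" for X
  proof (rule antisym)
    show "(SUP n. G n (prefix (Suc n) X)) \<le> ennreal (f X)" by (intro SUP_least G_le)
    show "ennreal (f X) \<le> (SUP n. G n (prefix (Suc n) X))"
    proof (rule dense_le)
      fix y assume y: "y < ennreal (f X)"
      then obtain c where c: "y = ennreal c" "0 \<le> c"
        by (cases y) (auto simp: top_unique)
      then have "c < f X" using y f(2) by (simp add: ennreal_less_iff)
      \<comment> \<open>Continuity enters here: f stays above c on a whole cylinder around X, so its
        infimum over that cylinder is at least c.\<close>
      moreover have "open (f -` {c<..})" using f(1) by (intro open_vimage) auto
      ultimately obtain n where n: "\<And>Y. (\<forall>i\<le>n. Y i = X i) \<Longrightarrow> c < f Y"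
        using open_contains_cylinder[of "f -` {c<..}" X] by auto
      have "y \<le> G n (prefix (Suc n) X)"
        unfolding G_def c(1)
      proof (rule INF_greatest)
        fix Y assume "Y \<in> {Y. prefix (Suc n) Y = prefix (Suc n) X}"
        then have "c < f Y" by (intro n) (auto simp: prefix_eq_iff less_Suc_eq_le)
        then show "ennreal c \<le> ennreal (f Y)" by (intro ennreal_leI) simp
      qed
      also have "\<dots> \<le> (SUP n. G n (prefix (Suc n) X))" by (rule SUP_upper) simp
      finally show "y \<le> (SUP n. G n (prefix (Suc n) X))" .
    qed
  qed
  have Gm: "(\<lambda>X. G n (prefix (Suc n) X)) \<in> borel_measurable \<mu>" for n
    by (rule measurable_compose[OF measurable_prefix[OF \<mu>]]) simp
  have e: "(\<lambda>N. emeasure (M N) (prefix (Suc n) -` {l})) \<longlonglongrightarrow> emeasure \<mu> (prefix (Suc n) -` {l})" for n l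
  proof (cases "length l = Suc n")
    case True
    have "(\<lambda>N. ennreal (measure (M N) {X. \<forall>i\<le>n. X i = l ! i})) \<longlonglongrightarrow> ennreal (measure \<mu> {X. \<forall>i\<le>n. X i = l ! i})"
      by (intro tendsto_ennrealI conv)
    then have "(\<lambda>N. emeasure (M N) {X. \<forall>i\<le>n. X i = l ! i}) \<longlonglongrightarrow> ennreal (measure \<mu> {X. \<forall>i\<le>n. X i = l ! i})"
      by (rule Lim_transform_eventually)
         (use fin(1) in eventually_elim, simp add: finite_measure.emeasure_eq_measure)
    then show ?thesis using True by (simp add: prefix_vimage finite_measure.emeasure_eq_measure[OF fin(2)])
  qed (simp add: prefix_vimage)
  have "(\<integral>\<^sup>+X. ennreal (f X) \<partial>\<mu>) = (SUP n. \<integral>\<^sup>+X. G n (prefix (Suc n) X) \<partial>\<mu>)"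
    unfolding G_sup[symmetric] by (rule nn_integral_monotone_convergence_SUP[OF G_inc Gm])
  also have "\<dots> \<le> liminf (\<lambda>N. \<integral>\<^sup>+X. ennreal (f X) \<partial>M N)"
  proof (rule SUP_least)
    fix n
    have "(\<integral>\<^sup>+X. G n (prefix (Suc n) X) \<partial>\<mu>) = (\<integral>\<^sup>+l. emeasure \<mu> (prefix (Suc n) -` {l}) * G n l \<partial>count_space UNIV)"
      by (rule nn_integral_prefix[OF \<mu>])
    also have "\<dots> \<le> (\<integral>\<^sup>+l. liminf (\<lambda>N. emeasure (M N) (prefix (Suc n) -` {l}) * G n l) \<partial>count_space UNIV)"
    proof (rule nn_integral_mono)
      fix l
      show "emeasure \<mu> (prefix (Suc n) -` {l}) * G n l \<le> liminf (\<lambda>N. emeasure (M N) (prefix (Suc n) -` {l}) * G n l)"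
      \<comment> \<open>Null cylinders are treated apart: \<open>G n l\<close> is infinite when
        \<open>l\<close> has the wrong length, being an infimum over the empty set, and the product
        is not continuous at 0 times infinity.\<close>
      proof (cases "emeasure \<mu> (prefix (Suc n) -` {l}) = 0")
        case False
        have "emeasure \<mu> (prefix (Suc n) -` {l}) \<noteq> \<infinity>"
          using finite_measure.emeasure_finite[OF fin(2)] by simp
        then have "(\<lambda>N. emeasure (M N) (prefix (Suc n) -` {l}) * G n l) \<longlonglongrightarrow> emeasure \<mu> (prefix (Suc n) -` {l}) * G n l"
          using False by (intro tendsto_mult_ennreal e tendsto_const) auto
        then show ?thesis using lim_imp_Liminf[of sequentially] by fastforce
      qed simp
    qed
    also have "\<dots> \<le> liminf (\<lambda>N. \<integral>\<^sup>+l. emeasure (M N) (prefix (Suc n) -` {l}) * G n l \<partial>count_space UNIV)"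
      by (rule nn_integral_liminf) simp
    also have "\<dots> = liminf (\<lambda>N. \<integral>\<^sup>+X. G n (prefix (Suc n) X) \<partial>M N)"
      by (simp only: nn_integral_prefix[OF M])
    also have "\<dots> \<le> liminf (\<lambda>N. \<integral>\<^sup>+X. ennreal (f X) \<partial>M N)"
      by (intro Liminf_mono always_eventually allI nn_integral_mono G_le)
    finally show "(\<integral>\<^sup>+X. G n (prefix (Suc n) X) \<partial>\<mu>) \<le> liminf (\<lambda>N. \<integral>\<^sup>+X. ennreal (f X) \<partial>M N)" .
  qed
  finally show ?thesis .
qed

text \<open>The Fatou bound for the nonnegative functions C + f and C - f, that is s = 1 and s = -1,
  gives the two halves of the limit. The laws are assumed to be probability measures only for large
  N, as conditioning on a null event gives the null measure.\<close>

lemma weakly_converges_of_cylinders: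
  fixes M :: "nat \<Rightarrow> (nat \<Rightarrow> site) measure"
  assumes M: "\<And>N. sets (M N) = sets borel" and \<mu>: "sets \<mu> = sets borel"
    and prob: "eventually (\<lambda>N. prob_space (M N)) sequentially" "prob_space \<mu>"
    and conv: "\<And>n a. (\<lambda>N. measure (M N) {X. \<forall>i\<le>n. X i = a i}) \<longlonglongrightarrow> measure \<mu> {X. \<forall>i\<le>n. X i = a i}"
  shows "weakly_converges M \<mu>"
  unfolding weakly_converges_def
proof (intro allI impI)
  fix f :: "(nat \<Rightarrow> site) \<Rightarrow> real"
  assume f: "continuous_on UNIV f" "bounded (range f)"
  then obtain C where C: "\<And>X. \<bar>f X\<bar> \<le> C" by (auto simp: bounded_iff)
  have C0: "0 \<le> C" using C[of "\<lambda>_. 0"] by linarith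
  have fin: "eventually (\<lambda>N. finite_measure (M N)) sequentially" "finite_measure \<mu>"
    using prob by (auto elim!: eventually_mono simp: prob_space_def)
  have int: "(\<integral>\<^sup>+X. ennreal (C + s * f X) \<partial>L) = ennreal (C + s * integral\<^sup>L L f)"
    "0 \<le> C + s * integral\<^sup>L L f"
    if L: "prob_space L" "sets L = sets borel" and s: "s = 1 \<or> s = -1" for L s
  proof -
    interpret prob_space L by fact
    have "f \<in> borel_measurable L"
      using borel_measurable_continuous_onI[OF f(1)] by (simp add: measurable_cong_sets[OF L(2) refl])
    then have i: "integrable L f" using C by (intro integrable_const_bound[of _ C]) auto
    have p: "0 \<le> C + s * f X" for X using C[of X] s by auto
    have "integral\<^sup>L L (\<lambda>X. C + s * f X) = C + s * integral\<^sup>L L f"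
      using i by (simp add: prob_space)
    moreover have "(\<integral>\<^sup>+X. ennreal (C + s * f X) \<partial>L) = ennreal (integral\<^sup>L L (\<lambda>X. C + s * f X))"
      using i p by (intro nn_integral_eq_integral) auto
    moreover have "0 \<le> integral\<^sup>L L (\<lambda>X. C + s * f X)" using p by (intro integral_nonneg_AE) auto
    ultimately show "(\<integral>\<^sup>+X. ennreal (C + s * f X) \<partial>L) = ennreal (C + s * integral\<^sup>L L f)"
      "0 \<le> C + s * integral\<^sup>L L f" by auto
  qed
  have key: "eventually (\<lambda>N. c < s * integral\<^sup>L (M N) f) sequentially"
    if s: "s = 1 \<or> s = -1" and c: "c < s * integral\<^sup>L \<mu> f" for s c
  \<comment> \<open>\<open>ennreal\<close> truncates negative numbers to 0. If C + c < 0, the claim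
    already follows from C + s * f being nonnegative.\<close>
  proof (cases "C + c < 0")
    case True
    show ?thesis using prob(1)
      by eventually_elim (use True int(2)[OF _ M s] in fastforce)
  next
    case False
    have "ennreal (C + s * integral\<^sup>L \<mu> f) \<le> liminf (\<lambda>N. \<integral>\<^sup>+X. ennreal (C + s * f X) \<partial>M N)"
      unfolding int(1)[OF prob(2) \<mu> s, symmetric]
    proof (rule nn_integral_le_liminf_of_cylinders[OF M \<mu> fin conv])
      show "continuous_on UNIV (\<lambda>X. C + s * f X)" by (intro continuous_intros f)
      show "0 \<le> C + s * f X" for X using C[of X] s by auto
    qed
    moreover have "ennreal (C + c) < ennreal (C + s * integral\<^sup>L \<mu> f)"
      using c False by (simp add: ennreal_less_iff)
    ultimately have "ennreal (C + c) < liminf (\<lambda>N. \<integral>\<^sup>+X. ennreal (C + s * f X) \<partial>M N)" by simp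
    from less_LiminfD[OF this] prob(1) show ?thesis
    proof eventually_elim
      case (elim N)
      then show ?case using False by (simp add: int(1)[OF elim(2) M s] ennreal_less_iff)
    qed
  qed
  show "(\<lambda>N. integral\<^sup>L (M N) f) \<longlonglongrightarrow> integral\<^sup>L \<mu> f"
  proof (rule order_tendstoI)
    fix c assume "c < integral\<^sup>L \<mu> f"
    then show "eventually (\<lambda>N. c < integral\<^sup>L (M N) f) sequentially" using key[of 1 c] by simp
  next
    fix c assume "integral\<^sup>L \<mu> f < c"
    then have "eventually (\<lambda>N. - c < -1 * integral\<^sup>L (M N) f) sequentially" by (intro key) auto
    then show "eventually (\<lambda>N. integral\<^sup>L (M N) f < c) sequentially" by eventually_elim simp
  qed
qed

lemma weakly_converges_cond_path_law:
  assumes el: "elliptic \<omega>" and t: "0 < t" "t < 1"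
    and lim: "\<And>x. \<exists>r>0. has_corner_limit \<omega> x (t, 1 - t) r"
    and z: "\<And>N. l1 (z N) = N" "(\<lambda>N. rvec (z N) /\<^sub>R real N) \<longlonglongrightarrow> (t, 1 - t)"
  shows "weakly_converges (\<lambda>N. cond_path_law (env_trans \<omega>) 0 N (z N)) (path_law (kappa (t, 1 - t) \<omega>) 0)"
proof (rule weakly_converges_of_cylinders)
  note nn = nn_trans_elliptic[OF el]
  have nk: "nn_trans (kappa (t, 1 - t) \<omega>)" by (rule nn_trans_kappa_elliptic[OF el t lim])
  have dir: "to_infinity_in_direction z (t, 1 - t)"
    using z by (simp add: to_infinity_in_direction_def filterlim_ident)
  show "sets (cond_path_law (env_trans \<omega>) 0 N (z N)) = sets borel" for N
    by (simp add: cond_path_law_def sets_path_law[OF nn])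
  show "sets (path_law (kappa (t, 1 - t) \<omega>) 0) = sets borel" by (rule sets_path_law[OF nk])
  show "prob_space (path_law (kappa (t, 1 - t) \<omega>) 0)" by (rule prob_space_path_law[OF nk])
  have lvl: "fst (z N) + snd (z N) = int N" if "0 \<le> fst (z N)" "0 \<le> snd (z N)" for N
    using z(1)[of N] that by (simp add: l1_def)
  interpret P: prob_space "path_law (env_trans \<omega>) 0" by (rule prob_space_path_law[OF nn])
  show "eventually (\<lambda>N. prob_space (cond_path_law (env_trans \<omega>) 0 N (z N))) sequentially"
    using to_infinity_ge[OF dir t, of 0]
  proof eventually_elim
    case (elim N)
    have "measure (path_law (env_trans \<omega>) 0) {X. X N = z N} > 0"
      using elim lvl[of N] by (simp add: measure_path_law_visit[OF el] visit_prob_pos[OF el])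
    then show ?case unfolding cond_path_law_def
      by (intro prob_space_uniform_measure) (auto simp: P.emeasure_eq_measure)
  qed
  fix n and a :: "nat \<Rightarrow> site"
  define R where "R N = of_bool (a 0 = 0) * (\<Prod>i<n. env_trans \<omega> (a i) (a (Suc i)) *
      visit_prob \<omega> (a (Suc i)) (z N) / visit_prob \<omega> (a i) (z N))" for N
  have "R \<longlonglongrightarrow> of_bool (a 0 = 0) * (\<Prod>i<n. kappa (t, 1 - t) \<omega> (a i) (a (Suc i)))"
    unfolding R_def
  proof (intro tendsto_mult tendsto_const tendsto_prod)
    fix i
    obtain r where r: "r > 0" "has_corner_limit \<omega> (a i) (t, 1 - t) r" using lim by blast
    show "(\<lambda>N. env_trans \<omega> (a i) (a (Suc i)) * visit_prob \<omega> (a (Suc i)) (z N) / visit_prob \<omega> (a i) (z N))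
      \<longlonglongrightarrow> kappa (t, 1 - t) \<omega> (a i) (a (Suc i))"
      by (rule visit_ratio_tendsto_kappa[OF el t r dir])
  qed
  moreover have "eventually (\<lambda>N. R N = measure (cond_path_law (env_trans \<omega>) 0 N (z N)) {X. \<forall>i\<le>n. X i = a i}) sequentially"
  proof -
    \<comment> \<open>A common bound for the coordinates of the prefix: once z dominates it, every
      denominator of \<open>R\<close> is positive.\<close>
    define c where "c = (\<Sum>i<n. \<bar>fst (a i)\<bar> + \<bar>snd (a i)\<bar>)"
    have c: "fst (a i) \<le> c" "snd (a i) \<le> c" if "i < n" for i
    proof -
      have "\<bar>fst (a i)\<bar> + \<bar>snd (a i)\<bar> \<le> c"
        unfolding c_def using that by (intro member_le_sum) auto
      then show "fst (a i) \<le> c" "snd (a i) \<le> c" by auto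
    qed
    show ?thesis
      using to_infinity_ge[OF dir t, of "max c (int n)"]
    proof eventually_elim
      case (elim N)
      have N: "fst (z N) + snd (z N) = int N" using elim by (intro lvl) auto
      show ?case unfolding R_def
      proof (rule cond_path_law_prefix[symmetric, OF el _ N])
        show "visit_prob \<omega> 0 (z N) > 0" using elim by (intro visit_prob_pos el) auto
        show "n \<le> N" using N elim by auto
        show "visit_prob \<omega> (a i) (z N) > 0" if "i < n" for i
          using elim c[OF that] by (intro visit_prob_pos el) auto
      qed
    qed
  qed
  ultimately show "(\<lambda>N. measure (cond_path_law (env_trans \<omega>) 0 N (z N)) {X. \<forall>i\<le>n. X i = a i})
    \<longlonglongrightarrow> measure (path_law (kappa (t, 1 - t) \<omega>) 0) {X. \<forall>i\<le>n. X i = a i}"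
    unfolding measure_path_law_prefix[OF nk] by (rule Lim_transform_eventually)
qed

text \<open>The space of \<open>env_measure\<close> is the unit cube, that of \<open>env_law\<close>
  consists of all real functions. The identity transports one law to the other and carries almost
  sure statements back.\<close>

lemma (in beta_parameters) distr_env_measure:
  "distr (env_measure \<alpha> \<beta>) (PiM UNIV (\<lambda>_. borel)) (\<lambda>\<omega>. \<omega>) = env_law"
  and env_measure_measurable: "(\<lambda>\<omega>. \<omega>) \<in> measurable (env_measure \<alpha> \<beta>) (PiM UNIV (\<lambda>_. borel))"
proof -
  have m: "(\<lambda>x. x) \<in> measurable (beta_measure \<alpha> \<beta>) borel"
    unfolding beta_measure_def by (simp add: measurable_restrict_space1)
  have "distr (PiM UNIV (\<lambda>_ :: site. beta_measure \<alpha> \<beta>)) (PiM UNIV (\<lambda>_. borel)) (\<lambda>X j. X j) =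
    PiM UNIV (\<lambda>j. distr (beta_measure \<alpha> \<beta>) borel (\<lambda>t. t))"
    using ab m by (intro distr_PiM_map[of "\<lambda>_. beta_measure \<alpha> \<beta>" "\<lambda>x. x" "\<lambda>_ t. t"] prob_space_beta_measure) auto
  then show "distr (env_measure \<alpha> \<beta>) (PiM UNIV (\<lambda>_. borel)) (\<lambda>\<omega>. \<omega>) = env_law"
    using ab by (simp add: env_measure_def env_law_def beta_law_eq_distr)
  have "(\<lambda>\<omega>. \<omega> i) \<in> borel_measurable (env_measure \<alpha> \<beta>)" for i
    unfolding env_measure_def by (rule measurable_compose[OF measurable_component_singleton[of i UNIV "\<lambda>_. beta_measure \<alpha> \<beta>"] m]) simp
  then show "(\<lambda>\<omega>. \<omega>) \<in> measurable (env_measure \<alpha> \<beta>) (PiM UNIV (\<lambda>_. borel))"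
    by (intro measurable_PiM_single') auto
qed

theorem theorem2p3:
  fixes \<alpha> \<beta> :: real and \<xi> :: "real \<times> real"
  assumes "\<alpha> > 0" and "\<beta> > 0" and "\<xi> \<in> riU"
  shows "\<exists>\<Omega>\<^sub>\<xi> \<in> sets (env_measure \<alpha> \<beta>).
    measure (env_measure \<alpha> \<beta>) \<Omega>\<^sub>\<xi> = 1 \<and>
    (\<forall>\<omega> \<in> \<Omega>\<^sub>\<xi>. \<forall>z :: nat \<Rightarrow> site.
       (\<forall>N. l1 (z N) = N) \<longrightarrow> (\<lambda>N. rvec (z N) /\<^sub>R real N) \<longlonglongrightarrow> \<xi> \<longrightarrow>
       weakly_converges (\<lambda>N. cond_path_law (env_trans \<omega>) 0 N (z N)) (path_law (kappa \<xi> \<omega>) 0))"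
proof -
  interpret beta_parameters \<alpha> \<beta> using assms by unfold_locales
  interpret E: prob_space "env_measure \<alpha> \<beta>" by (rule prob_space_env_measure[OF assms(1,2)])
  obtain t where t: "0 < t" "t < 1" and \<xi>: "\<xi> = (t, 1 - t)"
    using assms(3) by (auto simp: riU_def rvec_def e1_def e2_def)
  have "AE \<omega> in env_law. elliptic \<omega> \<and> (\<forall>x. \<exists>r>0. has_corner_limit \<omega> x (t, 1 - t) r)"
    using AE_elliptic AE_corner_limit_all[OF t] by eventually_elim blast
  then have "AE \<omega> in env_measure \<alpha> \<beta>. elliptic \<omega> \<and> (\<forall>x. \<exists>r>0. has_corner_limit \<omega> x (t, 1 - t) r)"
    unfolding distr_env_measure[symmetric] by (rule AE_distrD[OF env_measure_measurable])
  \<comment> \<open>A measurable null set covering the exceptional environments; its complement is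
    the required event.\<close>
  then obtain S where S: "{\<omega> \<in> space (env_measure \<alpha> \<beta>). \<not> (elliptic \<omega> \<and> (\<forall>x. \<exists>r>0. has_corner_limit \<omega> x (t, 1 - t) r))} \<subseteq> S"
      "emeasure (env_measure \<alpha> \<beta>) S = 0" "S \<in> sets (env_measure \<alpha> \<beta>)"
    by (rule AE_E)
  show ?thesis
  proof (intro bexI conjI ballI allI impI)
    show "space (env_measure \<alpha> \<beta>) - S \<in> sets (env_measure \<alpha> \<beta>)" using S by auto
    show "measure (env_measure \<alpha> \<beta>) (space (env_measure \<alpha> \<beta>) - S) = 1"
      using S by (subst E.prob_compl) (auto simp: measure_def)
    fix \<omega> and z :: "nat \<Rightarrow> site"
    assume "\<omega> \<in> space (env_measure \<alpha> \<beta>) - S"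
    then have \<omega>: "elliptic \<omega>" "\<And>x. \<exists>r>0. has_corner_limit \<omega> x (t, 1 - t) r" using S(1) by blast+
    assume "\<forall>N. l1 (z N) = N" "(\<lambda>N. rvec (z N) /\<^sub>R real N) \<longlonglongrightarrow> \<xi>"
    then show "weakly_converges (\<lambda>N. cond_path_law (env_trans \<omega>) 0 N (z N)) (path_law (kappa \<xi> \<omega>) 0)"
      unfolding \<xi> using weakly_converges_cond_path_law[OF \<omega>(1) t \<omega>(2)] by blast
  qed
qed

end
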